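(* Let $X,H$ be finite-dimensional Euclidean spaces, $f:X\to\mathbb{R}$ and $g:X\to H$ twice differentiable, and $K\subseteq H$ a nonempty closed convex $\mathcal{C}^2$-cone reducible set. Let $(\bar x,\bar\lambda)$ be a KKT point of the problem $\min_{x\in X} f(x)$ s.t. $g(x)\in K$. Suppose that the second-order sufficient condition (SOSC) holds at $(\bar x,\bar\lambda)$ and that the multiplier mapping $M_{\bar x}$ is calm at the origin for $\bar\lambda$. Let $\epsilon:\mathbb{R}_+\to\mathbb{R}_+$ be a function with $\epsilon(t)=o(t)$ as $t\downarrow 0$. Then there exist positive constants $\hat\alpha,\bar c,\varepsilon_0$ such that for any initial point $(x^0,\lambda^0)\in B_{\varepsilon_0}(\bar x,\bar\lambda)$ and any sequence $\{c_k\}$ with $c_k\ge\bar c$ for all $k$, there exists a sequence $\{(x^k,\lambda^k)\}$ starting at $(x^0,\lambda^0)$ such that for every $k\ge 0$, with $\epsilon_k:=\epsilon(r(x^k,\lambda^k))$, $$\|\nabla_x\mathcal{L}(x^{k+1},\lambda^k,c_k)+c_k^{-1}(x^{k+1}-x^k)\|\le\epsilon_k,$$ $$\lambda^{k+1}=c_kg(x^{k+1})+\lambda^k-\Pi_K\left(c_kg(x^{k+1})+\lambda^k\right),$$ $$\|x^{k+1}-x^k\|+\|\lambda^{k+1}-\lambda^k\|\le\hat\alpha\, r(x^k,\lambda^k).$$ Furthermore, any such sequence $\{(x^k,\lambda^k)\}$ converges to $(\bar x,\hat\lambda)$ for some $\hat\lambda\in\Lambda(\bar x)$; the convergence of $\{(x^k,\lambda^k)\}$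 to $(\bar x,\hat\lambda)$ and the convergence of $\mathrm{dist}\big((x^k,\lambda^k),\{\bar x\}\times\Lambda(\bar x)\big)$ to zero are both at a Q-linear rate. If in addition $c_k\to\infty$, both convergence rates are Q-superlinear.
   Context: Notation. $B_\varepsilon(x)$ is the closed ball of radius $\varepsilon$ centered at $x$; $\mathbb{B}$ denotes a closed unit ball centered at the origin; $\mathrm{dist}(x,S)=\inf_{y\in S}\|y-x\|$; $\Pi_S$ is the projection onto a closed convex set $S$; $\mathcal{J}g(x)$ is the derivative of $g$ and $\nabla g(x)$ its adjoint. For $y\in K$, $\mathcal{N}_K(y)=\{v: \langle v,z-y\rangle\le 0\ \forall z\in K\}$ (empty if $y\notin K$) and $\mathcal{T}_K(y)$ is the tangent (contingent) cone. $\mathcal{C}^2$-cone reducibility: $K$ is $\mathcal{C}^2$-cone reducible if for every $y_0\in K$ there exist a finite-dimensional space $Z$, a pointed closed convex cone $C\subset Z$, a neighborhood $N$ of $y_0$ and a twice continuously differentiable map $\Theta:N\to Z$ such that $\Theta(y_0)=0$, $\Theta'(y_0)$ is surjective and $K\cap N=\Theta^{-1}(C)\cap N$. Lagrangian: $L(x,\lambda)=f(x)+\langle\lambda,g(x)\rangle$. A KKT point is a pair $(\bar x,\bar\lambda)$ with $\nabla_xL(\bar x,\bar\lambda)=\nabla f(\bar x)+\nabla g(\bar x)\bar\lambda=0$ and $\bar\lambda\in\mathcal{N}_K(g(\bar x))$. The multiplier set is $\Lambda(\bar x)=\{\lambda\in H:\nabla_xL(\bar x,\lambda)=0,\ \lambda\in\mathcal{N}_K(g(\bar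 x))\}$. Augmented Lagrangian, for $c>0$: $\mathcal{L}(x,\lambda,c)=f(x)+\frac c2\mathrm{dist}^2\left(g(x)+c^{-1}\lambda,K\right)-\frac{1}{2c}\|\lambda\|^2$. Residual: $r(x,\lambda)=\|\nabla_xL(x,\lambda)\|+\|g(x)-\Pi_K(g(x)+\lambda)\|$. SOSC at $(\bar x,\bar\lambda)$: $\langle\nabla^2_{xx}L(\bar x,\bar\lambda)d,d\rangle-\sigma\left(\bar\lambda,\mathcal{T}_K^2(g(\bar x),\mathcal{J}g(\bar x)d)\right)>0$ for all $d\in C(\bar x)\setminus\{0\}$, where $C(\bar x)=\{d\in X:\mathcal{J}g(\bar x)d\in\mathcal{T}_K(g(\bar x)),\ \langle\mathcal{J}g(\bar x)d,\bar\lambda\rangle=0\}$ is the critical cone, $\sigma(y,C)=\sup_{z\in C}\langle y,z\rangle$ is the support function, and $\mathcal{T}_K^2(y,h)=\{w\in H:\mathrm{dist}(y+th+\frac12t^2w,K)=o(t^2),\ t\ge0\}$ is the second-order tangent set. Multiplier mapping: $M_{\bar x}(a,b)=\{\lambda\in H: a=\nabla_xL(\bar x,\lambda),\ \lambda\in\mathcal{N}_K(g(\bar x)-b)\}$ for $(a,b)\in X\times H$, so $M_{\bar x}(0,0)=\Lambda(\bar x)$. It is calm at the origin for $\bar\lambda$ if there are $l,\varepsilon,\delta>0$ with $M_{\bar x}(a,b)\cap B_\varepsilon(\bar\lambda)\subset\Lambda(\bar x)+l(\|a\|+\|b\|)\mathbb{B}_H$ whenever $\|(a,b)\|\le\delta$.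 Rates: a sequence $u^k\to\hat u$ converges Q-linearly if there is $q\in(0,1)$ with $\|u^{k+1}-\hat u\|\le q\|u^k-\hat u\|$ for all large $k$, and Q-superlinearly if $\|u^{k+1}-\hat u\|\le q_k\|u^k-\hat u\|$ for some $q_k\to0$; likewise for nonnegative scalar sequences tending to zero.
   Formalization: The multiplier update is formalized with the projection onto the scaled set c_k K instead of K; the two agree when K is a cone, and for general convex K the printed formula makes the claim false (f=0, g(x)=x, K={1}, solution (1,0), c_0>1). *)

theory Defs
  imports "HOL-Analysis.Analysis" "HOL-Library.Landau_Symbols"
begin

section \<open>Derivatives\<close>

text \<open>\<open>\<nabla>f(x) = Df(x)\<^sup>* 1\<close>, the adjoint of the derivative applied to the unit of the reals.\<close>

definition gradient :: "('a::euclidean_space \<Rightarrow> real) \<Rightarrow> 'a \<Rightarrow> 'a" where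
  "gradient f x = adjoint (frechet_derivative f (at x)) 1"

definition twice_differentiable :: "('a::real_normed_vector \<Rightarrow> 'b::real_normed_vector) \<Rightarrow> bool" where
  "twice_differentiable f \<longleftrightarrow>
     (\<exists>f' :: 'a \<Rightarrow> 'a \<Rightarrow>\<^sub>L 'b.
        (\<forall>x. (f has_derivative blinfun_apply (f' x)) (at x)) \<and> (\<forall>x. f' differentiable (at x)))"

definition twice_continuously_differentiable_on ::
    "'a::real_normed_vector set \<Rightarrow> ('a \<Rightarrow> 'b::real_normed_vector) \<Rightarrow> bool" where
  "twice_continuously_differentiable_on N f \<longleftrightarrow>
     (\<exists>(f' :: 'a \<Rightarrow> 'a \<Rightarrow>\<^sub>L 'b) (f'' :: 'a \<Rightarrow> 'a \<Rightarrow>\<^sub>L ('a \<Rightarrow>\<^sub>L 'b)).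
        (\<forall>x\<in>N. (f has_derivative blinfun_apply (f' x)) (at x)) \<and>
        (\<forall>x\<in>N. (f' has_derivative blinfun_apply (f'' x)) (at x)) \<and>
        continuous_on N f'')"

section \<open>Convex and variational geometry\<close>

definition pointed_cone :: "'a::real_vector set \<Rightarrow> bool" where
  "pointed_cone C \<longleftrightarrow> cone C \<and> C \<inter> uminus ` C = {0}"

text \<open>The space \<open>Z\<close> of the definition of \<open>C\<^sup>2\<close>-cone reducibility may depend on the point, so it cannot
  be a type. Since the derivative of \<open>\<Theta>\<close> maps the ambient space onto \<open>Z\<close>, the dimension of \<open>Z\<close> is at
  most that of the ambient space, and \<open>Z\<close> can be taken to be a linear subspace of it.
  Neighbourhoods are taken to be open.\<close>

definition C2_cone_reducible :: "'h::euclidean_space set \<Rightarrow> bool" where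
  "C2_cone_reducible K \<longleftrightarrow>
     (\<forall>y0\<in>K. \<exists>Z C N (\<Theta> :: 'h \<Rightarrow> 'h).
        subspace Z \<and>
        C \<subseteq> Z \<and> pointed_cone C \<and> closed C \<and> convex C \<and>
        open N \<and> y0 \<in> N \<and>
        \<Theta> ` N \<subseteq> Z \<and> twice_continuously_differentiable_on N \<Theta> \<and>
        \<Theta> y0 = 0 \<and> range (frechet_derivative \<Theta> (at y0)) = Z \<and>
        K \<inter> N = (\<Theta> -` C) \<inter> N)"

definition normal_cone :: "'h::real_inner set \<Rightarrow> 'h \<Rightarrow> 'h set" where
  "normal_cone K y = {v. y \<in> K \<and> (\<forall>z\<in>K. v \<bullet> (z - y) \<le> 0)}"

definition tangent_cone :: "'h::real_normed_vector set \<Rightarrow> 'h \<Rightarrow> 'h set" where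
  "tangent_cone K y =
     {h. \<exists>(t :: nat \<Rightarrow> real) w. (\<forall>k. t k > 0) \<and> t \<longlonglongrightarrow> 0 \<and> w \<longlonglongrightarrow> h \<and> (\<forall>k. y + t k *\<^sub>R w k \<in> K)}"

definition second_order_tangent_set :: "'h::real_normed_vector set \<Rightarrow> 'h \<Rightarrow> 'h \<Rightarrow> 'h set" where
  "second_order_tangent_set K y h =
     {w. (\<lambda>t. infdist (y + t *\<^sub>R h + (t\<^sup>2 / 2) *\<^sub>R w) K) \<in> o[at_right 0](\<lambda>t. t\<^sup>2)}"

text \<open>Extended-real valued, so that the support function of the empty set is \<open>-\<infinity>\<close>.\<close>

definition support_function :: "'h::real_inner \<Rightarrow> 'h set \<Rightarrow> ereal" where
  "support_function y S = (SUP z\<in>S. ereal (y \<bullet> z))"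

section \<open>The problem of minimising \<open>f x\<close> subject to \<open>g x \<in> K\<close>\<close>

definition lagrangian :: "('x \<Rightarrow> real) \<Rightarrow> ('x \<Rightarrow> 'h::real_inner) \<Rightarrow> 'x \<Rightarrow> 'h \<Rightarrow> real" where
  "lagrangian f g x l = f x + l \<bullet> g x"

definition grad_lagrangian ::
    "('x::euclidean_space \<Rightarrow> real) \<Rightarrow> ('x \<Rightarrow> 'h::real_inner) \<Rightarrow> 'x \<Rightarrow> 'h \<Rightarrow> 'x" where
  "grad_lagrangian f g x l = gradient (\<lambda>y. lagrangian f g y l) x"

definition hess_lagrangian ::
    "('x::euclidean_space \<Rightarrow> real) \<Rightarrow> ('x \<Rightarrow> 'h::real_inner) \<Rightarrow> 'x \<Rightarrow> 'h \<Rightarrow> 'x \<Rightarrow> 'x" where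
  "hess_lagrangian f g x l = frechet_derivative (\<lambda>y. grad_lagrangian f g y l) (at x)"

definition KKT_point ::
    "('x::euclidean_space \<Rightarrow> real) \<Rightarrow> ('x \<Rightarrow> 'h::real_inner) \<Rightarrow> 'h set \<Rightarrow> 'x \<Rightarrow> 'h \<Rightarrow> bool" where
  "KKT_point f g K x l \<longleftrightarrow> grad_lagrangian f g x l = 0 \<and> l \<in> normal_cone K (g x)"

definition multiplier_set ::
    "('x::euclidean_space \<Rightarrow> real) \<Rightarrow> ('x \<Rightarrow> 'h::real_inner) \<Rightarrow> 'h set \<Rightarrow> 'x \<Rightarrow> 'h set" where
  "multiplier_set f g K x = {l. grad_lagrangian f g x l = 0 \<and> l \<in> normal_cone K (g x)}"

definition aug_lagrangian ::
    "('x \<Rightarrow> real) \<Rightarrow> ('x \<Rightarrow> 'h::real_inner) \<Rightarrow> 'h set \<Rightarrow> 'x \<Rightarrow> 'h \<Rightarrow> real \<Rightarrow> real" where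
  "aug_lagrangian f g K x l c =
     f x + c / 2 * (infdist (g x + inverse c *\<^sub>R l) K)\<^sup>2 - 1 / (2 * c) * (norm l)\<^sup>2"

definition grad_aug_lagrangian ::
    "('x::euclidean_space \<Rightarrow> real) \<Rightarrow> ('x \<Rightarrow> 'h::real_inner) \<Rightarrow> 'h set \<Rightarrow> 'x \<Rightarrow> 'h \<Rightarrow> real \<Rightarrow> 'x" where
  "grad_aug_lagrangian f g K x l c = gradient (\<lambda>y. aug_lagrangian f g K y l c) x"

definition residual ::
    "('x::euclidean_space \<Rightarrow> real) \<Rightarrow> ('x \<Rightarrow> 'h::euclidean_space) \<Rightarrow> 'h set \<Rightarrow> 'x \<Rightarrow> 'h \<Rightarrow> real" where
  "residual f g K x l = norm (grad_lagrangian f g x l) + norm (g x - closest_point K (g x + l))"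

definition critical_cone ::
    "('x::euclidean_space \<Rightarrow> 'h::real_inner) \<Rightarrow> 'h set \<Rightarrow> 'x \<Rightarrow> 'h \<Rightarrow> 'x set" where
  "critical_cone g K x l =
     {d. frechet_derivative g (at x) d \<in> tangent_cone K (g x) \<and>
         frechet_derivative g (at x) d \<bullet> l = 0}"

definition SOSC ::
    "('x::euclidean_space \<Rightarrow> real) \<Rightarrow> ('x \<Rightarrow> 'h::real_inner) \<Rightarrow> 'h set \<Rightarrow> 'x \<Rightarrow> 'h \<Rightarrow> bool" where
  "SOSC f g K x l \<longleftrightarrow>
     (\<forall>d \<in> critical_cone g K x l - {0}.
        ereal (hess_lagrangian f g x l d \<bullet> d)
          - support_function l
              (second_order_tangent_set K (g x) (frechet_derivative g (at x) d)) > 0)"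

definition multiplier_map ::
    "('x::euclidean_space \<Rightarrow> real) \<Rightarrow> ('x \<Rightarrow> 'h::real_inner) \<Rightarrow> 'h set \<Rightarrow> 'x \<Rightarrow> 'x \<Rightarrow> 'h \<Rightarrow> 'h set" where
  "multiplier_map f g K x a b = {l. a = grad_lagrangian f g x l \<and> l \<in> normal_cone K (g x - b)}"

definition multiplier_map_calm ::
    "('x::euclidean_space \<Rightarrow> real) \<Rightarrow> ('x \<Rightarrow> 'h::real_inner) \<Rightarrow> 'h set \<Rightarrow> 'x \<Rightarrow> 'h \<Rightarrow> bool" where
  "multiplier_map_calm f g K x l \<longleftrightarrow>
     (\<exists>\<kappa>>0. \<exists>\<epsilon>>0. \<exists>\<delta>>0. \<forall>a b. norm (a, b) \<le> \<delta> \<longrightarrow>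
        multiplier_map f g K x a b \<inter> cball l \<epsilon>
          \<subseteq> {m + w | m w. m \<in> multiplier_set f g K x \<and> w \<in> cball 0 (\<kappa> * (norm a + norm b))})"

section \<open>The inexact proximal method of multipliers\<close>

text \<open>The multiplier update projects onto the scaled set \<open>c K\<close>, i.e. it is
  \<open>\<lambda>\<^sup>+ = c (g(x\<^sup>+) + \<lambda>/c - \<Pi>\<^sub>K(g(x\<^sup>+) + \<lambda>/c))\<close>, for which the gradient of the augmented Lagrangian at
  \<open>(x\<^sup>+, \<lambda>, c)\<close> equals the gradient of the Lagrangian at \<open>(x\<^sup>+, \<lambda>\<^sup>+)\<close>. If \<open>K\<close> is a cone then
  \<open>c K = K\<close>, and the update is the familiar
  \<open>\<lambda>\<^sup>+ = c g(x\<^sup>+) + \<lambda> - \<Pi>\<^sub>K(c g(x\<^sup>+) + \<lambda>)\<close>. For other convex sets the latter formula is not the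
  multiplier update: for \<open>K = {1}\<close> and \<open>g(x) = x\<close> it does not even keep solutions fixed unless
  \<open>c = 1\<close>.\<close>

definition multiplier_update :: "'h::euclidean_space set \<Rightarrow> real \<Rightarrow> 'h \<Rightarrow> 'h \<Rightarrow> 'h" where
  "multiplier_update K c y l = c *\<^sub>R y + l - closest_point ((\<lambda>z. c *\<^sub>R z) ` K) (c *\<^sub>R y + l)"

lemma multiplier_update_cone:
  assumes "cone K" "c > 0"
  shows "multiplier_update K c y l = c *\<^sub>R y + l - closest_point K (c *\<^sub>R y + l)"
proof (cases "K = {}")
  case False
  then have "(\<lambda>z. c *\<^sub>R z) ` K = K"
    using cone_iff[of K] assms by simp
  then show ?thesis
    by (simp add: multiplier_update_def)
qed (simp add: multiplier_update_def)

lemma multiplier_update_alt: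
  assumes "closed K" "convex K" "K \<noteq> {}" "c > 0"
  shows "multiplier_update K c y l
           = c *\<^sub>R (y + inverse c *\<^sub>R l - closest_point K (y + inverse c *\<^sub>R l))"
proof -
  let ?z = "y + inverse c *\<^sub>R l"
  let ?p = "closest_point K ?z"
  have p: "?p \<in> K" "\<forall>z\<in>K. dist ?z ?p \<le> dist ?z z"
    using closest_point_exists[of K ?z] assms by auto
  have z: "c *\<^sub>R y + l = c *\<^sub>R ?z"
    using assms by (simp add: algebra_simps)
  have "c *\<^sub>R ?p = closest_point ((\<lambda>z. c *\<^sub>R z) ` K) (c *\<^sub>R ?z)"
  proof (rule closest_point_unique)
    show "convex ((\<lambda>z. c *\<^sub>R z) ` K)" "closed ((\<lambda>z. c *\<^sub>R z) ` K)"
      using assms by (auto intro: convex_scaling closed_scaling)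
    show "c *\<^sub>R ?p \<in> (\<lambda>z. c *\<^sub>R z) ` K"
      using p by blast
    have "dist (c *\<^sub>R u) (c *\<^sub>R v) = c * dist u v" for u v :: 'a
      using \<open>c > 0\<close> by (simp add: dist_norm flip: scaleR_diff_right)
    then show "\<forall>w\<in>(\<lambda>z. c *\<^sub>R z) ` K. dist (c *\<^sub>R ?z) (c *\<^sub>R ?p) \<le> dist (c *\<^sub>R ?z) w"
      using p \<open>c > 0\<close> by auto
  qed
  then show ?thesis
    unfolding multiplier_update_def z by (simp add: scaleR_diff_right)
qed

definition pmm_sequence ::
    "('x::euclidean_space \<Rightarrow> real) \<Rightarrow> ('x \<Rightarrow> 'h::euclidean_space) \<Rightarrow> 'h set \<Rightarrow> (real \<Rightarrow> real) \<Rightarrow> real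
      \<Rightarrow> (nat \<Rightarrow> real) \<Rightarrow> (nat \<Rightarrow> 'x) \<Rightarrow> (nat \<Rightarrow> 'h) \<Rightarrow> bool" where
  "pmm_sequence f g K eps \<alpha> c x l \<longleftrightarrow>
     (\<forall>k. norm (grad_aug_lagrangian f g K (x (Suc k)) (l k) (c k)
                  + inverse (c k) *\<^sub>R (x (Suc k) - x k))
            \<le> eps (residual f g K (x k) (l k)) \<and>
          l (Suc k) = multiplier_update K (c k) (g (x (Suc k))) (l k) \<and>
          norm (x (Suc k) - x k) + norm (l (Suc k) - l k) \<le> \<alpha> * residual f g K (x k) (l k))"

section \<open>Rates of convergence\<close>

definition converges_Q_linearly :: "(nat \<Rightarrow> 'a::real_normed_vector) \<Rightarrow> 'a \<Rightarrow> bool" where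
  "converges_Q_linearly u v \<longleftrightarrow>
     u \<longlonglongrightarrow> v \<and>
     (\<exists>q. 0 < q \<and> q < 1 \<and> (\<forall>\<^sub>F k in sequentially. norm (u (Suc k) - v) \<le> q * norm (u k - v)))"

definition converges_Q_superlinearly :: "(nat \<Rightarrow> 'a::real_normed_vector) \<Rightarrow> 'a \<Rightarrow> bool" where
  "converges_Q_superlinearly u v \<longleftrightarrow>
     u \<longlonglongrightarrow> v \<and>
     (\<exists>q :: nat \<Rightarrow> real. q \<longlonglongrightarrow> 0 \<and> (\<forall>k. norm (u (Suc k) - v) \<le> q k * norm (u k - v)))"

end

theory Submission
  imports Defs
begin

text \<open>Near \<open>g xbar\<close>, reducibility gives a chart with derivative the identity that maps \<open>K\<close> to a cone, so
  that the curvature of \<open>K\<close> is a quadratic form \<open>Q h = \<langle>lbar, \<Phi>'' h h\<rangle>\<close>: it bounds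
  \<open>-\<sigma>(lbar, T\<^sup>2(h))\<close> from above, and \<open>Q (p - g xbar) / 2\<close> bounds, up to second order, both
  \<open>-\<langle>m, p - g xbar\<rangle>\<close> for normals \<open>m\<close> at \<open>g xbar\<close> and \<open>\<langle>l, p - g xbar\<rangle>\<close> for normals \<open>l\<close> at \<open>p\<close>
  from below. A compactness argument turns the second-order condition into a coercivity estimate for
  \<open>H d + Q h\<close>, where \<open>H\<close> is the Hessian form of the Lagrangian.

  The estimate has two consequences. First, \<open>f x + \<langle>m, g x - p\<rangle> + c |g x - p|\<^sup>2 / 2\<close> grows
  quadratically in \<open>x - xbar\<close>, uniformly in \<open>p \<in> K\<close> and in the multipliers \<open>m\<close> near \<open>lbar\<close>. Comparing a
  minimiser over a ball of the proximal augmented Lagrangian with \<open>xbar\<close> then shows that it is interior and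
  that the step has length at most seven times the distance to the solution set, whatever the
  penalty parameter. Secondly, with calmness of the multiplier map, the distance of \<open>(x, l)\<close> to the
  solution set is bounded by the perturbation that makes \<open>(x, l)\<close> a solution. As a step of the
  method solves the system up to \<open>eps r + \<alpha> r / c\<close>, the distance to the solution set is
  multiplied by an arbitrarily small factor; since the steps are at most proportional to this distance,
  the iterates converge at the same rate.\<close>

section \<open>Second-order Taylor expansion and local inverses\<close>

text \<open>\<open>\<Lambda>\<close> may contain many multipliers while SOSC is given at
  \<open>lbar\<close> only, so the estimates are uniform in multipliers \<open>m\<close> near
  \<open>lbar\<close> and are applied at the multiplier nearest to the current \<open>l\<close>. The
  obstacle is the gap \<open>G = -(m \<bullet> (p - ybar))\<close>, nonnegative but only of first
  order in \<open>p - ybar\<close>: it measures failure of orthogonality in the critical cone and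
  cannot be absorbed by quadratic terms. Coercivity is therefore stated with a gap coefficient
  proportional to the norm of \<open>x - xbar\<close>, which is below any \<open>\<theta>\<close>
  near \<open>xbar\<close>; it is paid for by a fraction \<open>\<theta>\<close> of the gap, held
  back when the curvature bound at \<open>ybar\<close> is applied. The point \<open>p\<close> of
  \<open>K\<close> is a variable of its own beside \<open>x\<close>, with slack
  \<open>g x - p\<close>. Thus growth applies to the projection inside the augmented Lagrangian, and
  the error bound to the shifted point \<open>g x - b\<close>. Existence is uniform in the penalty
  because the slack is measured as \<open>c * norm s\<close>, the length of the multiplier step: in
  the comparison with \<open>xbar\<close>, \<open>c\<close> then cancels. The condition on
  \<open>eps\<close> says nothing at \<open>0\<close>; at a zero residual it is the step-length
  bound that keeps the iterate fixed.\<close>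

text \<open>Since \<open>f'\<close> is differentiable at \<open>x0\<close> only, the mean value
  inequality is applied on the segment to \<open>f\<close> minus its quadratic Taylor polynomial.
  The derivative of this difference is the first-order remainder of \<open>f'\<close> applied to
  \<open>d\<close>, hence of size \<open>e * (norm d)\<^sup>2\<close>.\<close>

lemma second_order_taylor:
  fixes f :: "'a::real_normed_vector \<Rightarrow> 'b::real_normed_vector"
    and f' :: "'a \<Rightarrow> 'a \<Rightarrow>\<^sub>L 'b"
  assumes N: "open N" "x0 \<in> N"
    and f': "\<And>x. x \<in> N \<Longrightarrow> (f has_derivative blinfun_apply (f' x)) (at x)"
    and f'': "(f' has_derivative f'') (at x0)"
    and e: "e > 0"
  shows "\<exists>\<delta>>0. \<forall>d. norm d < \<delta> \<longrightarrow> x0 + d \<in> N \<and>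
           norm (f' (x0 + d) - f' x0 - f'' d) \<le> e * norm d \<and>
           norm (f (x0 + d) - f x0 - f' x0 d - (1/2) *\<^sub>R f'' d d) \<le> e * (norm d)\<^sup>2"
proof -
  obtain r where r: "r > 0" "ball x0 r \<subseteq> N"
    using N by (meson open_contains_ball)
  have lin: "linear f''"
    using f'' has_derivative_linear by blast
  obtain s where s: "s > 0"
      "\<And>y. norm (y - x0) < s \<Longrightarrow> norm (f' y - f' x0 - f'' (y - x0)) \<le> e * norm (y - x0)"
    using f'' e unfolding has_derivative_at_alt by metis
  have A: "norm (f' (x0 + d) - f' x0 - f'' d) \<le> e * norm d" if "norm d < s" for d
    using s(2)[of "x0 + d"] that by simp
  have B: "norm (f (x0 + d) - f x0 - f' x0 d - (1/2) *\<^sub>R f'' d d) \<le> e * (norm d)\<^sup>2"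
    if d: "norm d < min r s" for d
  proof -
    define \<psi> where "\<psi> = (\<lambda>t::real. f (x0 + t *\<^sub>R d) - t *\<^sub>R f' x0 d - (t\<^sup>2 / 2) *\<^sub>R f'' d d)"
    define \<psi>' where "\<psi>' = (\<lambda>t::real. f' (x0 + t *\<^sub>R d) d - f' x0 d - t *\<^sub>R f'' d d)"
    have small: "norm (t *\<^sub>R d) < min r s" if "t \<in> {0..1}" for t
    proof -
      have "norm (t *\<^sub>R d) \<le> 1 * norm d"
        using that by (simp add: mult_left_le_one_le)
      then show ?thesis using d by simp
    qed
    have der: "(\<psi> has_derivative (\<lambda>u. u *\<^sub>R \<psi>' t)) (at t within {0..1})" if t: "t \<in> {0..1}" for t
    proof -
      have "x0 + t *\<^sub>R d \<in> N"
        using small[OF t] r(2) by (auto simp: subset_iff dist_norm)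
      note F = f'[OF this]
      have "((\<lambda>t. x0 + t *\<^sub>R d) has_derivative (\<lambda>u. u *\<^sub>R d)) (at t within {0..1})"
        by (auto intro!: derivative_eq_intros)
      from has_derivative_compose[OF this F]
      have 1: "((\<lambda>t. f (x0 + t *\<^sub>R d)) has_derivative (\<lambda>u. u *\<^sub>R f' (x0 + t *\<^sub>R d) d)) (at t within {0..1})"
        by (simp add: blinfun.scaleR_right)
      have 2: "((\<lambda>t. (t\<^sup>2 / 2) *\<^sub>R f'' d d) has_derivative (\<lambda>u. (u * t) *\<^sub>R f'' d d)) (at t within {0..1})"
        by (auto intro!: derivative_eq_intros)
      have 3: "((\<lambda>t. t *\<^sub>R f' x0 d) has_derivative (\<lambda>u. u *\<^sub>R f' x0 d)) (at t within {0..1})"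
        by (auto intro!: derivative_eq_intros)
      show ?thesis
        unfolding \<psi>_def using has_derivative_diff[OF has_derivative_diff[OF 1 3] 2]
        by (simp add: \<psi>'_def scaleR_diff_right)
    qed
    have bnd: "onorm (\<lambda>u. u *\<^sub>R \<psi>' t) \<le> e * (norm d)\<^sup>2" if t: "t \<in> {0..1}" for t
    proof -
      have lt: "f'' (t *\<^sub>R d) = t *\<^sub>R f'' d"
        using lin by (simp add: linear_scale)
      have eq: "\<psi>' t = (f' (x0 + t *\<^sub>R d) - f' x0 - f'' (t *\<^sub>R d)) d"
        by (simp add: \<psi>'_def blinfun.diff_left lt blinfun.scaleR_left)
      have "norm (\<psi>' t) \<le> norm (f' (x0 + t *\<^sub>R d) - f' x0 - f'' (t *\<^sub>R d)) * norm d"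
        unfolding eq by (rule norm_blinfun)
      also have "\<dots> \<le> (e * norm (t *\<^sub>R d)) * norm d"
        using A[of "t *\<^sub>R d"] small[OF t] by (intro mult_right_mono) auto
      also have "\<dots> \<le> (e * (1 * norm d)) * norm d"
        using t e by (intro mult_right_mono mult_left_mono) (auto intro: mult_left_le_one_le)
      finally have "norm (\<psi>' t) \<le> e * (norm d)\<^sup>2"
        by (simp add: power2_eq_square)
      then show ?thesis
        using e by (intro onorm_le) (simp add: mult.commute mult_left_mono)
    qed
    have "norm (\<psi> 1 - \<psi> 0) \<le> e * (norm d)\<^sup>2 * norm (1 - 0 :: real)"
      using der bnd by (intro differentiable_bound[of "{0..1}" \<psi>]) auto
    moreover have "\<psi> 1 - \<psi> 0 = f (x0 + d) - f x0 - f' x0 d - (1/2) *\<^sub>R f'' d d"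
      by (simp add: \<psi>_def)
    ultimately show ?thesis by simp
  qed
  show ?thesis
    using A B r s(1) by (intro exI[of _ "min r s"]) (auto simp: subset_iff dist_norm)
qed

text \<open>On the ball, \<open>\<Phi>\<close> differs from the identity by a map with Lipschitz
  constant 1/2. This gives expansiveness at once, and surjectivity by Banach's fixed point
  theorem.\<close>

lemma near_identity_local_inverse:
  fixes \<Phi> :: "'a::banach \<Rightarrow> 'a" and \<Phi>' :: "'a \<Rightarrow> 'a \<Rightarrow>\<^sub>L 'a"
  assumes der: "\<And>y. y \<in> ball y0 r \<Longrightarrow> (\<Phi> has_derivative \<Phi>' y) (at y)"
    and close: "\<And>y. y \<in> ball y0 r \<Longrightarrow> norm (\<Phi>' y - id_blinfun) \<le> 1/2"
  shows near_identity_expansive: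
      "\<And>y z. y \<in> ball y0 r \<Longrightarrow> z \<in> ball y0 r \<Longrightarrow> norm (y - z) \<le> 2 * norm (\<Phi> y - \<Phi> z)"
    and near_identity_locally_onto:
      "\<And>u. 2 * norm (u - \<Phi> y0) < r \<Longrightarrow> \<exists>y\<in>ball y0 r. \<Phi> y = u"
proof -
  have contr: "norm ((\<Phi> y - y) - (\<Phi> z - z)) \<le> 1/2 * norm (y - z)"
    if "y \<in> ball y0 r" "z \<in> ball y0 r" for y z
  proof (rule differentiable_bound[where f = "\<lambda>y. \<Phi> y - y" and f' = "\<lambda>y. blinfun_apply (\<Phi>' y - id_blinfun)"])
    show "convex (ball y0 r)" by simp
    fix x assume x: "x \<in> ball y0 r"
    have "((\<lambda>y. \<Phi> y - y) has_derivative (\<lambda>h. \<Phi>' x h - h)) (at x)"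
      using der[OF x] by (intro derivative_intros)
    moreover have "blinfun_apply (\<Phi>' x - id_blinfun) = (\<lambda>h. \<Phi>' x h - h)"
      by (auto simp: blinfun.diff_left)
    ultimately have "((\<lambda>y. \<Phi> y - y) has_derivative blinfun_apply (\<Phi>' x - id_blinfun)) (at x)"
      by simp
    then show "((\<lambda>y. \<Phi> y - y) has_derivative blinfun_apply (\<Phi>' x - id_blinfun)) (at x within ball y0 r)"
      by (rule has_derivative_at_withinI)
    show "onorm (blinfun_apply (\<Phi>' x - id_blinfun)) \<le> 1/2"
      using close[OF x] by (simp add: norm_blinfun.rep_eq)
  qed (use that in auto)
  show "norm (y - z) \<le> 2 * norm (\<Phi> y - \<Phi> z)" if "y \<in> ball y0 r" "z \<in> ball y0 r" for y z
    using contr[OF that] norm_triangle_sub[of "y - z" "\<Phi> y - \<Phi> z"]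
    by (simp add: norm_minus_commute algebra_simps)
  show "\<exists>y\<in>ball y0 r. \<Phi> y = u" if u: "2 * norm (u - \<Phi> y0) < r" for u
  proof -
    \<comment> \<open>Fixed points of \<open>T\<close> are the preimages of \<open>u\<close>. As
      \<open>T\<close> moves the centre by exactly \<open>\<rho> / 2\<close> and contracts by 1/2,
      it maps the closed ball of radius \<open>\<rho>\<close> into itself.\<close>
    define \<rho> where "\<rho> = 2 * norm (u - \<Phi> y0)"
    define T where "T = (\<lambda>y. u - (\<Phi> y - y))"
    have sub: "cball y0 \<rho> \<subseteq> ball y0 r"
      using u unfolding \<rho>_def by auto
    have y0: "y0 \<in> cball y0 \<rho>" by (simp add: \<rho>_def)
    have T: "dist (T y) (T z) \<le> 1/2 * dist y z" if "y \<in> cball y0 \<rho>" "z \<in> cball y0 \<rho>" for y z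
    proof -
      have "T y - T z = - ((\<Phi> y - y) - (\<Phi> z - z))" by (simp add: T_def)
      then show ?thesis
        using contr[of y z] sub that unfolding dist_norm by (metis norm_minus_cancel subsetD)
    qed
    have "dist y0 (T y) \<le> \<rho>" if y: "y \<in> cball y0 \<rho>" for y
    proof -
      have "dist (T y0) (T y) \<le> 1/2 * \<rho>"
        using T[OF y0 y] y by auto
      moreover have "dist y0 (T y0) = \<rho> / 2"
        by (simp add: T_def \<rho>_def dist_norm norm_minus_commute)
      ultimately show ?thesis
        using dist_triangle[of y0 "T y" "T y0"] by simp
    qed
    then have "\<exists>!y\<in>cball y0 \<rho>. T y = y"
      using T y0 by (intro Banach_fix[where c = "1/2"]) (auto simp: complete_eq_closed)
    then obtain y where "y \<in> cball y0 \<rho>" "T y = y" by blast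
    then show ?thesis
      using sub by (intro bexI[of _ y]) (auto simp: T_def)
  qed
qed

section \<open>Straightening a cone reducible set\<close>

text \<open>The chart has values in the ambient space itself, so that the identity can be prescribed
  as its derivative at \<open>y0\<close>; first-order terms in \<open>y - y0\<close> then pass
  through it unchanged. The radius \<open>r\<close> is where the near-identity inverse lemmas
  apply.\<close>

locale straightening =
  fixes K :: "'h::euclidean_space set" and y0 :: 'h and \<Phi> :: "'h \<Rightarrow> 'h"
    and \<Phi>' :: "'h \<Rightarrow> 'h \<Rightarrow>\<^sub>L 'h" and \<Phi>'' :: "'h \<Rightarrow>\<^sub>L ('h \<Rightarrow>\<^sub>L 'h)" and D and r :: real
  assumes r_pos: "r > 0"
    and deriv: "y \<in> ball y0 r \<Longrightarrow> (\<Phi> has_derivative \<Phi>' y) (at y)"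
    and deriv_close: "y \<in> ball y0 r \<Longrightarrow> norm (\<Phi>' y - id_blinfun) \<le> 1/2"
    and deriv2: "(\<Phi>' has_derivative \<Phi>'') (at y0)"
    and \<Phi>_y0: "\<Phi> y0 = 0" and deriv_y0: "\<Phi>' y0 = id_blinfun"
    and cone_D: "cone D" and closed_D: "closed D"
    and K_iff: "y \<in> ball y0 r \<Longrightarrow> y \<in> K \<longleftrightarrow> \<Phi> y \<in> D"
begin

lemma expansive:
  "y \<in> ball y0 r \<Longrightarrow> z \<in> ball y0 r \<Longrightarrow> norm (y - z) \<le> 2 * norm (\<Phi> y - \<Phi> z)"
  using deriv deriv_close by (rule near_identity_expansive)

lemma locally_onto: "2 * norm u < r \<Longrightarrow> \<exists>y\<in>ball y0 r. \<Phi> y = u"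
  using near_identity_locally_onto[of y0 r \<Phi> \<Phi>' u] deriv deriv_close by (auto simp: \<Phi>_y0)

text \<open>Moving \<open>\<Phi> p\<close> by \<open>s *\<^sub>R \<omega>\<close> stays in
  \<open>D\<close> and pulls back to a point \<open>y\<close> of \<open>K\<close>, so
  \<open>l \<bullet> (y - p) \<le> 0\<close>. By expansiveness \<open>y\<close> differs from
  \<open>p + s *\<^sub>R v\<close> by at most \<open>2 * s\<close> times the mismatch of
  \<open>\<Phi>' p v\<close> and \<open>\<omega>\<close>, up to o(s). Dividing by \<open>s\<close>
  gives the claim.\<close>

lemma normal_direction:
  assumes p: "p \<in> ball y0 r" "2 * norm (\<Phi> p) < r"
    and D: "\<And>s. 0 < s \<Longrightarrow> s \<le> 1 \<Longrightarrow> \<Phi> p + s *\<^sub>R \<omega> \<in> D"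
    and l: "l \<in> normal_cone K p"
  shows "l \<bullet> v \<le> 2 * norm l * norm (\<Phi>' p v - \<omega>)"
proof (rule field_le_epsilon)
  fix e0 :: real assume e0: "e0 > 0"
  define e where "e = e0 / (2 * (norm l + 1) * (norm v + 1))"
  have e: "e > 0"
    using e0 by (simp add: e_def add_nonneg_pos)
  obtain d where d: "d > 0" "\<And>y. norm (y - p) < d \<Longrightarrow> norm (\<Phi> y - \<Phi> p - \<Phi>' p (y - p)) \<le> e * norm (y - p)"
    using deriv[OF p(1)] e unfolding has_derivative_at_alt by blast
  define \<rho> where "\<rho> = min d (r - dist y0 p)"
  have \<rho>: "\<rho> > 0" using d p by (simp add: \<rho>_def)
  \<comment> \<open>The second bound keeps \<open>p + s *\<^sub>R v\<close> in the ball and in the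
    range of the first-order expansion; the third keeps
    \<open>\<Phi> p + s *\<^sub>R \<omega>\<close> where \<open>\<Phi>\<close> is onto.\<close>
  define s where "s = min 1 (min (\<rho> / (2 * (norm v + 1))) ((r - 2 * norm (\<Phi> p)) / (4 * (norm \<omega> + 1))))"
  have nv: "norm v + 1 > 0" "norm \<omega> + 1 > 0" by (simp_all add: add_nonneg_pos)
  have s: "0 < s" "s \<le> 1"
    using \<rho> p nv by (auto simp: s_def)
  have "s * norm v \<le> s * (norm v + 1)" using s by simp
  also have "\<dots> \<le> (\<rho> / (2 * (norm v + 1))) * (norm v + 1)"
    using nv by (intro mult_right_mono) (auto simp: s_def)
  also have "\<dots> = \<rho> / 2" using nv by (simp add: divide_simps)
  also have "\<dots> < \<rho>" using \<rho> by simp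
  finally have sv: "norm (s *\<^sub>R v) < \<rho>" using s by simp
  have "s * norm \<omega> \<le> s * (norm \<omega> + 1)" using s by simp
  also have "\<dots> \<le> ((r - 2 * norm (\<Phi> p)) / (4 * (norm \<omega> + 1))) * (norm \<omega> + 1)"
    using nv by (intro mult_right_mono) (auto simp: s_def)
  also have "\<dots> = (r - 2 * norm (\<Phi> p)) / 4" using nv by (simp add: divide_simps)
  also have "\<dots> < (r - 2 * norm (\<Phi> p)) / 2" using p by simp
  finally have "2 * norm (\<Phi> p + s *\<^sub>R \<omega>) < r"
    using norm_triangle_ineq[of "\<Phi> p" "s *\<^sub>R \<omega>"] s by simp
  then obtain y where y: "y \<in> ball y0 r" "\<Phi> y = \<Phi> p + s *\<^sub>R \<omega>"
    using locally_onto by blast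
  have "y \<in> K" using K_iff[OF y(1)] D[OF s] y(2) by simp
  then have ly: "l \<bullet> (y - p) \<le> 0" using l by (simp add: normal_cone_def)
  have "dist y0 (p + s *\<^sub>R v) \<le> dist y0 p + norm (s *\<^sub>R v)"
    using dist_triangle[of y0 "p + s *\<^sub>R v" p] by (simp add: dist_norm)
  then have ball: "p + s *\<^sub>R v \<in> ball y0 r" using sv by (simp add: \<rho>_def)
  have "norm (\<Phi> (p + s *\<^sub>R v) - \<Phi> p - \<Phi>' p (s *\<^sub>R v)) \<le> e * norm (s *\<^sub>R v)"
    using d(2)[of "p + s *\<^sub>R v"] sv by (simp add: \<rho>_def)
  moreover have "norm (s *\<^sub>R \<Phi>' p v - s *\<^sub>R \<omega>) = s * norm (\<Phi>' p v - \<omega>)"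
    using s by (simp flip: scaleR_diff_right)
  moreover have "norm (\<Phi> (p + s *\<^sub>R v) - \<Phi> y) \<le>
      norm (\<Phi> (p + s *\<^sub>R v) - \<Phi> p - \<Phi>' p (s *\<^sub>R v)) + norm (s *\<^sub>R \<Phi>' p v - s *\<^sub>R \<omega>)"
    by (rule order_trans[OF _ norm_triangle_ineq]) (simp add: y(2) blinfun.scaleR_right diff_diff_eq)
  ultimately have "norm (\<Phi> (p + s *\<^sub>R v) - \<Phi> y) \<le> s * (e * norm v + norm (\<Phi>' p v - \<omega>))"
    using s by (simp add: algebra_simps)
  then have close: "norm (p + s *\<^sub>R v - y) \<le> s * (2 * (e * norm v + norm (\<Phi>' p v - \<omega>)))"
    using expansive[OF ball y(1)] by (simp add: algebra_simps)
  have "s * (l \<bullet> v) = l \<bullet> (p + s *\<^sub>R v - y) + l \<bullet> (y - p)"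
    by (simp add: algebra_simps inner_diff_right)
  also have "\<dots> \<le> norm l * norm (p + s *\<^sub>R v - y)"
    using ly norm_cauchy_schwarz[of l "p + s *\<^sub>R v - y"] by simp
  also have "\<dots> \<le> norm l * (s * (2 * (e * norm v + norm (\<Phi>' p v - \<omega>))))"
    using close by (rule mult_left_mono) simp
  finally have "s * (l \<bullet> v) \<le> s * (norm l * (2 * (e * norm v + norm (\<Phi>' p v - \<omega>))))"
    by (simp add: algebra_simps)
  then have "l \<bullet> v \<le> norm l * (2 * (e * norm v + norm (\<Phi>' p v - \<omega>)))"
    using s by simp
  also have "\<dots> = 2 * norm l * norm (\<Phi>' p v - \<omega>) + e * (2 * norm l * norm v)"
    by (simp add: algebra_simps)
  also have "e * (2 * norm l * norm v) \<le> e * (2 * (norm l + 1) * (norm v + 1))"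
    using e by (intro mult_left_mono mult_mono) auto
  also have "\<dots> = e0"
  proof -
    have "norm l + 1 \<noteq> 0" "norm v + 1 \<noteq> 0"
      using norm_ge_zero[of l] norm_ge_zero[of v] by linarith+
    then show ?thesis by (simp add: e_def)
  qed
  finally show "l \<bullet> v \<le> 2 * norm l * norm (\<Phi>' p v - \<omega>) + e0" by simp
qed

text \<open>At the base point \<open>\<Phi>'\<close> is the identity and \<open>\<Phi> p\<close> is
  a direction of the cone \<open>D\<close>, so \<open>v = \<omega> = \<Phi> p\<close> leaves no
  error term.\<close>

lemma normal_cone_at_base:
  assumes p: "p \<in> K \<inter> ball y0 r" and l: "l \<in> normal_cone K y0"
  shows "l \<bullet> \<Phi> p \<le> 0"
proof -
  have "\<Phi> p \<in> D" using K_iff p by auto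
  then have "l \<bullet> \<Phi> p \<le> 2 * norm l * norm (\<Phi>' y0 (\<Phi> p) - \<Phi> p)"
    using cone_D r_pos l by (intro normal_direction[of y0]) (auto simp: \<Phi>_y0 cone_def)
  then show ?thesis by (simp add: deriv_y0)
qed

text \<open>The ray through \<open>\<Phi> p\<close> lies in \<open>D\<close>, so one may move from
  \<open>\<Phi> p\<close> towards the apex: \<open>normal_direction\<close> is used with
  \<open>\<omega> = - \<Phi> p\<close> and \<open>- v\<close>.\<close>

lemma normal_cone_nearby:
  assumes p: "p \<in> K \<inter> ball y0 r" "2 * norm (\<Phi> p) < r" and l: "l \<in> normal_cone K p"
  shows "l \<bullet> v \<ge> - (2 * norm l * norm (\<Phi>' p v - \<Phi> p))"
proof -
  have "\<Phi> p \<in> D" using K_iff p by auto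
  then have D: "\<Phi> p + s *\<^sub>R (- \<Phi> p) \<in> D" if "0 < s" "s \<le> 1" for s
    using cone_D that unfolding cone_def
    by (metis (no_types) diff_ge_0_iff_ge pth_2 scaleR_left_diff_distrib scaleR_minus_right scaleR_one)
  have "l \<bullet> (- v) \<le> 2 * norm l * norm (\<Phi>' p (- v) - (- \<Phi> p))"
    using p D l by (intro normal_direction) auto
  moreover have "\<Phi>' p (- v) - (- \<Phi> p) = - (\<Phi>' p v - \<Phi> p)"
    by (simp add: blinfun.minus_right)
  ultimately show ?thesis by (metis inner_minus_right minus_le_iff norm_minus_cancel)
qed

end

text \<open>With \<open>A\<close> the derivative of \<open>\<Theta>\<close> at \<open>y0\<close> and
  \<open>R\<close> a linear right inverse on \<open>Z\<close>, \<open>\<Phi>\<close> puts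
  \<open>R (\<Theta> y)\<close> in place of the component \<open>R (A (y - y0))\<close> of
  \<open>y - y0\<close> and keeps the component in the kernel of \<open>A\<close>. Its derivative at
  \<open>y0\<close> is \<open>RA + I - RA = I\<close>, and \<open>A (\<Phi> y) = \<Theta> y\<close>,
  so \<open>K\<close> becomes the preimage \<open>D\<close> of \<open>C\<close> under
  \<open>A\<close>.\<close>

lemma C2_cone_reducible_straightening:
  fixes K :: "'h::euclidean_space set"
  assumes "C2_cone_reducible K" "y0 \<in> K"
  shows "\<exists>\<Phi> \<Phi>' \<Phi>'' D r. straightening K y0 \<Phi> \<Phi>' \<Phi>'' D r"
proof -
  obtain Z C N and \<Theta> :: "'h \<Rightarrow> 'h" where Z: "subspace Z" and C: "C \<subseteq> Z" "pointed_cone C" "closed C"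
    and N: "open N" "y0 \<in> N" and \<Theta>: "\<Theta> ` N \<subseteq> Z" "twice_continuously_differentiable_on N \<Theta>"
      "\<Theta> y0 = 0" "range (frechet_derivative \<Theta> (at y0)) = Z"
    and KN: "K \<inter> N = (\<Theta> -` C) \<inter> N"
    using assms unfolding C2_cone_reducible_def by metis
  obtain \<Theta>' :: "'h \<Rightarrow> 'h \<Rightarrow>\<^sub>L 'h" and \<Theta>'' :: "'h \<Rightarrow> 'h \<Rightarrow>\<^sub>L ('h \<Rightarrow>\<^sub>L 'h)" where
    d1: "\<And>y. y \<in> N \<Longrightarrow> (\<Theta> has_derivative \<Theta>' y) (at y)" and
    d2: "\<And>y. y \<in> N \<Longrightarrow> (\<Theta>' has_derivative \<Theta>'' y) (at y)"
    using \<Theta>(2) unfolding twice_continuously_differentiable_on_def by metis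
  define A where "A = \<Theta>' y0"
  have rangeA: "range A = Z"
    using \<Theta>(4) frechet_derivative_at[OF d1[OF N(2)]] by (simp add: A_def)
  have "linear A" by (simp add: blinfun.bounded_linear_right bounded_linear.linear)
  then obtain R0 where R0: "linear R0" "\<And>z. z \<in> Z \<Longrightarrow> A (R0 z) = z"
    using linear_exists_right_inverse_on[of A UNIV] rangeA by auto
  define R where "R = Blinfun R0"
  have R: "A (R z) = z" if "z \<in> Z" for z
    using R0 that by (simp add: R_def bounded_linear_Blinfun_apply linear_conv_bounded_linear)
  define \<Phi> where "\<Phi> = (\<lambda>y. R (\<Theta> y) + (y - y0) - R (A (y - y0)))"
  define \<Phi>' where "\<Phi>' = (\<lambda>y. (R o\<^sub>L \<Theta>' y) + id_blinfun - (R o\<^sub>L A))"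
  define \<Phi>'' where "\<Phi>'' = Blinfun (\<lambda>h. R o\<^sub>L \<Theta>'' y0 h)"
  define D where "D = {u. A u \<in> C}"
  have \<Phi>'': "blinfun_apply \<Phi>'' = (\<lambda>h. R o\<^sub>L \<Theta>'' y0 h)"
    unfolding \<Phi>''_def
    by (intro bounded_linear_Blinfun_apply bounded_linear_compose[OF
        bounded_bilinear.bounded_linear_right[OF bounded_bilinear_blinfun_compose]]
        blinfun.bounded_linear_right)
  have der: "(\<Phi> has_derivative \<Phi>' y) (at y)" if "y \<in> N" for y
  proof -
    have "((\<lambda>y. R (\<Theta> y) + (y - y0) - R (A (y - y0))) has_derivative
        (\<lambda>h. R (\<Theta>' y h) + h - R (A h))) (at y)"
      using d1[OF that] by (auto intro!: derivative_eq_intros)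
    moreover have "blinfun_apply (\<Phi>' y) = (\<lambda>h. R (\<Theta>' y h) + h - R (A h))"
      by (auto simp: \<Phi>'_def blinfun.diff_left blinfun.add_left)
    ultimately show ?thesis by (simp add: \<Phi>_def)
  qed
  have der': "(\<Phi>' has_derivative \<Phi>'') (at y0)"
  proof -
    have "((\<lambda>y. (R o\<^sub>L \<Theta>' y) + id_blinfun - (R o\<^sub>L A)) has_derivative (\<lambda>h. R o\<^sub>L \<Theta>'' y0 h)) (at y0)"
      using d2[OF N(2)]
      by (auto intro!: derivative_eq_intros
          bounded_linear.has_derivative[OF bounded_bilinear.bounded_linear_right[OF bounded_bilinear_blinfun_compose]])
    then show ?thesis by (simp add: \<Phi>'_def \<Phi>'')
  qed
  have id: "\<Phi>' y0 = id_blinfun" by (simp add: \<Phi>'_def A_def)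
  have "continuous (at y0) \<Phi>'"
    using der' has_derivative_continuous by blast
  then obtain s where s: "s > 0" "\<And>y. dist y y0 < s \<Longrightarrow> dist (\<Phi>' y) (\<Phi>' y0) < 1/2"
    unfolding continuous_at_eps_delta by (metis half_gt_zero zero_less_one)
  obtain s' where s': "s' > 0" "ball y0 s' \<subseteq> N"
    using N by (meson open_contains_ball)
  have A\<Phi>: "A (\<Phi> y) = \<Theta> y" if "y \<in> N" for y
  proof -
    have "\<Theta> y \<in> Z" using \<Theta>(1) that by auto
    moreover have "A (R (A v)) = A v" for v
      using rangeA by (intro R) auto
    ultimately show ?thesis by (simp add: \<Phi>_def blinfun.diff_right blinfun.add_right R)
  qed
  show "\<exists>\<Phi> \<Phi>' \<Phi>'' D r. straightening K y0 \<Phi> \<Phi>' \<Phi>'' D r"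
  proof (rule exI[of _ \<Phi>], rule exI[of _ \<Phi>'], rule exI[of _ \<Phi>''], rule exI[of _ D],
      rule exI[of _ "min s s'"], unfold_locales) 
    show "min s s' > 0" using s s' by simp
    show "norm (\<Phi>' y - id_blinfun) \<le> 1/2" if "y \<in> ball y0 (min s s')" for y
      using s(2)[of y] that by (simp add: id dist_norm norm_minus_commute)
    show "\<Phi> y0 = 0" by (simp add: \<Phi>_def \<Theta>(3))
    have "cone C" using C(2) by (simp add: pointed_cone_def)
    then show "cone D" by (simp add: cone_def D_def blinfun.scaleR_right)
    have "D = A -` C" by (auto simp: D_def)
    then show "closed D"
      using C(3) by (simp add: continuous_closed_vimage linear_continuous_at blinfun.bounded_linear_right)
    show "y \<in> K \<longleftrightarrow> \<Phi> y \<in> D" if "y \<in> ball y0 (min s s')" for y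
    proof -
      have "y \<in> N" using that s' by auto
      then show ?thesis using KN A\<Phi> by (auto simp: D_def)
    qed
    show "(\<Phi> has_derivative \<Phi>' y) (at y)" if "y \<in> ball y0 (min s s')" for y
      using der[of y] that s' by auto
  qed (use der' id in auto)
qed

section \<open>Tangent sets and curvature of the set, read off in the chart\<close>

context straightening
begin

lemma chart_taylor:
  assumes "e > 0"
  shows "\<exists>\<delta>>0. \<forall>h. norm h < \<delta> \<longrightarrow> y0 + h \<in> ball y0 r \<and>
    norm (\<Phi>' (y0 + h) h - h - \<Phi>'' h h) \<le> e * (norm h)\<^sup>2 \<and>
    norm (\<Phi> (y0 + h) - h - (1/2) *\<^sub>R \<Phi>'' h h) \<le> e * (norm h)\<^sup>2"
proof -
  obtain \<delta> where \<delta>: "\<delta> > 0" "\<And>h. norm h < \<delta> \<Longrightarrow> y0 + h \<in> ball y0 r \<and>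
      norm (\<Phi>' (y0 + h) - id_blinfun - \<Phi>'' h) \<le> e * norm h \<and>
      norm (\<Phi> (y0 + h) - h - (1/2) *\<^sub>R \<Phi>'' h h) \<le> e * (norm h)\<^sup>2"
    using second_order_taylor[of "ball y0 r" y0 \<Phi> \<Phi>' \<Phi>'' e] r_pos deriv deriv2 assms
    by (auto simp: \<Phi>_y0 deriv_y0)
  have "norm (\<Phi>' (y0 + h) h - h - \<Phi>'' h h) \<le> e * (norm h)\<^sup>2" if "norm h < \<delta>" for h
  proof -
    have "norm (\<Phi>' (y0 + h) h - h - \<Phi>'' h h) = norm ((\<Phi>' (y0 + h) - id_blinfun - \<Phi>'' h) h)"
      by (simp add: blinfun.diff_left)
    also have "\<dots> \<le> norm (\<Phi>' (y0 + h) - id_blinfun - \<Phi>'' h) * norm h"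
      by (rule norm_blinfun)
    also have "\<dots> \<le> (e * norm h) * norm h"
      using \<delta>(2)[OF that] by (intro mult_right_mono) auto
    finally show ?thesis by (simp add: power2_eq_square)
  qed
  then show ?thesis using \<delta> by blast
qed

lemma norm_\<Phi>''_le: "norm (\<Phi>'' h k) \<le> norm \<Phi>'' * norm h * norm k"
  by (rule order_trans[OF norm_blinfun mult_right_mono[OF norm_blinfun]]) simp

text \<open>The chart is the identity to first order, so the rescaled images \<open>u k\<close> of
  points of \<open>K\<close> have the same limit as the difference quotients \<open>w k\<close>;
  they lie in the closed cone \<open>D\<close>.\<close>

lemma tangent_cone_subset: "tangent_cone K y0 \<subseteq> D"
proof
  fix h assume "h \<in> tangent_cone K y0"
  then obtain t :: "nat \<Rightarrow> real" and w where t: "\<And>k. t k > 0" "t \<longlonglongrightarrow> 0" and w: "w \<longlonglongrightarrow> h"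
    and K: "\<And>k. y0 + t k *\<^sub>R w k \<in> K"
    unfolding tangent_cone_def by auto
  obtain \<delta> where \<delta>: "\<delta> > 0" "\<And>h. norm h < \<delta> \<Longrightarrow> y0 + h \<in> ball y0 r \<and>
      norm (\<Phi> (y0 + h) - h - (1/2) *\<^sub>R \<Phi>'' h h) \<le> 1 * (norm h)\<^sup>2"
    using chart_taylor[of 1] by auto
  have "(\<lambda>k. t k *\<^sub>R w k) \<longlonglongrightarrow> 0 *\<^sub>R h"
    by (intro tendsto_intros t w)
  then have "(\<lambda>k. norm (t k *\<^sub>R w k)) \<longlonglongrightarrow> 0"
    using tendsto_norm_zero by fastforce
  then have ev: "\<forall>\<^sub>F k in sequentially. norm (t k *\<^sub>R w k) < \<delta>"
    using \<delta>(1) by (rule order_tendstoD)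
  define u where "u k = inverse (t k) *\<^sub>R \<Phi> (y0 + t k *\<^sub>R w k)" for k
  define C where "C = 1 + norm \<Phi>''"
  have close: "norm (u k - w k) \<le> C * t k * (norm (w k))\<^sup>2" if k: "norm (t k *\<^sub>R w k) < \<delta>" for k
  proof -
    let ?h = "t k *\<^sub>R w k"
    have "norm (\<Phi> (y0 + ?h) - ?h) \<le> norm (\<Phi> (y0 + ?h) - ?h - (1/2) *\<^sub>R \<Phi>'' ?h ?h) + norm ((1/2) *\<^sub>R \<Phi>'' ?h ?h)"
      using norm_triangle_ineq[of "\<Phi> (y0 + ?h) - ?h - (1/2) *\<^sub>R \<Phi>'' ?h ?h" "(1/2) *\<^sub>R \<Phi>'' ?h ?h"] by simp
    also have "\<dots> \<le> (norm ?h)\<^sup>2 + norm \<Phi>'' * norm ?h * norm ?h"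
    proof -
      have "norm ((1/2) *\<^sub>R \<Phi>'' ?h ?h) = norm (\<Phi>'' ?h ?h) / 2" by simp
      then show ?thesis
        using \<delta>(2)[OF k] norm_\<Phi>''_le[of ?h ?h] norm_ge_zero[of "\<Phi>'' ?h ?h"] by linarith
    qed
    also have "\<dots> = C * (t k)\<^sup>2 * (norm (w k))\<^sup>2"
      by (simp add: C_def power2_eq_square algebra_simps)
    finally have le: "norm (\<Phi> (y0 + ?h) - ?h) \<le> C * (t k)\<^sup>2 * (norm (w k))\<^sup>2" .
    have "u k - w k = inverse (t k) *\<^sub>R (\<Phi> (y0 + ?h) - ?h)"
      using t(1)[of k] by (simp add: u_def scaleR_diff_right)
    then have "norm (u k - w k) = inverse (t k) * norm (\<Phi> (y0 + ?h) - ?h)"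
      using t(1)[of k] by simp
    also have "\<dots> \<le> inverse (t k) * (C * (t k)\<^sup>2 * (norm (w k))\<^sup>2)"
      using le t(1)[of k] by (intro mult_left_mono) auto
    also have "\<dots> = C * t k * (norm (w k))\<^sup>2"
      using t(1)[of k] by (simp add: power2_eq_square)
    finally show ?thesis .
  qed
  have "(\<lambda>k. C * t k * (norm (w k))\<^sup>2) \<longlonglongrightarrow> C * 0 * (norm h)\<^sup>2"
    by (intro tendsto_intros t w)
  then have "(\<lambda>k. u k - w k) \<longlonglongrightarrow> 0"
    by (intro Lim_null_comparison[OF eventually_mono[OF ev close]]) simp_all
  then have "u \<longlonglongrightarrow> h"
    using tendsto_add[OF _ w] by fastforce
  moreover have "\<forall>\<^sub>F k in sequentially. u k \<in> D"
    using ev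
  proof (rule eventually_mono)
    fix k assume k: "norm (t k *\<^sub>R w k) < \<delta>"
    then have "\<Phi> (y0 + t k *\<^sub>R w k) \<in> D"
      using K_iff \<delta>(2) K by blast
    then show "u k \<in> D"
      using cone_D t(1)[of k] unfolding u_def cone_def by simp
  qed
  ultimately show "h \<in> D"
    using closed_D by (metis Lim_in_closed_set sequentially_bot)
qed

text \<open>The image of \<open>y0 + t h + t^2 w / 2\<close> is
  \<open>t h + t^2 (w + \<Phi>'' h h) / 2 + o(t^2)\<close>. The choice
  \<open>w = - \<Phi>'' h h\<close> cancels the quadratic term, and \<open>t *\<^sub>R h\<close> in
  \<open>D\<close> pulls back to a point of \<open>K\<close> at distance o(t^2).\<close>

lemma second_order_tangent:
  assumes "h \<in> tangent_cone K y0"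
  shows "- \<Phi>'' h h \<in> second_order_tangent_set K y0 h"
  unfolding second_order_tangent_set_def mem_Collect_eq
proof (rule landau_o.smallI)
  fix c :: real assume c: "c > 0"
  have hD: "h \<in> D" using assms tangent_cone_subset by blast
  define w where "w = - \<Phi>'' h h"
  define k where "k = (\<lambda>t::real. h + (t/2) *\<^sub>R w)"
  \<comment> \<open>The curve is \<open>y0 + t *\<^sub>R k t\<close> with \<open>k t\<close> tending
    to \<open>h\<close>. The Taylor remainder and the variation of \<open>\<Phi>''\<close> between
    \<open>h\<close> and \<open>k t\<close> each get \<open>c / 4\<close> of the budget;
    expansiveness doubles their sum to \<open>c\<close>.\<close>
  define e where "e = c / (4 * ((norm h)\<^sup>2 + 1))"
  have e: "e > 0" using c by (simp add: e_def add_nonneg_pos)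
  obtain \<delta> where \<delta>: "\<delta> > 0" "\<And>h. norm h < \<delta> \<Longrightarrow> y0 + h \<in> ball y0 r \<and>
      norm (\<Phi> (y0 + h) - h - (1/2) *\<^sub>R \<Phi>'' h h) \<le> e * (norm h)\<^sup>2"
    using chart_taylor[OF e] by auto
  have lim_k: "(k \<longlongrightarrow> h) (at_right 0)"
    unfolding k_def by (auto intro!: tendsto_eq_intros)
  have "((\<lambda>t. norm (\<Phi>'' h h - \<Phi>'' (k t) (k t))) \<longlongrightarrow> norm (\<Phi>'' h h - \<Phi>'' h h)) (at_right 0)"
    by (intro tendsto_intros lim_k)
  then have ev1: "\<forall>\<^sub>F t in at_right 0. norm (\<Phi>'' h h - \<Phi>'' (k t) (k t)) < c / 2"
    using c by (intro order_tendstoD(2)[where y = 0]) auto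
  have "((\<lambda>t. (norm (k t))\<^sup>2) \<longlongrightarrow> (norm h)\<^sup>2) (at_right 0)"
    by (intro tendsto_intros lim_k)
  then have ev2: "\<forall>\<^sub>F t in at_right 0. (norm (k t))\<^sup>2 < (norm h)\<^sup>2 + 1"
    by (rule order_tendstoD) simp
  have "((\<lambda>t. norm (t *\<^sub>R k t)) \<longlongrightarrow> norm (0 *\<^sub>R h)) (at_right 0)"
    by (intro tendsto_intros lim_k)
  then have ev3: "\<forall>\<^sub>F t in at_right 0. norm (t *\<^sub>R k t) < \<delta>"
    using \<delta>(1) by (intro order_tendstoD(2)[where y = 0]) auto
  have "((\<lambda>t. 2 * norm (t *\<^sub>R h)) \<longlongrightarrow> 2 * norm (0 *\<^sub>R h)) (at_right 0)"
    by (intro tendsto_intros)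
  then have ev4: "\<forall>\<^sub>F t in at_right 0. 2 * norm (t *\<^sub>R h) < r"
    using r_pos by (intro order_tendstoD(2)[where y = 0]) auto
  show "\<forall>\<^sub>F t in at_right 0. norm (infdist (y0 + t *\<^sub>R h + (t\<^sup>2/2) *\<^sub>R - \<Phi>'' h h) K) \<le> c * norm (t\<^sup>2)"
    using ev1 ev2 ev3 ev4 eventually_at_right_less[of 0]
  proof eventually_elim
    case (elim t)
    obtain y where y: "y \<in> ball y0 r" "\<Phi> y = t *\<^sub>R h"
      using locally_onto[OF elim(4)] by blast
    have "y \<in> K" using K_iff[OF y(1)] y(2) hD cone_D elim(5) by (simp add: cone_def)
    have tk: "t *\<^sub>R k t = t *\<^sub>R h + (t\<^sup>2/2) *\<^sub>R w"
      by (simp add: k_def scaleR_add_right power2_eq_square)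
    have eq: "\<Phi> y - \<Phi> (y0 + t *\<^sub>R k t) = (t\<^sup>2/2) *\<^sub>R (\<Phi>'' h h - \<Phi>'' (k t) (k t))
        - (\<Phi> (y0 + t *\<^sub>R k t) - t *\<^sub>R k t - (1/2) *\<^sub>R \<Phi>'' (t *\<^sub>R k t) (t *\<^sub>R k t))"
      by (simp add: y(2) tk[symmetric] blinfun.scaleR_left blinfun.scaleR_right power2_eq_square scaleR_diff_right)
        (simp add: k_def w_def scaleR_add_right scaleR_diff_right power2_eq_square)
    have "norm (\<Phi> y - \<Phi> (y0 + t *\<^sub>R k t)) \<le> (t\<^sup>2/2) * norm (\<Phi>'' h h - \<Phi>'' (k t) (k t)) + e * (norm (t *\<^sub>R k t))\<^sup>2"
      unfolding eq using \<delta>(2)[OF elim(3)]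
        norm_triangle_ineq4[of "(t\<^sup>2/2) *\<^sub>R (\<Phi>'' h h - \<Phi>'' (k t) (k t))"
          "\<Phi> (y0 + t *\<^sub>R k t) - t *\<^sub>R k t - (1/2) *\<^sub>R \<Phi>'' (t *\<^sub>R k t) (t *\<^sub>R k t)"]
      by simp
    also have "\<dots> \<le> (t\<^sup>2/2) * (c/2) + e * (t\<^sup>2 * ((norm h)\<^sup>2 + 1))"
      using elim e by (intro add_mono mult_left_mono) (auto simp: power_mult_distrib intro: mult_left_mono)
    also have "\<dots> = t\<^sup>2 * (c/4) + t\<^sup>2 * (e * ((norm h)\<^sup>2 + 1))" by simp
    also have "e * ((norm h)\<^sup>2 + 1) = c / 4"
      using add_nonneg_pos[of "(norm h)\<^sup>2" 1] by (simp add: e_def divide_simps)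
    finally have "norm (\<Phi> y - \<Phi> (y0 + t *\<^sub>R k t)) \<le> t\<^sup>2 * (c/2)" by (simp add: field_simps)
    then have "norm (y - (y0 + t *\<^sub>R k t)) \<le> 2 * (t\<^sup>2 * (c/2))"
      using expansive[OF y(1), of "y0 + t *\<^sub>R k t"] \<delta>(2)[OF elim(3)] by linarith
    then have "norm (y - (y0 + t *\<^sub>R k t)) \<le> c * t\<^sup>2"
      by (simp add: mult.commute)
    then have "infdist (y0 + t *\<^sub>R k t) K \<le> c * t\<^sup>2"
      using infdist_le[OF \<open>y \<in> K\<close>, of "y0 + t *\<^sub>R k t"] by (simp add: dist_norm norm_minus_commute)
    then show ?case
      by (simp add: tk w_def infdist_nonneg add_diff_eq)
  qed
qed

text \<open>A single element of the second-order tangent set bounds the supremum from below. SOSC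
  subtracts the support function, so this is the direction that turns SOSC into positivity of a
  quadratic expression.\<close>

lemma curvature_support:
  assumes "h \<in> tangent_cone K y0"
  shows "ereal (- (l \<bullet> \<Phi>'' h h)) \<le> support_function l (second_order_tangent_set K y0 h)"
  unfolding support_function_def
  using SUP_upper[OF second_order_tangent[OF assms], of "\<lambda>z. ereal (l \<bullet> z)"] by simp

lemma near_multiplier:
  assumes "e > 0"
  obtains \<delta> where "\<delta> > 0" and "\<And>l. norm (l - l0) < \<delta> \<Longrightarrow> norm l \<le> norm l0 + 1"
    and "\<And>l h. norm (l - l0) < \<delta> \<Longrightarrow> \<bar>l \<bullet> \<Phi>'' h h - l0 \<bullet> \<Phi>'' h h\<bar> \<le> e * (norm h)\<^sup>2"
proof -
  have "norm \<Phi>'' + 1 > 0" by (simp add: add_nonneg_pos)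
  define \<delta>2 where "\<delta>2 = min 1 (e / (norm \<Phi>'' + 1))"
  have \<delta>2: "\<delta>2 > 0" using assms \<open>norm \<Phi>'' + 1 > 0\<close> by (simp add: \<delta>2_def)
  have near: "norm l \<le> norm l0 + 1" "\<bar>l \<bullet> \<Phi>'' h h - l0 \<bullet> \<Phi>'' h h\<bar> \<le> e * (norm h)\<^sup>2" if l: "norm (l - l0) < \<delta>2" for l h
  proof -
    show "norm l \<le> norm l0 + 1"
      using l norm_triangle_ineq2[of l l0] by (simp add: \<delta>2_def)
    have "\<bar>l \<bullet> \<Phi>'' h h - l0 \<bullet> \<Phi>'' h h\<bar> \<le> norm (l - l0) * norm (\<Phi>'' h h)"
      using Cauchy_Schwarz_ineq2[of "l - l0" "\<Phi>'' h h"] by (simp add: inner_diff_left)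
    also have "\<dots> \<le> (e / (norm \<Phi>'' + 1)) * (norm \<Phi>'' * norm h * norm h)"
      using l norm_\<Phi>''_le[of h h] assms \<open>norm \<Phi>'' + 1 > 0\<close> by (intro mult_mono) (auto simp: \<delta>2_def)
    also have "\<dots> \<le> (e / (norm \<Phi>'' + 1)) * ((norm \<Phi>'' + 1) * norm h * norm h)"
      using assms \<open>norm \<Phi>'' + 1 > 0\<close> by (intro mult_left_mono mult_right_mono) auto
    also have "\<dots> = e * (norm h)\<^sup>2"
      using \<open>norm \<Phi>'' + 1 > 0\<close> by (simp add: divide_simps power2_eq_square)
    finally show "\<bar>l \<bullet> \<Phi>'' h h - l0 \<bullet> \<Phi>'' h h\<bar> \<le> e * (norm h)\<^sup>2" .
  qed
  with \<delta>2 show ?thesis using that by blast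
qed

text \<open>The exact inequality \<open>l \<bullet> \<Phi> p \<le> 0\<close> at the base point is
  expanded with \<open>\<Phi> p = h + \<Phi>'' h h / 2 + o\<close>; replacing \<open>l\<close> by
  \<open>l0\<close> in the quadratic term costs another small multiple of the squared norm of
  \<open>h\<close>.\<close>

lemma curvature_at_base:
  assumes "e > 0"
  shows "\<exists>\<delta>>0. \<forall>p\<in>K. \<forall>l\<in>normal_cone K y0. norm (p - y0) < \<delta> \<longrightarrow> norm (l - l0) < \<delta> \<longrightarrow>
      - (l \<bullet> (p - y0)) \<ge> (l0 \<bullet> \<Phi>'' (p - y0) (p - y0)) / 2 - e * (norm (p - y0))\<^sup>2"
proof -
  define C where "C = norm l0 + 1"
  have C: "C \<ge> 1" by (simp add: C_def)
  define e1 where "e1 = e / (16 * C)"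
  have e1: "e1 > 0" using assms C by (simp add: e1_def)
  obtain \<delta>2 where \<delta>2: "\<delta>2 > 0" and near: "\<And>l. norm (l - l0) < \<delta>2 \<Longrightarrow> norm l \<le> C"
      "\<And>l h. norm (l - l0) < \<delta>2 \<Longrightarrow> \<bar>l \<bullet> \<Phi>'' h h - l0 \<bullet> \<Phi>'' h h\<bar> \<le> e * (norm h)\<^sup>2"
    using near_multiplier[OF assms] unfolding C_def by metis
  obtain \<delta> where \<delta>0: "\<delta> > 0" "\<forall>h. norm h < \<delta> \<longrightarrow> y0 + h \<in> ball y0 r \<and>
    norm (\<Phi>' (y0 + h) h - h - \<Phi>'' h h) \<le> e1 * (norm h)\<^sup>2 \<and>
    norm (\<Phi> (y0 + h) - h - (1/2) *\<^sub>R \<Phi>'' h h) \<le> e1 * (norm h)\<^sup>2"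
    using chart_taylor[OF e1] by (elim exE conjE)
  then have \<delta>: "\<delta> > 0" "\<And>h. norm h < \<delta> \<Longrightarrow> y0 + h \<in> ball y0 r"
    "\<And>h. norm h < \<delta> \<Longrightarrow> norm (\<Phi>' (y0 + h) h - h - \<Phi>'' h h) \<le> e1 * (norm h)\<^sup>2"
    "\<And>h. norm h < \<delta> \<Longrightarrow> norm (\<Phi> (y0 + h) - h - (1/2) *\<^sub>R \<Phi>'' h h) \<le> e1 * (norm h)\<^sup>2"
    by blast+
  have small: "norm l * (e1 * (norm h)\<^sup>2) \<le> e / 16 * (norm h)\<^sup>2" if "norm l \<le> C" for l h :: 'h
  proof -
    have "norm l * (e1 * (norm h)\<^sup>2) \<le> C * (e1 * (norm h)\<^sup>2)"
      using that e1 by (intro mult_right_mono) auto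
    then show ?thesis using C by (simp add: e1_def)
  qed
  show "\<exists>\<delta>>0. \<forall>p\<in>K. \<forall>l\<in>normal_cone K y0. norm (p - y0) < \<delta> \<longrightarrow> norm (l - l0) < \<delta> \<longrightarrow>
      - (l \<bullet> (p - y0)) \<ge> (l0 \<bullet> \<Phi>'' (p - y0) (p - y0)) / 2 - e * (norm (p - y0))\<^sup>2"
  proof (rule exI[of _ "min \<delta> \<delta>2"], intro conjI ballI impI)
    fix p l assume p: "p \<in> K" and l: "l \<in> normal_cone K y0"
      and n: "norm (p - y0) < min \<delta> \<delta>2" "norm (l - l0) < min \<delta> \<delta>2"
    define h where "h = p - y0"
    have ph: "p = y0 + h" "norm h < \<delta>" "norm (l - l0) < \<delta>2" using n by (simp_all add: h_def)
    have "l \<bullet> \<Phi> p \<le> 0"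
      using p l \<delta>(2)[OF ph(2)] ph(1) by (intro normal_cone_at_base) auto
    moreover have "l \<bullet> (h + (1/2) *\<^sub>R \<Phi>'' h h - \<Phi> p) \<le> norm l * norm (\<Phi> p - h - (1/2) *\<^sub>R \<Phi>'' h h)"
    proof -
      have "norm (h + (1/2) *\<^sub>R \<Phi>'' h h - \<Phi> p) = norm (\<Phi> p - h - (1/2) *\<^sub>R \<Phi>'' h h)"
        by (metis diff_diff_eq norm_minus_commute)
      then show ?thesis
        using norm_cauchy_schwarz[of l "h + (1/2) *\<^sub>R \<Phi>'' h h - \<Phi> p"] by metis
    qed
    moreover have "\<dots> \<le> norm l * (e1 * (norm h)\<^sup>2)"
      using \<delta>(4)[OF ph(2)] ph(1) by (intro mult_left_mono) auto
    moreover note small[OF near(1)[OF ph(3)], of h] near(2)[OF ph(3), of h]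
    moreover have "l \<bullet> (h + (1/2) *\<^sub>R \<Phi>'' h h - \<Phi> p) = l \<bullet> h + (l \<bullet> \<Phi>'' h h) / 2 - l \<bullet> \<Phi> p"
      by (simp add: inner_diff_right inner_add_right)
    ultimately have "l \<bullet> h \<le> - (l0 \<bullet> \<Phi>'' h h) / 2 + e * (norm h)\<^sup>2 / 2 + e / 16 * (norm h)\<^sup>2"
      by linarith
    moreover have "e * (norm h)\<^sup>2 \<ge> 0" using assms by simp
    ultimately show "- (l \<bullet> (p - y0)) \<ge> (l0 \<bullet> \<Phi>'' (p - y0) (p - y0)) / 2 - e * (norm (p - y0))\<^sup>2"
      unfolding h_def[symmetric] by simp
  qed (use \<delta>(1) \<delta>2 in simp)
qed

text \<open>For \<open>v = h - \<Phi>'' h h / 2\<close> the expansion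
  \<open>\<Phi>' p h = h + \<Phi>'' h h + o\<close> gives \<open>\<Phi>' p v = \<Phi> p + o\<close>,
  so \<open>normal_cone_nearby\<close> yields \<open>l \<bullet> v \<ge> - o\<close>, a bound from
  below on \<open>l \<bullet> h\<close>. The quadratic term of \<open>\<Phi>' p h\<close> is twice
  that of \<open>\<Phi> p\<close>, which leaves the factor 1/2.\<close>

lemma curvature_nearby:
  assumes "e > 0"
  shows "\<exists>\<delta>>0. \<forall>p\<in>K. \<forall>l\<in>normal_cone K p. norm (p - y0) < \<delta> \<longrightarrow> norm (l - l0) < \<delta> \<longrightarrow>
      l \<bullet> (p - y0) \<ge> (l0 \<bullet> \<Phi>'' (p - y0) (p - y0)) / 2 - e * (norm (p - y0))\<^sup>2"
proof -
  define C where "C = norm l0 + 1"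
  have C: "C \<ge> 1" by (simp add: C_def)
  define e1 where "e1 = e / (16 * C)"
  have e1: "e1 > 0" using assms C by (simp add: e1_def)
  obtain \<delta>2 where \<delta>2: "\<delta>2 > 0" and near: "\<And>l. norm (l - l0) < \<delta>2 \<Longrightarrow> norm l \<le> C"
      "\<And>l h. norm (l - l0) < \<delta>2 \<Longrightarrow> \<bar>l \<bullet> \<Phi>'' h h - l0 \<bullet> \<Phi>'' h h\<bar> \<le> e * (norm h)\<^sup>2"
    using near_multiplier[OF assms] unfolding C_def by metis
  obtain \<delta> where \<delta>0: "\<delta> > 0" "\<forall>h. norm h < \<delta> \<longrightarrow> y0 + h \<in> ball y0 r \<and>
    norm (\<Phi>' (y0 + h) h - h - \<Phi>'' h h) \<le> e1 * (norm h)\<^sup>2 \<and>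
    norm (\<Phi> (y0 + h) - h - (1/2) *\<^sub>R \<Phi>'' h h) \<le> e1 * (norm h)\<^sup>2"
    using chart_taylor[OF e1] by (elim exE conjE)
  then have \<delta>: "\<delta> > 0" "\<And>h. norm h < \<delta> \<Longrightarrow> y0 + h \<in> ball y0 r"
    "\<And>h. norm h < \<delta> \<Longrightarrow> norm (\<Phi>' (y0 + h) h - h - \<Phi>'' h h) \<le> e1 * (norm h)\<^sup>2"
    "\<And>h. norm h < \<delta> \<Longrightarrow> norm (\<Phi> (y0 + h) - h - (1/2) *\<^sub>R \<Phi>'' h h) \<le> e1 * (norm h)\<^sup>2"
    by blast+
  have small: "norm l * (e1 * (norm h)\<^sup>2) \<le> e / 16 * (norm h)\<^sup>2" if "norm l \<le> C" for l h :: 'h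
  proof -
    have "norm l * (e1 * (norm h)\<^sup>2) \<le> C * (e1 * (norm h)\<^sup>2)"
      using that e1 by (intro mult_right_mono) auto
    then show ?thesis using C by (simp add: e1_def)
  qed
  define C'' where "C'' = norm \<Phi>'' + 1"
  have C'': "C'' > 0" by (simp add: C''_def add_nonneg_pos)
  have Cr: "2 * (1 + C'' + e1) > 0" using e1 C'' by simp
  obtain \<delta>4 where \<delta>4: "\<delta>4 > 0" "\<And>h. norm h < \<delta>4 \<Longrightarrow> norm (\<Phi>' (y0 + h) - id_blinfun - \<Phi>'' h) \<le> e1 * norm h"
    using second_order_taylor[of "ball y0 r" y0 \<Phi> \<Phi>' \<Phi>'' e1] r_pos deriv deriv2 e1
    by (auto simp: \<Phi>_y0 deriv_y0)
  \<comment> \<open>Norm at most 1 lets squares be bounded by first powers; the bound with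
    \<open>r\<close> puts \<open>\<Phi> p\<close> where the chart is onto; the last one makes the
    third-order term \<open>\<Phi>' p q - q\<close> at most
    \<open>e1 * (norm h)\<^sup>2\<close>.\<close>
  define \<delta>3 where "\<delta>3 = min (min \<delta> \<delta>4) (min (min 1 (r / (2 * (1 + C'' + e1)))) (e1 / (C''*C'' + e1 * C'' + 1)))"
  have C4: "C''*C'' + e1 * C'' + 1 > 0" using C'' e1 by (simp add: add_pos_pos)
  have \<delta>3: "\<delta>3 > 0" using \<delta>(1) \<delta>4(1) divide_pos_pos[OF r_pos Cr] divide_pos_pos[OF e1 C4]
    unfolding \<delta>3_def by linarith
  show "\<exists>\<delta>>0. \<forall>p\<in>K. \<forall>l\<in>normal_cone K p. norm (p - y0) < \<delta> \<longrightarrow> norm (l - l0) < \<delta> \<longrightarrow>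
      l \<bullet> (p - y0) \<ge> (l0 \<bullet> \<Phi>'' (p - y0) (p - y0)) / 2 - e * (norm (p - y0))\<^sup>2"
  proof (rule exI[of _ "min \<delta>3 \<delta>2"], intro conjI ballI impI)
    fix p l assume p: "p \<in> K" and l: "l \<in> normal_cone K p"
      and n: "norm (p - y0) < min \<delta>3 \<delta>2" "norm (l - l0) < min \<delta>3 \<delta>2"
    define h where "h = p - y0"
    have ph: "p = y0 + h" "norm h < \<delta>3" "norm (l - l0) < \<delta>2" "norm h < \<delta>" "norm h < \<delta>4" "norm h \<le> 1"
      using n by (simp_all add: h_def \<delta>3_def)
    have pb: "p \<in> K \<inter> ball y0 r" using p \<delta>(2)[OF ph(4)] ph(1) by auto
    define v where "v = h - (1/2) *\<^sub>R \<Phi>'' h h"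
    define q where "q = \<Phi>'' h h"
    have q: "norm q \<le> C'' * (norm h)\<^sup>2"
    proof -
      have "norm \<Phi>'' * norm h * norm h \<le> C'' * (norm h)\<^sup>2"
        by (simp add: C''_def power2_eq_square algebra_simps)
      then show ?thesis using norm_\<Phi>''_le[of h h] unfolding q_def by linarith
    qed
    have T4: "norm (\<Phi> p - h - (1/2) *\<^sub>R q) \<le> e1 * (norm h)\<^sup>2"
      using \<delta>(4)[OF ph(4)] ph(1) by (simp add: q_def)
    have T3: "norm (\<Phi>' p h - h - q) \<le> e1 * (norm h)\<^sup>2"
      using \<delta>(3)[OF ph(4)] ph(1) by (simp add: q_def)
    have hh: "(norm h)\<^sup>2 \<le> norm h"
      using ph(6) by (simp add: power2_eq_square mult_left_le_one_le)
    have "norm (\<Phi> p) \<le> norm (\<Phi> p - h - (1/2) *\<^sub>R q) + norm h + norm ((1/2) *\<^sub>R q)"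
      using norm_triangle_ineq[of "\<Phi> p - h - (1/2) *\<^sub>R q" "h + (1/2) *\<^sub>R q"] norm_triangle_ineq[of h "(1/2) *\<^sub>R q"]
      by simp
    also have "\<dots> \<le> e1 * norm h + norm h + C'' * norm h"
    proof -
      have "norm ((1/2) *\<^sub>R q) = norm q / 2" by simp
      moreover have "e1 * (norm h)\<^sup>2 \<le> e1 * norm h" "C'' * (norm h)\<^sup>2 \<le> C'' * norm h"
        using hh e1 C'' by (auto intro: mult_left_mono)
      ultimately show ?thesis using T4 q norm_ge_zero[of q] by linarith
    qed
    also have "\<dots> = (1 + C'' + e1) * norm h" by (simp add: algebra_simps)
    also have "\<dots> < (1 + C'' + e1) * (r / (2 * (1 + C'' + e1)))"
      using ph(2) Cr by (intro mult_strict_left_mono) (auto simp: \<delta>3_def)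
    also have "\<dots> = r / 2" using Cr by (simp add: divide_simps)
    finally have pr: "2 * norm (\<Phi> p) < r" by simp
    have id: "\<Phi>' p q = q + \<Phi>'' h q + (\<Phi>' p - id_blinfun - \<Phi>'' h) q"
      by (simp add: blinfun.diff_left)
    have "norm (\<Phi>'' h q) \<le> C'' * norm h * (C'' * (norm h)\<^sup>2)"
      using norm_\<Phi>''_le[of h q] q C''
      by (elim order_trans) (intro mult_mono, auto simp: C''_def)
    moreover have "norm ((\<Phi>' p - id_blinfun - \<Phi>'' h) q) \<le> (e1 * norm h) * (C'' * (norm h)\<^sup>2)"
      using \<delta>4(2)[OF ph(5)] ph(1) q e1 by (intro order_trans[OF norm_blinfun] mult_mono) auto
    ultimately have "norm (\<Phi>' p q - q) \<le> (C'' * C'' + e1 * C'') * norm h * (norm h)\<^sup>2"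
      unfolding id using norm_triangle_ineq[of "\<Phi>'' h q" "(\<Phi>' p - id_blinfun - \<Phi>'' h) q"]
      by (simp add: algebra_simps)
    also have "\<dots> \<le> (C'' * C'' + e1 * C'' + 1) * (e1 / (C'' * C'' + e1 * C'' + 1)) * (norm h)\<^sup>2"
      using ph(2) C4 C'' e1 by (intro mult_right_mono mult_mono) (auto simp: \<delta>3_def)
    also have "\<dots> = e1 * (norm h)\<^sup>2" using C4 by (simp add: divide_simps)
    finally have T5: "norm (\<Phi>' p q - q) \<le> e1 * (norm h)\<^sup>2" .
    \<comment> \<open>The three brackets are the two Taylor remainders and half of the third-order
      term, whence the total \<open>5/2 * e1\<close>.\<close>
    have vec: "\<Phi>' p v - \<Phi> p = (\<Phi>' p h - h - q) - (1/2) *\<^sub>R (\<Phi>' p q - q) - (\<Phi> p - h - (1/2) *\<^sub>R q)"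
      using scaleR_half_double[of q]
      by (simp add: v_def q_def[symmetric] blinfun.diff_right blinfun.scaleR_right algebra_simps)
    have "norm (\<Phi>' p v - \<Phi> p) \<le> norm (\<Phi>' p h - h - q) + norm ((1/2) *\<^sub>R (\<Phi>' p q - q)) + norm (\<Phi> p - h - (1/2) *\<^sub>R q)"
      unfolding vec using norm_triangle_ineq4[of "(\<Phi>' p h - h - q) - (1/2) *\<^sub>R (\<Phi>' p q - q)" "\<Phi> p - h - (1/2) *\<^sub>R q"]
        norm_triangle_ineq4[of "\<Phi>' p h - h - q" "(1/2) *\<^sub>R (\<Phi>' p q - q)"] by linarith
    moreover have "norm ((1/2) *\<^sub>R (\<Phi>' p q - q)) = norm (\<Phi>' p q - q) / 2" by simp
    ultimately have "norm (\<Phi>' p v - \<Phi> p) \<le> 5/2 * (e1 * (norm h)\<^sup>2)"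
      using T3 T4 T5 by linarith
    then have "norm l * norm (\<Phi>' p v - \<Phi> p) \<le> norm l * (5/2 * (e1 * (norm h)\<^sup>2))"
      by (rule mult_left_mono) simp
    then have "2 * norm l * norm (\<Phi>' p v - \<Phi> p) \<le> 5 * (norm l * (e1 * (norm h)\<^sup>2))"
      by simp
    then have "l \<bullet> v \<ge> - (5 * (norm l * (e1 * (norm h)\<^sup>2)))"
      using normal_cone_nearby[OF pb pr l, of v] by linarith
    with small[OF near(1)[OF ph(3)], of h] near(2)[OF ph(3), of h]
    have "l \<bullet> h \<ge> (l0 \<bullet> \<Phi>'' h h) / 2 - e * (norm h)\<^sup>2 / 2 - 5 * (e / 16 * (norm h)\<^sup>2)"
      by (simp add: v_def inner_diff_right)
    moreover have "e * (norm h)\<^sup>2 \<ge> 0" using assms by simp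
    ultimately show "l \<bullet> (p - y0) \<ge> (l0 \<bullet> \<Phi>'' (p - y0) (p - y0)) / 2 - e * (norm (p - y0))\<^sup>2"
      unfolding h_def[symmetric] by simp
  qed (use \<delta>3 \<delta>2 in simp)
qed

end

section \<open>Coercivity from the second-order condition\<close>

text \<open>The factors \<open>s n\<close> may stay bounded or blow up. The choice
  \<open>t n = 1 / (s n + n + 1)\<close> tends to 0 and keeps \<open>t n * s n \<le> 1\<close> in
  either case, so that \<open>y0 + t n *\<^sub>R (s n *\<^sub>R (p n - y0))\<close> lies between
  \<open>y0\<close> and \<open>p n\<close>.\<close>

lemma tangent_cone_convex_limit:
  fixes y0 :: "'h::real_normed_vector"
  assumes "convex K" "y0 \<in> K" "\<And>n. p n \<in> K" "\<And>n. s n \<ge> (0::real)"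
    and lim: "(\<lambda>n. s n *\<^sub>R (p n - y0)) \<longlonglongrightarrow> h"
  shows "h \<in> tangent_cone K y0"
proof -
  define t where "t n = inverse (s n + real (Suc n))" for n
  have pos: "s n + real (Suc n) > 0" for n
    using assms(4)[of n] by simp
  have t: "t n > 0" for n using pos by (simp add: t_def)
  have "t n \<le> inverse (real (Suc n))" for n
    unfolding t_def using assms(4)[of n] by (intro le_imp_inverse_le) auto
  then have "t \<longlonglongrightarrow> 0"
    using t by (intro tendsto_sandwich[OF _ _ tendsto_const LIMSEQ_inverse_real_of_nat])
      (auto intro: always_eventually less_imp_le)
  moreover have "y0 + t n *\<^sub>R (s n *\<^sub>R (p n - y0)) \<in> K" for n
  proof -
    have "t n * s n \<le> t n * (s n + real (Suc n))"
      using t[of n] by (intro mult_left_mono) auto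
    also have "\<dots> = 1" using pos[of n] by (simp add: t_def)
    finally have "t n * s n \<le> 1" .
    moreover have "0 \<le> t n * s n" using t[of n] assms(4)[of n] by simp
    ultimately have "(1 - t n * s n) *\<^sub>R y0 + (t n * s n) *\<^sub>R p n \<in> K"
      using assms by (intro convexD) auto
    then show ?thesis by (simp add: algebra_simps)
  qed
  ultimately show ?thesis
    unfolding tangent_cone_def using t lim by blast
qed

lemma gradient_inner:
  assumes "(\<phi> has_derivative D) (at x)"
  shows "gradient \<phi> x \<bullet> v = D v"
  using frechet_derivative_at[OF assms] adjoint_works[OF has_derivative_linear[OF assms], of v 1]
  by (simp add: gradient_def inner_commute)

locale kkt_setting = straightening K "g xbar" \<Phi> \<Phi>' \<Phi>'' D r
  for K :: "'h::euclidean_space set" and g :: "'x::euclidean_space \<Rightarrow> 'h" and xbar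
    and \<Phi> \<Phi>' \<Phi>'' D r +
  fixes f :: "'x \<Rightarrow> real" and lbar :: 'h
    and f' :: "'x \<Rightarrow> 'x \<Rightarrow>\<^sub>L real" and g' :: "'x \<Rightarrow> 'x \<Rightarrow>\<^sub>L 'h"
    and f'' :: "'x \<Rightarrow>\<^sub>L ('x \<Rightarrow>\<^sub>L real)" and g'' :: "'x \<Rightarrow>\<^sub>L ('x \<Rightarrow>\<^sub>L 'h)"
  assumes f': "(f has_derivative f' x) (at x)" and f'': "(f' has_derivative f'') (at xbar)"
    and g': "(g has_derivative g' x) (at x)" and g'': "(g' has_derivative g'') (at xbar)"
    and K: "K \<noteq> {}" "closed K" "convex K"
    and KKT: "KKT_point f g K xbar lbar"
    and SOSC: "SOSC f g K xbar lbar"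
    and calm: "multiplier_map_calm f g K xbar lbar"
begin

abbreviation "ybar \<equiv> g xbar"
abbreviation "J \<equiv> g' xbar"
abbreviation "grad \<equiv> grad_lagrangian f g"
abbreviation "\<Lambda> \<equiv> multiplier_set f g K xbar"

definition "H d = f'' d d + lbar \<bullet> g'' d d"
definition "Q h = lbar \<bullet> \<Phi>'' h h"
definition "CQ = norm lbar * norm \<Phi>''"

lemma ybar_in_K: "ybar \<in> K"
  using KKT by (simp add: KKT_point_def normal_cone_def)

lemma lbar_in_\<Lambda>: "lbar \<in> \<Lambda>"
  using KKT by (simp add: KKT_point_def multiplier_set_def)

lemma lagrangian_has_derivative:
  "((\<lambda>y. lagrangian f g y l) has_derivative (\<lambda>v. f' x v + l \<bullet> g' x v)) (at x)"
  unfolding lagrangian_def by (intro derivative_intros f' g')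

lemma grad_inner: "grad x l \<bullet> v = f' x v + l \<bullet> g' x v"
  unfolding grad_lagrangian_def by (rule gradient_inner[OF lagrangian_has_derivative])

text \<open>The gradient is defined through an adjoint, so it is first written in coordinates; each
  coordinate is an evaluation of \<open>f'\<close> and \<open>g'\<close>, whose derivatives at
  \<open>xbar\<close> are known.\<close>

lemma hess_inner: "hess_lagrangian f g xbar l d \<bullet> v = f'' d v + l \<bullet> g'' d v"
proof -
  have eq: "(\<lambda>y. grad y l) = (\<lambda>y. \<Sum>i\<in>Basis. (f' y i + l \<bullet> g' y i) *\<^sub>R i)"
    by (rule ext, rule euclidean_eqI) (simp add: grad_inner)
  have df: "((\<lambda>y. f' y i) has_derivative (\<lambda>d. f'' d i)) (at xbar)" for i
    by (rule bounded_linear.has_derivative[OF blinfun.bounded_linear_left f''])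
  have dg: "((\<lambda>y. g' y i) has_derivative (\<lambda>d. g'' d i)) (at xbar)" for i
    by (rule bounded_linear.has_derivative[OF blinfun.bounded_linear_left g''])
  have "((\<lambda>y. grad y l) has_derivative (\<lambda>d. \<Sum>i\<in>Basis. (f'' d i + l \<bullet> g'' d i) *\<^sub>R i)) (at xbar)"
    unfolding eq by (intro derivative_intros df dg)
  from frechet_derivative_at[OF this]
  have "hess_lagrangian f g xbar l d = (\<Sum>i\<in>Basis. (f'' d i + l \<bullet> g'' d i) *\<^sub>R i)"
    by (simp add: hess_lagrangian_def fun_eq_iff)
  then have "hess_lagrangian f g xbar l d \<bullet> v = (\<Sum>i\<in>Basis. (f'' d i + l \<bullet> g'' d i) * (i \<bullet> v))"
    by (simp add: inner_sum_left)
  also have "\<dots> = f'' d (\<Sum>i\<in>Basis. (i \<bullet> v) *\<^sub>R i) + l \<bullet> g'' d (\<Sum>i\<in>Basis. (i \<bullet> v) *\<^sub>R i)"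
    by (simp add: blinfun.sum_right blinfun.scaleR_right inner_sum_right sum.distrib[symmetric] algebra_simps
        del: euclidean_representation)
  finally show ?thesis by (simp add: inner_commute[of _ v] euclidean_representation)
qed

text \<open>By \<open>curvature_support\<close> the support function in SOSC is at least
  \<open>- Q (J d)\<close>, so replacing it by that value can only increase the left-hand
  side.\<close>

lemma curvature_SOSC:
  assumes "d \<noteq> 0" "J d \<in> tangent_cone K ybar" "lbar \<bullet> J d = 0"
  shows "H d + Q (J d) > 0"
proof -
  have J: "frechet_derivative g (at xbar) = J"
    using frechet_derivative_at[OF g'[of xbar]] by simp
  have "d \<in> critical_cone g K xbar lbar - {0}"
    using assms by (simp add: critical_cone_def J inner_commute)
  then have *: "ereal (H d) - support_function lbar (second_order_tangent_set K ybar (J d)) > 0"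
    using SOSC unfolding SOSC_def hess_inner J H_def by blast
  have "ereal (- Q (J d)) \<le> support_function lbar (second_order_tangent_set K ybar (J d))"
    unfolding Q_def by (rule curvature_support[OF assms(2)])
  then have "ereal (H d) - support_function lbar (second_order_tangent_set K ybar (J d)) \<le> ereal (H d) - ereal (- Q (J d))"
    by (rule ereal_minus_mono[OF order_refl])
  with * have "0 < ereal (H d) - ereal (- Q (J d))"
    by (rule less_le_trans)
  then show ?thesis by simp
qed

lemma Q_abs_le: "\<bar>Q h\<bar> \<le> CQ * (norm h)\<^sup>2"
proof -
  have "\<bar>Q h\<bar> \<le> norm lbar * norm (\<Phi>'' h h)"
    unfolding Q_def by (rule Cauchy_Schwarz_ineq2)
  also have "\<dots> \<le> norm lbar * (norm \<Phi>'' * norm h * norm h)"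
    by (intro mult_left_mono norm_\<Phi>''_le) simp
  finally show ?thesis by (simp add: CQ_def power2_eq_square mult.assoc)
qed

lemma CQ_nonneg: "CQ \<ge> 0" by (simp add: CQ_def)

lemma Q_scaleR: "Q (t *\<^sub>R h) = t\<^sup>2 * Q h"
  by (simp add: Q_def blinfun.scaleR_left blinfun.scaleR_right power2_eq_square)

lemma H_scaleR: "H (t *\<^sub>R h) = t\<^sup>2 * H h"
  by (simp add: H_def blinfun.scaleR_left blinfun.scaleR_right power2_eq_square algebra_simps)

lemma continuous_H: "continuous_on UNIV H" and continuous_Q: "continuous_on UNIV Q"
  unfolding H_def Q_def by (intro continuous_intros)+

text \<open>The second-order sufficient condition, with both conditions defining the critical cone
  replaced by penalty terms.\<close>

lemma coercivity:
  "\<exists>\<gamma>>0. \<exists>M>0. \<forall>d. \<forall>p\<in>K. \<forall>s\<ge>0.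
     H d + Q (s *\<^sub>R (p - ybar)) \<ge> \<gamma> * (norm d)\<^sup>2 - M * (norm (J d - s *\<^sub>R (p - ybar)))\<^sup>2
        - M * norm d * (- (lbar \<bullet> (s *\<^sub>R (p - ybar))))"
proof (rule ccontr)
  assume contra: "\<not> ?thesis"
  \<comment> \<open>The estimate is assumed to fail for \<open>\<gamma> = 1 / (n + 1)\<close> and
    \<open>M = n + 1 + 2 * CQ\<close>. The part \<open>2 * CQ\<close> compensates for
    \<open>Q\<close>, which is not bounded before the distance of \<open>h\<close> from
    \<open>J d\<close> is; the part \<open>n + 1\<close> then forces both penalties to 0.\<close>
  have "\<exists>d p s. p \<in> K \<and> s \<ge> 0 \<and> norm d = 1 \<and> H d + Q (s *\<^sub>R (p - ybar)) <
      inverse (real (Suc n)) - (real (Suc n) + 2 * CQ) * (norm (J d - s *\<^sub>R (p - ybar)))\<^sup>2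
        - (real (Suc n) + 2 * CQ) * (- (lbar \<bullet> (s *\<^sub>R (p - ybar))))" for n
  proof -
    define \<gamma> where "\<gamma> = inverse (real (Suc n))"
    define M where "M = real (Suc n) + 2 * CQ"
    have \<gamma>M: "\<gamma> > 0" "M > 0" "M \<ge> CQ" using CQ_nonneg by (simp_all add: \<gamma>_def M_def)
    obtain d p s where ps: "p \<in> K" "s \<ge> 0" and
      lt: "H d + Q (s *\<^sub>R (p - ybar)) < \<gamma> * (norm d)\<^sup>2 - M * (norm (J d - s *\<^sub>R (p - ybar)))\<^sup>2
        - M * norm d * (- (lbar \<bullet> (s *\<^sub>R (p - ybar))))"
      using contra \<gamma>M unfolding not_ex not_all not_le not_imp by (metis not_le)
    define h where "h = s *\<^sub>R (p - ybar)"
    \<comment> \<open>For \<open>d = 0\<close> the failure would read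
      \<open>Q h < - M * (norm h)\<^sup>2\<close>, contrary to \<open>M \<ge> CQ\<close>.\<close>
    have "d \<noteq> 0"
    proof
      assume "d = 0"
      then have "Q h < - M * (norm h)\<^sup>2"
        using lt by (simp add: h_def[symmetric] H_def)
      moreover have "CQ * (norm h)\<^sup>2 \<le> M * (norm h)\<^sup>2"
        using \<gamma>M by (intro mult_right_mono) auto
      ultimately show False using Q_abs_le[of h] by simp
    qed
    \<comment> \<open>All terms are homogeneous of degree two in \<open>(d, h)\<close>; the factor
      \<open>norm d\<close> in the gap penalty serves this purpose, and \<open>s\<close> absorbs the
      scaling of \<open>h\<close>.\<close>
    define t where "t = inverse (norm d)"
    have t: "t > 0" "t * norm d = 1" using \<open>d \<noteq> 0\<close> by (simp_all add: t_def)
    have n1: "norm (t *\<^sub>R d) = 1" using t by simp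
    have "t\<^sup>2 * (H d + Q h) < t\<^sup>2 * (\<gamma> * (norm d)\<^sup>2 - M * (norm (J d - h))\<^sup>2 - M * norm d * (- (lbar \<bullet> h)))"
      using lt t by (intro mult_strict_left_mono) (auto simp: h_def)
    also have "\<dots> = \<gamma> * (t * norm d)\<^sup>2 - M * (t * norm (J d - h))\<^sup>2 - M * (t * norm d) * (- (lbar \<bullet> (t *\<^sub>R h)))"
      by (simp add: power2_eq_square algebra_simps)
    also have "t * norm (J d - h) = norm (J (t *\<^sub>R d) - t *\<^sub>R h)"
      using t by (simp add: blinfun.scaleR_right flip: scaleR_diff_right)
    finally have "H (t *\<^sub>R d) + Q (t *\<^sub>R h) < \<gamma> - M * (norm (J (t *\<^sub>R d) - t *\<^sub>R h))\<^sup>2 - M * (- (lbar \<bullet> (t *\<^sub>R h)))"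
      by (simp add: t H_scaleR Q_scaleR algebra_simps)
    then show ?thesis
      using n1 ps t unfolding \<gamma>_def M_def h_def scaleR_scaleR
      by (intro exI[of _ "t *\<^sub>R d"] exI[of _ p] exI[of _ "t * s"]) simp
  qed
  then obtain d p s where p: "\<And>n. p n \<in> K" and s: "\<And>n. s n \<ge> 0" and d: "\<And>n. norm (d n) = 1"
    and lt: "\<And>n::nat. H (d n) + Q (s n *\<^sub>R (p n - ybar)) <
      inverse (real (Suc n)) - (real (Suc n) + 2 * CQ) * (norm (J (d n) - s n *\<^sub>R (p n - ybar)))\<^sup>2
        - (real (Suc n) + 2 * CQ) * (- (lbar \<bullet> (s n *\<^sub>R (p n - ybar))))"
    by metis
  define h where "h n = s n *\<^sub>R (p n - ybar)" for n
  have G: "lbar \<bullet> h n \<le> 0" for n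
    using KKT p[of n] s[of n] by (simp add: KKT_point_def normal_cone_def h_def mult_le_0_iff)
  obtain CH where CH: "\<And>n. \<bar>H (d n)\<bar> \<le> CH"
  proof -
    have "compact (H ` sphere 0 1)"
      using continuous_H continuous_on_subset by (intro compact_continuous_image) auto
    then obtain B where "\<forall>y\<in>H ` sphere 0 1. norm y \<le> B"
      using compact_imp_bounded bounded_iff by metis
    then show ?thesis using d by (intro that[of B]) auto
  qed
  define B where "B = 1 + CH + 2 * CQ * (norm J)\<^sup>2"
  \<comment> \<open>From \<open>(norm h)\<^sup>2 \<le> 2 * (norm J)\<^sup>2 + 2 * (norm (J d -
    h))\<^sup>2\<close>, the unbounded part of \<open>- Q h\<close> is cancelled by the
    \<open>2 * CQ\<close> share of the penalty.\<close>
  have bound: "real (Suc n) * (norm (J (d n) - h n))\<^sup>2 + real (Suc n) * (- (lbar \<bullet> h n)) \<le> B" for n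
  proof -
    have "norm (h n) \<le> norm (J (d n)) + norm (J (d n) - h n)"
      using norm_triangle_ineq4[of "J (d n)" "J (d n) - h n"] by simp
    also have "norm (J (d n)) \<le> norm J"
      using norm_blinfun[of J "d n"] d[of n] by simp
    finally have "(norm (h n))\<^sup>2 \<le> (norm J + norm (J (d n) - h n))\<^sup>2"
      by (intro power_mono) auto
    also have "\<dots> \<le> 2 * (norm J)\<^sup>2 + 2 * (norm (J (d n) - h n))\<^sup>2"
      using sum_squares_bound[of "norm J" "norm (J (d n) - h n)"] by (simp add: power2_sum)
    finally have "CQ * (norm (h n))\<^sup>2 \<le> CQ * (2 * (norm J)\<^sup>2 + 2 * (norm (J (d n) - h n))\<^sup>2)"
      using CQ_nonneg by (rule mult_left_mono)
    then have "- Q (h n) \<le> 2 * CQ * (norm J)\<^sup>2 + 2 * CQ * (norm (J (d n) - h n))\<^sup>2"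
      using Q_abs_le[of "h n"] by (simp add: algebra_simps)
    moreover have "- H (d n) \<le> CH" using CH[of n] by linarith
    moreover have "inverse (real (Suc n)) \<le> 1" by (simp add: inverse_eq_divide)
    moreover have "2 * CQ * (- (lbar \<bullet> h n)) \<ge> 0"
      using CQ_nonneg G[of n] by (intro mult_nonneg_nonneg) auto
    moreover have "(real (Suc n) + 2 * CQ) * (norm (J (d n) - h n))\<^sup>2
        = real (Suc n) * (norm (J (d n) - h n))\<^sup>2 + 2 * CQ * (norm (J (d n) - h n))\<^sup>2"
      "(real (Suc n) + 2 * CQ) * (- (lbar \<bullet> h n)) = real (Suc n) * (- (lbar \<bullet> h n)) + 2 * CQ * (- (lbar \<bullet> h n))"
      by (simp_all add: algebra_simps)
    ultimately show ?thesis
      using lt[of n] unfolding h_def[symmetric] B_def by linarith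
  qed
  have B0: "(\<lambda>n. B * inverse (real (Suc n))) \<longlonglongrightarrow> 0"
    using tendsto_mult_right_zero[OF LIMSEQ_inverse_real_of_nat] by simp
  have sq: "(norm (J (d n) - h n))\<^sup>2 \<le> B * inverse (real (Suc n))"
    and lin: "- (lbar \<bullet> h n) \<le> B * inverse (real (Suc n))" for n
  proof -
    have "0 \<le> real (Suc n) * (norm (J (d n) - h n))\<^sup>2" by simp
    moreover have "0 \<le> real (Suc n) * (- (lbar \<bullet> h n))"
      by (rule mult_nonneg_nonneg) (use G[of n] in auto)
    ultimately have "real (Suc n) * (norm (J (d n) - h n))\<^sup>2 \<le> B" "real (Suc n) * (- (lbar \<bullet> h n)) \<le> B"
      using bound[of n] by linarith+
    then show "(norm (J (d n) - h n))\<^sup>2 \<le> B * inverse (real (Suc n))"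
      and "- (lbar \<bullet> h n) \<le> B * inverse (real (Suc n))"
      by (simp_all only: inverse_eq_divide) (simp_all add: field_simps)
  qed
  have "(\<lambda>n. (norm (J (d n) - h n))\<^sup>2) \<longlonglongrightarrow> 0"
    using sq by (intro tendsto_sandwich[OF _ _ tendsto_const B0]) auto
  then have "(\<lambda>n. norm (J (d n) - h n)) \<longlonglongrightarrow> 0"
    using tendsto_real_sqrt by fastforce
  then have lim1: "(\<lambda>n. J (d n) - h n) \<longlonglongrightarrow> 0"
    by (rule tendsto_norm_zero_cancel)
  have lim2: "(\<lambda>n. - (lbar \<bullet> h n)) \<longlonglongrightarrow> 0"
    using lin G by (intro tendsto_sandwich[OF _ _ tendsto_const B0]) auto
  \<comment> \<open>A limit \<open>u\<close> of the unit directions is critical, as both penalties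
    vanish in the limit, but has \<open>H u + Q (J u) \<le> 0\<close>.\<close>
  have "d n \<in> sphere 0 1" for n using d by simp
  then obtain u \<sigma> where u: "u \<in> sphere 0 1" and \<sigma>: "strict_mono (\<sigma> :: nat \<Rightarrow> nat)" and du: "(d \<circ> \<sigma>) \<longlonglongrightarrow> u"
    using compact_sphere[of "0::'x" 1] unfolding compact_def by metis
  have "(\<lambda>n. J (d (\<sigma> n)) - (J (d (\<sigma> n)) - h (\<sigma> n))) \<longlonglongrightarrow> J u - 0"
    using du LIMSEQ_subseq_LIMSEQ[OF lim1 \<sigma>]
    by (intro tendsto_diff blinfun.tendsto tendsto_const) (simp_all add: o_def)
  then have hu: "(\<lambda>n. h (\<sigma> n)) \<longlonglongrightarrow> J u" by simp
  have tan: "J u \<in> tangent_cone K ybar"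
    using hu unfolding h_def
    by (intro tangent_cone_convex_limit[OF K(3) ybar_in_K, of "\<lambda>n. p (\<sigma> n)" "\<lambda>n. s (\<sigma> n)"] p s)
  have "(\<lambda>n. - (lbar \<bullet> h (\<sigma> n))) \<longlonglongrightarrow> - (lbar \<bullet> J u)"
    using hu by (intro tendsto_intros)
  moreover have "(\<lambda>n. - (lbar \<bullet> h (\<sigma> n))) \<longlonglongrightarrow> 0"
    using LIMSEQ_subseq_LIMSEQ[OF lim2 \<sigma>] by (simp add: o_def)
  ultimately have crit: "lbar \<bullet> J u = 0"
    using LIMSEQ_unique[of "\<lambda>n. - (lbar \<bullet> h (\<sigma> n))" "- (lbar \<bullet> J u)" 0] by simp
  have "(\<lambda>n. H (d (\<sigma> n)) + Q (h (\<sigma> n))) \<longlonglongrightarrow> H u + Q (J u)"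
    using du unfolding o_def
    by (intro tendsto_add continuous_on_tendsto_compose[OF continuous_H]
        continuous_on_tendsto_compose[OF continuous_Q] hu) simp_all
  moreover have "(\<lambda>n. inverse (real (Suc (\<sigma> n)))) \<longlonglongrightarrow> 0"
    using LIMSEQ_subseq_LIMSEQ[OF LIMSEQ_inverse_real_of_nat \<sigma>] by (simp add: o_def)
  moreover have "H (d n) + Q (h n) \<le> inverse (real (Suc n))" for n
  proof -
    have "(real (Suc n) + 2 * CQ) * (norm (J (d n) - h n))\<^sup>2 \<ge> 0"
      by (rule mult_nonneg_nonneg) (use CQ_nonneg in auto)
    moreover have "(real (Suc n) + 2 * CQ) * (- (lbar \<bullet> h n)) \<ge> 0"
      by (rule mult_nonneg_nonneg) (use CQ_nonneg G[of n] in auto)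
    ultimately show ?thesis using lt[of n] unfolding h_def[symmetric] by linarith
  qed
  ultimately have "H u + Q (J u) \<le> 0"
    by (intro LIMSEQ_le[of _ _ "\<lambda>n. inverse (real (Suc (\<sigma> n)))"]) auto
  moreover have "u \<noteq> 0" using u by auto
  ultimately show False using curvature_SOSC[OF _ tan crit] by simp
qed

end

lemma power2_le_sum:
  fixes a u v :: real
  assumes "0 \<le> a" "a \<le> u + v"
  shows "a\<^sup>2 \<le> 2 * u\<^sup>2 + 2 * v\<^sup>2"
proof -
  have "a\<^sup>2 \<le> (u + v)\<^sup>2" using assms by (intro power_mono)
  also have "\<dots> \<le> 2 * u\<^sup>2 + 2 * v\<^sup>2"
    using sum_squares_bound[of u v] by (simp add: power2_sum)
  finally show ?thesis .
qed

section \<open>Expansions at nearby multipliers and localised coercivity\<close>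

context kkt_setting
begin

lemma local_expansion:
  assumes "e > 0"
  shows "\<exists>\<delta>>0. \<forall>x. norm (x - xbar) < \<delta> \<longrightarrow>
    \<bar>f x - f xbar - f' xbar (x - xbar) - f'' (x - xbar) (x - xbar) / 2\<bar> \<le> e * (norm (x - xbar))\<^sup>2 \<and>
    norm (f' x - f' xbar - f'' (x - xbar)) \<le> e * norm (x - xbar) \<and>
    norm (g x - ybar - J (x - xbar) - (1/2) *\<^sub>R g'' (x - xbar) (x - xbar)) \<le> e * (norm (x - xbar))\<^sup>2 \<and>
    norm (g' x - J - g'' (x - xbar)) \<le> e * norm (x - xbar)"
proof -
  obtain \<delta>1 where 1: "\<delta>1 > 0" "\<forall>d. norm d < \<delta>1 \<longrightarrow> xbar + d \<in> UNIV \<and>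
      norm (f' (xbar + d) - f' xbar - f'' d) \<le> e * norm d \<and>
      norm (f (xbar + d) - f xbar - f' xbar d - (1/2) *\<^sub>R f'' d d) \<le> e * (norm d)\<^sup>2"
    using second_order_taylor[OF open_UNIV UNIV_I f' f'' assms] by blast
  obtain \<delta>2 where 2: "\<delta>2 > 0" "\<forall>d. norm d < \<delta>2 \<longrightarrow> xbar + d \<in> UNIV \<and>
      norm (g' (xbar + d) - g' xbar - g'' d) \<le> e * norm d \<and>
      norm (g (xbar + d) - g xbar - g' xbar d - (1/2) *\<^sub>R g'' d d) \<le> e * (norm d)\<^sup>2"
    using second_order_taylor[OF open_UNIV UNIV_I g' g'' assms] by blast
  show ?thesis
  proof (intro exI[of _ "min \<delta>1 \<delta>2"] conjI allI impI)
    fix x assume "norm (x - xbar) < min \<delta>1 \<delta>2"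
    then show "\<bar>f x - f xbar - f' xbar (x - xbar) - f'' (x - xbar) (x - xbar) / 2\<bar> \<le> e * (norm (x - xbar))\<^sup>2"
      "norm (f' x - f' xbar - f'' (x - xbar)) \<le> e * norm (x - xbar)"
      "norm (g x - ybar - J (x - xbar) - (1/2) *\<^sub>R g'' (x - xbar) (x - xbar)) \<le> e * (norm (x - xbar))\<^sup>2"
      "norm (g' x - J - g'' (x - xbar)) \<le> e * norm (x - xbar)"
      using 1(2)[rule_format, of "x - xbar"] 2(2)[rule_format, of "x - xbar"] by simp_all
  qed (use 1 2 in simp)
qed

lemma local_lipschitz:
  "\<exists>C\<ge>1. \<exists>\<delta>>0. \<forall>x. norm (x - xbar) < \<delta> \<longrightarrow>
    norm (g x - ybar) \<le> C * norm (x - xbar) \<and> norm (f' x - f' xbar) \<le> C * norm (x - xbar) \<and>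
    norm (g' x - J) \<le> C * norm (x - xbar) \<and> norm (g' x) \<le> C \<and>
    norm (g x - ybar - J (x - xbar)) \<le> C * (norm (x - xbar))\<^sup>2"
proof -
  obtain \<delta> where \<delta>: "\<delta> > 0" and ex: "\<And>x. norm (x - xbar) < \<delta> \<Longrightarrow>
    norm (f' x - f' xbar - f'' (x - xbar)) \<le> norm (x - xbar) \<and>
    norm (g x - ybar - J (x - xbar) - (1/2) *\<^sub>R g'' (x - xbar) (x - xbar)) \<le> (norm (x - xbar))\<^sup>2 \<and>
    norm (g' x - J - g'' (x - xbar)) \<le> norm (x - xbar)"
    using local_expansion[of 1] by auto
  define C where "C = 1 + norm J + norm f'' + norm g''"
  show ?thesis
  proof (rule exI[of _ C], rule conjI, simp add: C_def, rule exI[of _ "min 1 \<delta>"], intro conjI allI impI)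
    fix x assume x: "norm (x - xbar) < min 1 \<delta>"
    define d where "d = x - xbar"
    have d: "norm d \<le> 1" "(norm d)\<^sup>2 \<le> norm d"
      using x by (simp_all add: d_def power2_eq_square mult_left_le_one_le)
    have e: "norm (f' x - f' xbar - f'' d) \<le> norm d"
      "norm (g x - ybar - J d - (1/2) *\<^sub>R g'' d d) \<le> (norm d)\<^sup>2"
      "norm (g' x - J - g'' d) \<le> norm d"
      using ex[of x] x by (simp_all add: d_def)
    have nf: "norm (f'' d) \<le> norm f'' * norm d" and ng: "norm (g'' d) \<le> norm g'' * norm d"
      and nJ: "norm (J d) \<le> norm J * norm d" by (rule norm_blinfun)+
    have "norm (g'' d d) \<le> norm g'' * norm d * norm d"
      by (rule order_trans[OF norm_blinfun mult_right_mono[OF norm_blinfun]]) simp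
    moreover have "norm ((1/2) *\<^sub>R g'' d d) = norm (g'' d d) / 2" by simp
    ultimately have ngg: "norm ((1/2) *\<^sub>R g'' d d) \<le> norm g'' * (norm d)\<^sup>2"
      using norm_ge_zero[of "g'' d d"] by (simp add: power2_eq_square mult.assoc del: norm_ge_zero)
    have le: "a * t \<le> C * t" if "a \<le> C" "t \<ge> 0" for a t using that by (rule mult_right_mono)
    have "norm (g x - ybar - J d) \<le> norm (g x - ybar - J d - (1/2) *\<^sub>R g'' d d) + norm ((1/2) *\<^sub>R g'' d d)"
      using norm_triangle_ineq[of "g x - ybar - J d - (1/2) *\<^sub>R g'' d d" "(1/2) *\<^sub>R g'' d d"] by simp
    also have "\<dots> \<le> (1 + norm g'') * (norm d)\<^sup>2"
      using e(2) ngg by (simp add: distrib_right)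
    finally have g2: "norm (g x - ybar - J d) \<le> (1 + norm g'') * (norm d)\<^sup>2" .
    also have "\<dots> \<le> C * (norm d)\<^sup>2" by (intro le) (auto simp: C_def)
    finally show "norm (g x - ybar - J (x - xbar)) \<le> C * (norm (x - xbar))\<^sup>2" by (simp add: d_def)
    have "norm (g x - ybar) \<le> norm (g x - ybar - J d) + norm (J d)"
      using norm_triangle_ineq[of "g x - ybar - J d" "J d"] by simp
    also have "\<dots> \<le> (1 + norm g'') * norm d + norm J * norm d"
    proof -
      have "(1 + norm g'') * (norm d)\<^sup>2 \<le> (1 + norm g'') * norm d"
        using d by (intro mult_left_mono) auto
      then show ?thesis using g2 nJ by linarith
    qed
    also have "\<dots> = (1 + norm g'' + norm J) * norm d" by (simp add: distrib_right)
    also have "\<dots> \<le> C * norm d" by (intro le) (auto simp: C_def)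
    finally show "norm (g x - ybar) \<le> C * norm (x - xbar)" by (simp add: d_def)
    have "norm (f' x - f' xbar) \<le> norm (f' x - f' xbar - f'' d) + norm (f'' d)"
      using norm_triangle_ineq[of "f' x - f' xbar - f'' d" "f'' d"] by simp
    also have "\<dots> \<le> (1 + norm f'') * norm d" using e(1) nf by (simp add: distrib_right)
    also have "\<dots> \<le> C * norm d" by (intro le) (auto simp: C_def)
    finally show "norm (f' x - f' xbar) \<le> C * norm (x - xbar)" by (simp add: d_def)
    have "norm (g' x - J) \<le> norm (g' x - J - g'' d) + norm (g'' d)"
      using norm_triangle_ineq[of "g' x - J - g'' d" "g'' d"] by simp
    also have "\<dots> \<le> (1 + norm g'') * norm d" using e(3) ng by (simp add: distrib_right)
    finally have gg: "norm (g' x - J) \<le> (1 + norm g'') * norm d" .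
    also have "\<dots> \<le> C * norm d" by (intro le) (auto simp: C_def)
    finally show "norm (g' x - J) \<le> C * norm (x - xbar)" by (simp add: d_def)
    have "norm (g' x) \<le> norm (g' x - J) + norm J"
      using norm_triangle_ineq[of "g' x - J" J] by simp
    also have "\<dots> \<le> (1 + norm g'') * 1 + norm J"
      using gg d(1) mult_left_mono[OF d(1), of "1 + norm g''"] by simp
    also have "\<dots> \<le> C" by (simp add: C_def)
    finally show "norm (g' x) \<le> C" .
  qed (use \<delta> in simp)
qed

lemma \<Lambda>D: "m \<in> \<Lambda> \<Longrightarrow> grad xbar m = 0" "m \<in> \<Lambda> \<Longrightarrow> m \<in> normal_cone K ybar"
  by (simp_all add: multiplier_set_def)

lemma g''_near: "\<bar>(m - lbar) \<bullet> g'' d d\<bar> \<le> norm (m - lbar) * (norm g'' * (norm d)\<^sup>2)"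
proof -
  have "norm (g'' d d) \<le> norm g'' * norm d * norm d"
    by (rule order_trans[OF norm_blinfun mult_right_mono[OF norm_blinfun]]) simp
  then have "norm (m - lbar) * norm (g'' d d) \<le> norm (m - lbar) * (norm g'' * (norm d)\<^sup>2)"
    by (intro mult_left_mono) (simp_all add: power2_eq_square mult.assoc)
  then show ?thesis using Cauchy_Schwarz_ineq2 order_trans by blast
qed

text \<open>Stationarity of \<open>m\<close> at \<open>xbar\<close> removes the linear term of the
  Lagrangian. In the second estimate \<open>(l - m) \<bullet> J d\<close> is traded for
  \<open>(l - m) \<bullet> (g x - ybar)\<close>; the difference involves
  \<open>(l - m) \<bullet> g'' d d\<close>, small because both multipliers are near
  \<open>lbar\<close>.\<close>

lemma expansions_at_multipliers:
  assumes e: "e > 0"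
  shows "\<exists>\<delta>>0. \<forall>x m l. norm (x - xbar) < \<delta> \<longrightarrow> m \<in> \<Lambda> \<longrightarrow> norm (m - lbar) < \<delta> \<longrightarrow> norm (l - lbar) < \<delta> \<longrightarrow>
    \<bar>f x + m \<bullet> g x - (f xbar + m \<bullet> ybar) - H (x - xbar) / 2\<bar> \<le> e * (norm (x - xbar))\<^sup>2 \<and>
    \<bar>grad x l \<bullet> (x - xbar) - (H (x - xbar) + (l - m) \<bullet> (g x - ybar))\<bar> \<le> e * (norm (x - xbar))\<^sup>2"
proof -
  define C where "C = norm lbar + 1"
  have C: "C \<ge> 1" by (simp add: C_def)
  define e1 where "e1 = e / (8 * C)"
  have e1: "e1 > 0" using e C by (simp add: e1_def)
  obtain \<delta> where \<delta>: "\<delta> > 0" and ex: "\<And>x. norm (x - xbar) < \<delta> \<Longrightarrow>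
    \<bar>f x - f xbar - f' xbar (x - xbar) - f'' (x - xbar) (x - xbar) / 2\<bar> \<le> e1 * (norm (x - xbar))\<^sup>2 \<and>
    norm (f' x - f' xbar - f'' (x - xbar)) \<le> e1 * norm (x - xbar) \<and>
    norm (g x - ybar - J (x - xbar) - (1/2) *\<^sub>R g'' (x - xbar) (x - xbar)) \<le> e1 * (norm (x - xbar))\<^sup>2 \<and>
    norm (g' x - J - g'' (x - xbar)) \<le> e1 * norm (x - xbar)"
    using local_expansion[OF e1] by blast
  have pos: "norm g'' + 1 > 0" by (simp add: add_nonneg_pos)
  define \<delta>' where "\<delta>' = min \<delta> (min 1 (e / (4 * (norm g'' + 1))))"
  show ?thesis
  proof (rule exI[of _ \<delta>'], rule conjI, use \<delta> e pos in \<open>simp add: \<delta>'_def\<close>, intro allI impI)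
    fix x m l assume x: "norm (x - xbar) < \<delta>'" and m: "m \<in> \<Lambda>" "norm (m - lbar) < \<delta>'" and l: "norm (l - lbar) < \<delta>'"
    define d where "d = x - xbar"
    define rf where "rf = f x - f xbar - f' xbar d - f'' d d / 2"
    define rg where "rg = g x - ybar - J d - (1/2) *\<^sub>R g'' d d"
    define sf where "sf = (f' x - f' xbar - f'' d) d"
    define sg where "sg = (g' x - J - g'' d) d"
    have ex': "norm (f' x - f' xbar - f'' d) \<le> e1 * norm d" "norm (g' x - J - g'' d) \<le> e1 * norm d"
      and rf: "\<bar>rf\<bar> \<le> e1 * (norm d)\<^sup>2" and rg: "norm rg \<le> e1 * (norm d)\<^sup>2"
      using ex[of x] x by (simp_all add: d_def \<delta>'_def rf_def rg_def)
    have sf: "\<bar>sf\<bar> \<le> e1 * (norm d)\<^sup>2"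
      using order_trans[OF norm_blinfun mult_right_mono[OF ex'(1)], of d]
      by (simp add: sf_def power2_eq_square mult.assoc)
    have sg: "norm sg \<le> e1 * (norm d)\<^sup>2"
      using order_trans[OF norm_blinfun mult_right_mono[OF ex'(2)], of d]
      by (simp add: sg_def power2_eq_square mult.assoc)
    have nm: "norm k \<le> C" "\<bar>(k - lbar) \<bullet> g'' d d\<bar> \<le> e / 4 * (norm d)\<^sup>2" if "norm (k - lbar) < \<delta>'" for k
    proof -
      show "norm k \<le> C"
        using that norm_triangle_ineq2[of k lbar] by (simp add: C_def \<delta>'_def)
      have "norm (k - lbar) * (norm g'' * (norm d)\<^sup>2) \<le> (e / (4 * (norm g'' + 1))) * ((norm g'' + 1) * (norm d)\<^sup>2)"
        using that pos e by (intro mult_mono mult_right_mono) (auto simp: \<delta>'_def)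
      also have "\<dots> = e / 4 * (norm d)\<^sup>2" using pos by (simp add: divide_simps)
      finally show "\<bar>(k - lbar) \<bullet> g'' d d\<bar> \<le> e / 4 * (norm d)\<^sup>2"
        using g''_near[of k d] by linarith
    qed
    have rem: "\<bar>k \<bullet> v\<bar> \<le> e / 8 * (norm d)\<^sup>2" if "norm k \<le> C" "norm v \<le> e1 * (norm d)\<^sup>2" for k v :: 'h
    proof -
      have "\<bar>k \<bullet> v\<bar> \<le> norm k * norm v" by (rule Cauchy_Schwarz_ineq2)
      also have "\<dots> \<le> C * (e1 * (norm d)\<^sup>2)" using that C by (intro mult_mono) auto
      also have "\<dots> = e / 8 * (norm d)\<^sup>2" using C by (simp add: e1_def)
      finally show ?thesis .
    qed
    have "e1 * (norm d)\<^sup>2 \<le> e / 8 * (norm d)\<^sup>2"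
    proof (rule mult_right_mono)
      show "e1 \<le> e / 8" using C e by (simp add: e1_def divide_simps mult_left_le)
    qed simp
    then have rs: "\<bar>rf\<bar> \<le> e / 8 * (norm d)\<^sup>2" "\<bar>sf\<bar> \<le> e / 8 * (norm d)\<^sup>2" using rf sf by linarith+
    have grad0: "f' xbar d + m \<bullet> J d = 0"
      using grad_inner[of xbar m d] \<Lambda>D(1)[OF m(1)] by simp
    have e0: "e * (norm d)\<^sup>2 \<ge> 0" using e by simp
    have fx: "f x = f xbar + f' xbar d + f'' d d / 2 + rf" by (simp add: rf_def)
    have gx: "g x = ybar + J d + (1/2) *\<^sub>R g'' d d + rg" by (simp add: rg_def)
    have kgx: "k \<bullet> g x = k \<bullet> ybar + k \<bullet> J d + (k \<bullet> g'' d d) / 2 + k \<bullet> rg" for k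
      by (subst gx) (simp add: inner_add_right)
    have Hk: "k \<bullet> g'' d d = lbar \<bullet> g'' d d + (k - lbar) \<bullet> g'' d d" for k
      by (simp add: inner_diff_left)
    have Hd: "H d = f'' d d + lbar \<bullet> g'' d d" by (simp add: H_def)
    have "f x + m \<bullet> g x - (f xbar + m \<bullet> ybar) - H d / 2 = rf + m \<bullet> rg + ((m - lbar) \<bullet> g'' d d) / 2"
      unfolding fx kgx Hd using grad0 Hk[of m] by argo
    then have "\<bar>f x + m \<bullet> g x - (f xbar + m \<bullet> ybar) - H d / 2\<bar> \<le> e * (norm d)\<^sup>2"
      using rs(1) rem[OF nm(1)[OF m(2)] rg] nm(2)[OF m(2)] e0 by linarith
    moreover
    have f'x: "f' x d = f' xbar d + f'' d d + sf" by (simp add: sf_def blinfun.diff_left)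
    have g'x: "g' x d = J d + g'' d d + sg" by (simp add: sg_def blinfun.diff_left)
    have kg'x: "k \<bullet> g' x d = k \<bullet> J d + k \<bullet> g'' d d + k \<bullet> sg" for k
      by (simp add: g'x inner_add_right)
    have lm: "(l - m) \<bullet> (g x - ybar) = l \<bullet> g x - l \<bullet> ybar - (m \<bullet> g x - m \<bullet> ybar)"
      by (simp add: inner_diff_left inner_diff_right)
    have "grad x l \<bullet> d - (H d + (l - m) \<bullet> (g x - ybar))
        = sf + l \<bullet> sg - l \<bullet> rg + m \<bullet> rg + ((l - lbar) \<bullet> g'' d d) / 2 + ((m - lbar) \<bullet> g'' d d) / 2"
      unfolding lm grad_inner f'x kg'x Hd kgx using grad0 Hk[of m] Hk[of l] by argo
    then have "\<bar>grad x l \<bullet> d - (H d + (l - m) \<bullet> (g x - ybar))\<bar> \<le> e * (norm d)\<^sup>2"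
      using rs(2) rem[OF nm(1)[OF m(2)] rg] rem[OF nm(1)[OF l] rg] rem[OF nm(1)[OF l] sg]
        nm(2)[OF m(2)] nm(2)[OF l] e0 by linarith
    ultimately show "\<bar>f x + m \<bullet> g x - (f xbar + m \<bullet> ybar) - H (x - xbar) / 2\<bar> \<le> e * (norm (x - xbar))\<^sup>2 \<and>
      \<bar>grad x l \<bullet> (x - xbar) - (H (x - xbar) + (l - m) \<bullet> (g x - ybar))\<bar> \<le> e * (norm (x - xbar))\<^sup>2"
      by (simp add: d_def)
  qed
qed

lemma normal_cone_base_nonneg: "p \<in> K \<Longrightarrow> m \<in> normal_cone K ybar \<Longrightarrow> - (m \<bullet> (p - ybar)) \<ge> 0"
  by (simp add: normal_cone_def)

text \<open>Coercivity is used at \<open>s = 1\<close>, with \<open>J d\<close> replaced by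
  \<open>g x - ybar\<close> and \<open>lbar\<close> by \<open>m\<close>. The gap there carries the
  factor \<open>M0 * norm d\<close>, which nearness to \<open>xbar\<close> makes smaller than
  \<open>\<theta>\<close>; this is why \<open>\<gamma>\<close> and \<open>M\<close> can be chosen
  before \<open>\<theta>\<close>.\<close>

lemma local_coercivity:
  "\<exists>\<gamma>>0. \<exists>M>0. \<forall>\<theta>>0. \<exists>\<delta>>0. \<forall>x. \<forall>p\<in>K. \<forall>m\<in>normal_cone K ybar.
     norm (x - xbar) < \<delta> \<longrightarrow> norm (m - lbar) < \<delta> \<longrightarrow>
     H (x - xbar) + Q (p - ybar) + \<theta> * (- (m \<bullet> (p - ybar)))
       \<ge> \<gamma> * (norm (x - xbar))\<^sup>2 - M * (norm (g x - p))\<^sup>2"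
proof -
  obtain \<gamma>0 M0 where \<gamma>0: "\<gamma>0 > 0" and M0: "M0 > 0" and coer: "\<And>d p s. p \<in> K \<Longrightarrow> s \<ge> 0 \<Longrightarrow>
     H d + Q (s *\<^sub>R (p - ybar)) \<ge> \<gamma>0 * (norm d)\<^sup>2 - M0 * (norm (J d - s *\<^sub>R (p - ybar)))\<^sup>2
        - M0 * norm d * (- (lbar \<bullet> (s *\<^sub>R (p - ybar))))"
    using coercivity by blast
  obtain C \<delta>0 where C: "C \<ge> 1" and \<delta>0: "\<delta>0 > 0" and lip: "\<And>x. norm (x - xbar) < \<delta>0 \<Longrightarrow>
    norm (g x - ybar) \<le> C * norm (x - xbar) \<and> norm (g x - ybar - J (x - xbar)) \<le> C * (norm (x - xbar))\<^sup>2"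
    using local_lipschitz by blast
  have C2: "C \<le> C\<^sup>2" using C by (simp add: power2_eq_square)
  have C2pos: "C\<^sup>2 > 0" using C by simp
  have "\<exists>\<delta>>0. \<forall>x. \<forall>p\<in>K. \<forall>m\<in>normal_cone K ybar.
     norm (x - xbar) < \<delta> \<longrightarrow> norm (m - lbar) < \<delta> \<longrightarrow>
     H (x - xbar) + Q (p - ybar) + \<theta> * (- (m \<bullet> (p - ybar)))
       \<ge> \<gamma>0 / 2 * (norm (x - xbar))\<^sup>2 - 3 * M0 * (norm (g x - p))\<^sup>2" if \<theta>: "\<theta> > 0" for \<theta>
  proof -
    \<comment> \<open>\<open>\<theta> / M0\<close> bounds the gap coefficient. The last entry limits
      the loss from linearising \<open>g\<close> and the loss from replacing \<open>lbar\<close> to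
      \<open>\<gamma>0 / 4\<close> each; the slack contributes \<open>2 * M0\<close> and
      \<open>M0\<close>, hence \<open>3 * M0\<close>.\<close>
    define \<delta> where "\<delta> = min (min \<delta>0 1) (min (\<theta> / M0) (\<gamma>0 / (8 * M0 * C\<^sup>2)))"
    have \<delta>: "\<delta> > 0" using \<delta>0 \<theta> M0 \<gamma>0 C2pos by (simp add: \<delta>_def)
    have "M0 * C\<^sup>2 * \<delta> \<le> M0 * C\<^sup>2 * (\<gamma>0 / (8 * M0 * C\<^sup>2))"
      using M0 C2pos by (intro mult_left_mono) (auto simp: \<delta>_def)
    also have "\<dots> = \<gamma>0 / 8" using M0 C2pos C by simp
    finally have \<delta>1: "M0 * C\<^sup>2 * \<delta> \<le> \<gamma>0 / 8" .
    have "M0 * C * \<delta> \<le> M0 * C\<^sup>2 * \<delta>" using M0 \<delta> C2 by simp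
    then have \<delta>2: "M0 * C * \<delta> \<le> \<gamma>0 / 8" using \<delta>1 by linarith
    show ?thesis
    proof (rule exI[of _ \<delta>], intro conjI allI ballI impI)
      fix x p m assume p: "p \<in> K" and m: "m \<in> normal_cone K ybar"
        and x: "norm (x - xbar) < \<delta>" and ml: "norm (m - lbar) < \<delta>"
      define d where "d = x - xbar"
      define h where "h = p - ybar"
      define b where "b = g x - p"
      define G where "G = - (m \<bullet> h)"
      have G: "G \<ge> 0" using normal_cone_base_nonneg[OF p m] by (simp add: G_def h_def)
      have nd: "norm d \<le> \<delta>" "\<delta> \<le> 1" "norm d \<le> 1" using x by (auto simp: d_def \<delta>_def)
      have l: "norm (g x - ybar) \<le> C * norm d" "norm (g x - ybar - J d) \<le> C * (norm d)\<^sup>2"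
        using lip[of x] x by (auto simp: d_def \<delta>_def)
      have m1: "H d + Q h \<ge> \<gamma>0 * (norm d)\<^sup>2 - M0 * (norm (J d - h))\<^sup>2 - M0 * norm d * (- (lbar \<bullet> h))"
        using coer[OF p, of 1 d] by (simp add: h_def)
      have "norm (J d - h) \<le> norm b + C * (norm d)\<^sup>2"
        using norm_triangle_ineq4[of b "g x - ybar - J d"] l(2) by (simp add: b_def h_def algebra_simps)
      then have "(norm (J d - h))\<^sup>2 \<le> 2 * (norm b)\<^sup>2 + 2 * (C * (norm d)\<^sup>2)\<^sup>2"
        by (intro power2_le_sum) auto
      also have "(C * (norm d)\<^sup>2)\<^sup>2 \<le> C\<^sup>2 * \<delta> * (norm d)\<^sup>2"
      proof -
        have "(norm d)\<^sup>2 \<le> \<delta>" using nd mult_mono[of "norm d" \<delta> "norm d" 1] by (simp add: power2_eq_square)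
        then have "C\<^sup>2 * ((norm d)\<^sup>2 * (norm d)\<^sup>2) \<le> C\<^sup>2 * (\<delta> * (norm d)\<^sup>2)"
          by (intro mult_left_mono mult_right_mono) auto
        then show ?thesis by (simp add: power_mult_distrib power2_eq_square mult_ac)
      qed
      finally have "M0 * (norm (J d - h))\<^sup>2 \<le> M0 * (2 * (norm b)\<^sup>2 + 2 * (C\<^sup>2 * \<delta> * (norm d)\<^sup>2))"
        using M0 by (simp add: mult_left_mono)
      also have "\<dots> = 2 * M0 * (norm b)\<^sup>2 + 2 * ((M0 * C\<^sup>2 * \<delta>) * (norm d)\<^sup>2)"
        by (simp add: algebra_simps)
      also have "\<dots> \<le> 2 * M0 * (norm b)\<^sup>2 + 2 * ((\<gamma>0 / 8) * (norm d)\<^sup>2)"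
        using mult_right_mono[OF \<delta>1, of "(norm d)\<^sup>2"] by simp
      finally have m2: "M0 * (norm (J d - h))\<^sup>2 \<le> 2 * M0 * (norm b)\<^sup>2 + \<gamma>0 / 4 * (norm d)\<^sup>2" by simp
      have "norm h \<le> C * norm d + norm b"
        using norm_triangle_ineq4[of "g x - ybar" b] l(1) by (simp add: b_def h_def)
      then have "norm d * norm h \<le> norm d * (C * norm d + norm b)" by (intro mult_left_mono) auto
      also have "\<dots> = C * (norm d)\<^sup>2 + norm d * norm b" by (simp add: power2_eq_square algebra_simps)
      also have "norm d * norm b \<le> C * (norm d)\<^sup>2 + (norm b)\<^sup>2"
        using sum_squares_bound[of "norm d" "norm b"] mult_right_mono[OF C, of "(norm d)\<^sup>2"]
          zero_le_power2[of "norm b"] zero_le_power2[of "norm d"] by linarith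
      finally have dh: "norm d * norm h \<le> 2 * C * (norm d)\<^sup>2 + (norm b)\<^sup>2" by simp
      have "- (lbar \<bullet> h) = G + (m - lbar) \<bullet> h" by (simp add: G_def inner_diff_left)
      also have "(m - lbar) \<bullet> h \<le> \<delta> * norm h"
        using ml order_trans[OF norm_cauchy_schwarz mult_right_mono[of "norm (m - lbar)" \<delta> "norm h"]] by simp
      finally have "M0 * norm d * (- (lbar \<bullet> h)) \<le> M0 * norm d * (G + \<delta> * norm h)"
        using M0 by (intro mult_left_mono) auto
      also have "\<dots> = (M0 * norm d) * G + (M0 * \<delta>) * (norm d * norm h)" by (simp add: algebra_simps)
      also have "\<dots> \<le> \<theta> * G + (M0 * \<delta>) * (2 * C * (norm d)\<^sup>2 + (norm b)\<^sup>2)"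
      proof (intro add_mono mult_right_mono[OF _ G] mult_left_mono[OF dh])
        have "M0 * norm d \<le> M0 * (\<theta> / M0)"
          using M0 nd by (intro mult_left_mono) (auto simp: \<delta>_def)
        then show "M0 * norm d \<le> \<theta>" using M0 by simp
      qed (use M0 \<delta> in auto)
      also have "\<dots> = \<theta> * G + 2 * ((M0 * C * \<delta>) * (norm d)\<^sup>2) + \<delta> * (M0 * (norm b)\<^sup>2)"
        by (simp add: algebra_simps)
      also have "\<dots> \<le> \<theta> * G + 2 * ((\<gamma>0 / 8) * (norm d)\<^sup>2) + 1 * (M0 * (norm b)\<^sup>2)"
      proof -
        have "\<delta> * (M0 * (norm b)\<^sup>2) \<le> 1 * (M0 * (norm b)\<^sup>2)"
          by (rule mult_right_mono[OF nd(2)]) (use M0 in simp)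
        moreover have "(M0 * C * \<delta>) * (norm d)\<^sup>2 \<le> \<gamma>0 / 8 * (norm d)\<^sup>2"
          by (rule mult_right_mono[OF \<delta>2]) simp
        ultimately show ?thesis by linarith
      qed
      finally have m3: "M0 * norm d * (- (lbar \<bullet> h)) \<le> \<theta> * G + \<gamma>0 / 4 * (norm d)\<^sup>2 + M0 * (norm b)\<^sup>2" by simp
      have "H d + Q h + \<theta> * G \<ge> \<gamma>0 / 2 * (norm d)\<^sup>2 - 3 * M0 * (norm b)\<^sup>2"
        using m1 m2 m3 by linarith
      then show "H (x - xbar) + Q (p - ybar) + \<theta> * (- (m \<bullet> (p - ybar)))
         \<ge> \<gamma>0 / 2 * (norm (x - xbar))\<^sup>2 - 3 * M0 * (norm (g x - p))\<^sup>2"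
        by (simp add: d_def h_def b_def G_def)
    qed (rule \<delta>)
  qed
  then show ?thesis using \<gamma>0 M0 by (intro exI[of _ "\<gamma>0/2"] conjI exI[of _ "3 * M0"]) auto
qed

text \<open>The gap is split as \<open>\<theta> * G + (1 - \<theta>) * G\<close> and
  \<open>curvature_at_base\<close> is applied to the second part only. The retained fraction pays
  for the gap term of \<open>local_coercivity\<close>.\<close>

lemma base_curvature:
  assumes e: "e > 0"
  shows "\<exists>\<theta>>0. \<exists>\<delta>>0. \<forall>p\<in>K. \<forall>m\<in>normal_cone K ybar.
    norm (p - ybar) < \<delta> \<longrightarrow> norm (m - lbar) < \<delta> \<longrightarrow>
    - (m \<bullet> (p - ybar)) \<ge> \<theta> * (- (m \<bullet> (p - ybar))) + Q (p - ybar) / 2 - e * (norm (p - ybar))\<^sup>2"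
proof -
  \<comment> \<open>This ensures \<open>\<theta> * CQ \<le> e\<close>, so giving up
    \<open>\<theta> * Q h / 2\<close> costs at most half of the allowed error.\<close>
  define \<theta> where "\<theta> = min 1 (e / (CQ + 1))"
  have \<theta>: "\<theta> > 0" "\<theta> \<le> 1" using e CQ_nonneg by (simp_all add: \<theta>_def)
  have "\<theta> * CQ \<le> (e / (CQ + 1)) * (CQ + 1)"
    using \<theta> CQ_nonneg e by (intro mult_mono) (auto simp: \<theta>_def)
  then have \<theta>CQ: "\<theta> * CQ \<le> e" using CQ_nonneg by simp
  obtain \<delta> where \<delta>: "\<delta> > 0" and base: "\<forall>p\<in>K. \<forall>m\<in>normal_cone K ybar.
      norm (p - ybar) < \<delta> \<longrightarrow> norm (m - lbar) < \<delta> \<longrightarrow>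
      - (m \<bullet> (p - ybar)) \<ge> Q (p - ybar) / 2 - e/2 * (norm (p - ybar))\<^sup>2"
    using curvature_at_base[of "e/2" lbar] e unfolding Q_def by auto
  show ?thesis
  proof (rule exI[of _ \<theta>], rule conjI[OF \<theta>(1)], rule exI[of _ \<delta>], rule conjI[OF \<delta>], intro ballI impI)
    fix p m assume p: "p \<in> K" "m \<in> normal_cone K ybar" "norm (p - ybar) < \<delta>" "norm (m - lbar) < \<delta>"
    define h where "h = p - ybar"
    define G where "G = - (m \<bullet> h)"
    have "G \<ge> Q h / 2 - e/2 * (norm h)\<^sup>2" using base p by (simp add: G_def h_def)
    then have "(1 - \<theta>) * G \<ge> (1 - \<theta>) * (Q h / 2 - e/2 * (norm h)\<^sup>2)"
      using \<theta> by (intro mult_left_mono) auto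
    moreover have "(1 - \<theta>) * (Q h / 2 - e/2 * (norm h)\<^sup>2)
        = Q h / 2 - (\<theta> * Q h) / 2 - e/2 * (norm h)\<^sup>2 + \<theta> * (e/2 * (norm h)\<^sup>2)"
      by (simp add: field_simps)
    moreover have "\<theta> * (e/2 * (norm h)\<^sup>2) \<ge> 0" using \<theta> e by simp
    moreover have "\<theta> * Q h \<le> e * (norm h)\<^sup>2"
    proof -
      have "\<theta> * Q h \<le> \<theta> * (CQ * (norm h)\<^sup>2)"
        using Q_abs_le[of h] \<theta> by (intro mult_left_mono) auto
      also have "\<dots> \<le> e * (norm h)\<^sup>2"
        using mult_right_mono[OF \<theta>CQ, of "(norm h)\<^sup>2"] by (simp add: mult.assoc)
      finally show ?thesis .
    qed
    moreover have "(1 - \<theta>) * G = G - \<theta> * G" by (simp add: algebra_simps)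
    ultimately have "G \<ge> \<theta> * G + Q h / 2 - e * (norm h)\<^sup>2" by linarith
    then show "- (m \<bullet> (p - ybar)) \<ge> \<theta> * (- (m \<bullet> (p - ybar))) + Q (p - ybar) / 2 - e * (norm (p - ybar))\<^sup>2"
      by (simp add: G_def h_def)
  qed
qed

end

section \<open>Quadratic growth and error bound\<close>

lemma closest_point_add_normal:
  fixes K :: "'h::euclidean_space set"
  assumes "closed K" "convex K" "m \<in> normal_cone K y"
  shows "closest_point K (y + m) = y"
proof (rule closest_point_unique[symmetric])
  show "y \<in> K" using assms by (simp add: normal_cone_def)
  show "\<forall>z\<in>K. dist (y + m) y \<le> dist (y + m) z"
  proof
    fix z assume z: "z \<in> K"
    have "(norm (m - (z - y)))\<^sup>2 = (norm m)\<^sup>2 - 2 * (m \<bullet> (z - y)) + (norm (z - y))\<^sup>2"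
      by (simp only: power2_norm_eq_inner) (simp add: inner_diff_left inner_diff_right inner_commute)
    moreover have "m \<bullet> (z - y) \<le> 0" using assms(3) z by (simp add: normal_cone_def)
    ultimately have "(norm m)\<^sup>2 \<le> (norm (m - (z - y)))\<^sup>2"
      using zero_le_power2[of "norm (z - y)"] by linarith
    then have "norm m \<le> norm (m - (z - y))" by (rule power2_le_imp_le) simp
    then show "dist (y + m) y \<le> dist (y + m) z" by (simp add: dist_norm algebra_simps)
  qed
qed (use assms in auto)

lemma closest_point_normal:
  fixes K :: "'h::euclidean_space set"
  assumes "closed K" "convex K" "K \<noteq> {}"
  shows "z - closest_point K z \<in> normal_cone K (closest_point K z)"
  using assms closest_point_in_set closest_point_dot by (auto simp: normal_cone_def)

lemma normal_cone_scaleR: "m \<in> normal_cone K y \<Longrightarrow> c \<ge> 0 \<Longrightarrow> c *\<^sub>R m \<in> normal_cone K y"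
  by (auto simp: normal_cone_def mult_nonneg_nonpos)

context kkt_setting
begin

text \<open>For \<open>p\<close> near \<open>ybar\<close>, \<open>m \<bullet> (g x - p)\<close>
  splits into \<open>m \<bullet> (g x - ybar)\<close> and the gap. The Taylor expansion supplies
  \<open>H / 2\<close>, the gap supplies \<open>\<theta> * G + Q / 2\<close>, and together they are
  half of \<open>local_coercivity\<close> taken with \<open>2 * \<theta>\<close>. For
  \<open>p\<close> far from \<open>ybar\<close> the slack is bounded away from 0 and the penalty
  alone dominates.\<close>

lemma quadratic_growth:
  "\<exists>\<gamma>>0. \<exists>c0>0. \<exists>\<delta>>0. \<forall>x. \<forall>m\<in>\<Lambda>. \<forall>p\<in>K. norm (x - xbar) < \<delta> \<longrightarrow> norm (m - lbar) < \<delta> \<longrightarrow>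
     f x + m \<bullet> (g x - p) + c0 / 2 * (norm (g x - p))\<^sup>2 \<ge> f xbar + \<gamma> * (norm (x - xbar))\<^sup>2"
proof -
  obtain \<gamma> M where \<gamma>: "\<gamma> > 0" and M: "M > 0" and coer: "\<And>\<theta>. \<theta> > 0 \<Longrightarrow> \<exists>\<delta>>0. \<forall>x. \<forall>p\<in>K. \<forall>m\<in>normal_cone K ybar.
     norm (x - xbar) < \<delta> \<longrightarrow> norm (m - lbar) < \<delta> \<longrightarrow>
     H (x - xbar) + Q (p - ybar) + \<theta> * (- (m \<bullet> (p - ybar))) \<ge> \<gamma> * (norm (x - xbar))\<^sup>2 - M * (norm (g x - p))\<^sup>2"
    using local_coercivity by blast
  obtain C \<delta>1 where C: "C \<ge> 1" and \<delta>1: "\<delta>1 > 0" and lip: "\<And>x. norm (x - xbar) < \<delta>1 \<Longrightarrow> norm (g x - ybar) \<le> C * norm (x - xbar)"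
    using local_lipschitz by blast
  \<comment> \<open>Since \<open>norm h \<le> C * norm d + norm b\<close>, this turns the curvature
    error into \<open>\<gamma> / 16\<close> times the squared norms of \<open>d\<close> and
    \<open>b\<close>.\<close>
  define e where "e = \<gamma> / (32 * C\<^sup>2)"
  have C2: "C\<^sup>2 \<ge> 1" using C by simp
  have e: "e > 0" "e \<le> \<gamma> / 32" "e * C\<^sup>2 = \<gamma> / 32" using \<gamma> C2 C by (simp_all add: e_def divide_simps)
  obtain \<theta> \<delta>2 where \<theta>: "\<theta> > 0" and \<delta>2: "\<delta>2 > 0" and base: "\<And>p m. p \<in> K \<Longrightarrow> m \<in> normal_cone K ybar \<Longrightarrow>
    norm (p - ybar) < \<delta>2 \<Longrightarrow> norm (m - lbar) < \<delta>2 \<Longrightarrow>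
    - (m \<bullet> (p - ybar)) \<ge> \<theta> * (- (m \<bullet> (p - ybar))) + Q (p - ybar) / 2 - e * (norm (p - ybar))\<^sup>2"
    using base_curvature[OF e(1)] by blast
  obtain \<delta>3 where \<delta>3: "\<delta>3 > 0" and co: "\<And>x p m. p \<in> K \<Longrightarrow> m \<in> normal_cone K ybar \<Longrightarrow>
     norm (x - xbar) < \<delta>3 \<Longrightarrow> norm (m - lbar) < \<delta>3 \<Longrightarrow>
     H (x - xbar) + Q (p - ybar) + 2 * \<theta> * (- (m \<bullet> (p - ybar))) \<ge> \<gamma> * (norm (x - xbar))\<^sup>2 - M * (norm (g x - p))\<^sup>2"
    using coer[of "2 * \<theta>"] \<theta> by auto
  obtain \<delta>4 where \<delta>4: "\<delta>4 > 0" and tay: "\<And>x m. norm (x - xbar) < \<delta>4 \<Longrightarrow> m \<in> \<Lambda> \<Longrightarrow> norm (m - lbar) < \<delta>4 \<Longrightarrow>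
    \<bar>f x + m \<bullet> g x - (f xbar + m \<bullet> ybar) - H (x - xbar) / 2\<bar> \<le> \<gamma> / 16 * (norm (x - xbar))\<^sup>2"
    using expansions_at_multipliers[of "\<gamma> / 16"] \<gamma> by (metis divide_pos_pos zero_less_numeral)
  have "isCont f xbar" using f' has_derivative_continuous by blast
  then obtain \<delta>5 where \<delta>5: "\<delta>5 > 0" and fc: "\<And>x. dist x xbar < \<delta>5 \<Longrightarrow> dist (f x) (f xbar) < 1"
    unfolding continuous_at_eps_delta by (metis zero_less_one)
  define \<delta> where "\<delta> = min (min (min \<delta>1 \<delta>2) (min \<delta>3 \<delta>4)) (min (min \<delta>5 1) (\<delta>2 / (2 * C)))"
  have \<delta>: "\<delta> > 0" using \<delta>1 \<delta>2 \<delta>3 \<delta>4 \<delta>5 C by (simp add: \<delta>_def)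
  define L where "L = norm lbar + 1"
  have L: "L > 0" by (simp add: L_def add_nonneg_pos)
  \<comment> \<open>\<open>M + \<gamma>\<close> serves the near case. In the far case the second
    summand absorbs the linear term \<open>m \<bullet> b\<close>, and the third the possible drop of
    \<open>f\<close> by 1 together with the growth term.\<close>
  define c0 where "c0 = (M + \<gamma>) + (8 * L / \<delta>2 + 16 * (1 + \<gamma>) / \<delta>2\<^sup>2)"
  have ge: "8 * L / \<delta>2 \<ge> 0" "16 * (1 + \<gamma>) / \<delta>2\<^sup>2 \<ge> 0" using L \<gamma> \<delta>2 by simp_all
  then have c0: "c0 \<ge> M + \<gamma>" "c0 \<ge> 8 * L / \<delta>2" "c0 \<ge> 16 * (1 + \<gamma>) / \<delta>2\<^sup>2" "c0 > 0"
    using M \<gamma> unfolding c0_def by linarith+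
  show ?thesis
  proof (rule exI[of _ "\<gamma> / 4"], rule conjI, use \<gamma> in simp, rule exI[of _ c0], rule conjI[OF c0(4)],
      rule exI[of _ \<delta>], rule conjI[OF \<delta>], intro allI ballI impI)
    fix x m p assume m: "m \<in> \<Lambda>" and p: "p \<in> K" and x: "norm (x - xbar) < \<delta>" and ml: "norm (m - lbar) < \<delta>"
    define d where "d = x - xbar"
    define h where "h = p - ybar"
    define b where "b = g x - p"
    have mN: "m \<in> normal_cone K ybar" using \<Lambda>D m by blast
    have xs: "norm d < \<delta>1" "norm d < \<delta>3" "norm d < \<delta>4" "norm d < \<delta>5" "norm d < 1" "norm d < \<delta>2 / (2 * C)"
      using x by (simp_all add: d_def \<delta>_def)
    have ms: "norm (m - lbar) < \<delta>2" "norm (m - lbar) < \<delta>3" "norm (m - lbar) < \<delta>4" "norm (m - lbar) < 1"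
      using ml by (simp_all add: \<delta>_def)
    have gx: "norm (g x - ybar) \<le> C * norm d" using lip[of x] xs by (simp add: d_def)
    show "f x + m \<bullet> (g x - p) + c0 / 2 * (norm (g x - p))\<^sup>2 \<ge> f xbar + \<gamma> / 4 * (norm (x - xbar))\<^sup>2"
    proof (cases "norm h < \<delta>2")
      case True
      define G where "G = - (m \<bullet> h)"
      have "norm h \<le> C * norm d + norm b"
        using norm_triangle_ineq4[of "g x - ybar" b] gx by (simp add: b_def h_def)
      then have "(norm h)\<^sup>2 \<le> 2 * (C * norm d)\<^sup>2 + 2 * (norm b)\<^sup>2"
        by (intro power2_le_sum) auto
      then have "e * (norm h)\<^sup>2 \<le> e * (2 * (C * norm d)\<^sup>2 + 2 * (norm b)\<^sup>2)"
        using e by (intro mult_left_mono) auto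
      also have "\<dots> = 2 * ((e * C\<^sup>2) * (norm d)\<^sup>2) + 2 * (e * (norm b)\<^sup>2)"
        by (simp add: power_mult_distrib algebra_simps)
      also have "\<dots> \<le> \<gamma> / 16 * (norm d)\<^sup>2 + \<gamma> / 16 * (norm b)\<^sup>2"
        unfolding e(3) using mult_right_mono[OF e(2), of "(norm b)\<^sup>2"] by simp
      finally have 1: "e * (norm h)\<^sup>2 \<le> \<gamma> / 16 * (norm d)\<^sup>2 + \<gamma> / 16 * (norm b)\<^sup>2" .
      have 2: "G \<ge> \<theta> * G + Q h / 2 - e * (norm h)\<^sup>2"
        using base[OF p mN _ ms(1)] True by (simp add: G_def h_def)
      have 3: "H d + Q h + 2 * \<theta> * G \<ge> \<gamma> * (norm d)\<^sup>2 - M * (norm b)\<^sup>2"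
        using co[OF p mN _ ms(2), of x] xs by (simp add: G_def h_def d_def b_def)
      have 4: "f x + m \<bullet> g x - (f xbar + m \<bullet> ybar) - H d / 2 \<ge> - (\<gamma> / 16 * (norm d)\<^sup>2)"
        using tay[OF xs(3)[unfolded d_def] m ms(3)] unfolding d_def by linarith
      have 5: "(M + \<gamma>) * (norm b)\<^sup>2 \<le> c0 * (norm b)\<^sup>2"
        using c0 by (intro mult_right_mono) auto
      have 6: "\<gamma> * (norm b)\<^sup>2 \<ge> 0" "\<gamma> * (norm d)\<^sup>2 \<ge> 0" using \<gamma> by simp_all
      have 7: "m \<bullet> b = m \<bullet> g x - m \<bullet> ybar + G"
        by (simp add: G_def h_def b_def inner_diff_right)
      have 8: "(M + \<gamma>) * (norm b)\<^sup>2 = M * (norm b)\<^sup>2 + \<gamma> * (norm b)\<^sup>2" by (rule distrib_right)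
      have "f x + m \<bullet> b + c0 / 2 * (norm b)\<^sup>2 \<ge> f xbar + \<gamma> / 4 * (norm d)\<^sup>2"
        using 1 2 3 4 5 6 7 8 by linarith
      then show ?thesis by (simp add: b_def d_def)
    next
      case False
      \<comment> \<open>The entry \<open>\<delta>2 / (2 * C)\<close> of \<open>\<delta>\<close>
        places \<open>g x\<close> within \<open>\<delta>2 / 2\<close> of \<open>ybar\<close>, so a
        far \<open>p\<close> has slack at least \<open>\<delta>2 / 2\<close>.\<close>
      have "C * norm d \<le> C * (\<delta>2 / (2 * C))" using xs(6) C by (intro mult_left_mono) auto
      then have "norm (g x - ybar) \<le> \<delta>2 / 2" using gx C by simp
      moreover have "norm h \<le> norm (g x - ybar) + norm b"
        using norm_triangle_ineq4[of "g x - ybar" b] by (simp add: b_def h_def)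
      ultimately have nb: "norm b \<ge> \<delta>2 / 2" using False by linarith
      have "norm m \<le> L" using ms(4) norm_triangle_ineq2[of m lbar] by (simp add: L_def)
      then have "norm m * norm b \<le> L * norm b" by (intro mult_right_mono) auto
      then have 1: "m \<bullet> b \<ge> - (L * norm b)" using Cauchy_Schwarz_ineq2[of m b] by linarith
      have "L * norm b = (8 * L / \<delta>2) / 4 * (\<delta>2 / 2 * norm b)" using \<delta>2 by simp
      also have "\<dots> \<le> c0 / 4 * (norm b * norm b)"
        using c0 nb \<delta>2 L by (intro mult_mono mult_right_mono divide_right_mono) auto
      finally have 2: "L * norm b \<le> c0 / 4 * (norm b)\<^sup>2" by (simp add: power2_eq_square)
      have "1 + \<gamma> = (16 * (1 + \<gamma>) / \<delta>2\<^sup>2) / 4 * (\<delta>2 / 2)\<^sup>2" using \<delta>2 by (simp add: power2_eq_square)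
      also have "\<dots> \<le> c0 / 4 * (norm b)\<^sup>2"
        using c0 nb \<delta>2 by (intro mult_mono power_mono divide_right_mono) auto
      finally have 3: "1 + \<gamma> \<le> c0 / 4 * (norm b)\<^sup>2" .
      have 4: "f x \<ge> f xbar - 1" using fc[of x] xs(4) by (simp add: dist_norm d_def abs_less_iff)
      have "(norm d)\<^sup>2 \<le> 1\<^sup>2" using xs(5) by (intro power_mono) auto
      then have "\<gamma> / 4 * (norm d)\<^sup>2 \<le> \<gamma> / 4 * 1" using \<gamma> by (intro mult_left_mono) auto
      then have 5: "\<gamma> / 4 * (norm d)\<^sup>2 \<le> \<gamma>" using \<gamma> by linarith
      have "f x + m \<bullet> b + c0 / 2 * (norm b)\<^sup>2 \<ge> f xbar + \<gamma> / 4 * (norm d)\<^sup>2"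
        using 1 2 3 4 5 by linarith
      then show ?thesis by (simp add: b_def d_def)
    qed
  qed
qed

section \<open>Error bound for the perturbed optimality system\<close>

lemma grad_diff:
  "norm (grad x l - grad y m) \<le> norm (f' x - f' y) + norm (l - m) * norm (g' x) + norm m * norm (g' x - g' y)"
proof -
  define v where "v = grad x l - grad y m"
  \<comment> \<open>The gradient is known through its inner products, so the difference is tested
    against itself and one factor \<open>norm v\<close> is cancelled at the end.\<close>
  have "(norm v)\<^sup>2 = (f' x - f' y) v + (l - m) \<bullet> g' x v + m \<bullet> (g' x - g' y) v"
    unfolding power2_norm_eq_inner
    by (subst (1) v_def) (simp add: inner_diff_left grad_inner blinfun.diff_left inner_diff_right)
  also have "\<dots> \<le> norm (f' x - f' y) * norm v + norm (l - m) * (norm (g' x) * norm v) + norm m * (norm (g' x - g' y) * norm v)"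
  proof (intro add_mono)
    show "(f' x - f' y) v \<le> norm (f' x - f' y) * norm v"
      using norm_blinfun[of "f' x - f' y" v] by simp
    show "(l - m) \<bullet> g' x v \<le> norm (l - m) * (norm (g' x) * norm v)"
      by (rule order_trans[OF norm_cauchy_schwarz mult_left_mono[OF norm_blinfun]]) simp
    show "m \<bullet> (g' x - g' y) v \<le> norm m * (norm (g' x - g' y) * norm v)"
      by (rule order_trans[OF norm_cauchy_schwarz mult_left_mono[OF norm_blinfun]]) simp
  qed
  finally have "norm v * norm v \<le> (norm (f' x - f' y) + norm (l - m) * norm (g' x) + norm m * norm (g' x - g' y)) * norm v"
    by (simp add: power2_eq_square algebra_simps)
  then show ?thesis
    by (cases "v = 0") (auto simp: v_def[symmetric])
qed

lemma closed_\<Lambda>: "closed \<Lambda>"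
proof -
  have "grad xbar l = 0 \<longleftrightarrow> (\<forall>v. f' xbar v + l \<bullet> J v = 0)" for l
    by (metis grad_inner inner_eq_zero_iff inner_zero_left)
  then have "\<Lambda> = (\<Inter>v. {l. f' xbar v + l \<bullet> J v = 0}) \<inter> (\<Inter>z\<in>K. {l. l \<bullet> (z - ybar) \<le> 0})"
    using ybar_in_K by (auto simp: multiplier_set_def normal_cone_def)
  also have "closed \<dots>"
    by (intro closed_Int closed_INT ballI closed_Collect_eq closed_Collect_le continuous_intros)
  finally show ?thesis .
qed

text \<open>The last bound keeps the nearest multiplier close to \<open>lbar\<close>, where the
  uniform estimates hold, although it changes with \<open>l\<close>.\<close>

lemma nearest_multiplier:
  obtains m where "m \<in> \<Lambda>" "norm (l - m) = infdist l \<Lambda>" "norm (m - lbar) \<le> 2 * norm (l - lbar)"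
proof -
  obtain m where m: "m \<in> \<Lambda>" "infdist l \<Lambda> = dist l m"
    using infdist_attains_inf[OF closed_\<Lambda>, of l] lbar_in_\<Lambda> by auto
  have "dist l m \<le> norm (l - lbar)"
    using infdist_le[OF lbar_in_\<Lambda>, of l] m(2) by (simp add: dist_norm)
  moreover have "norm (m - lbar) \<le> dist l m + norm (l - lbar)"
    using norm_triangle_ineq[of "m - l" "l - lbar"] by (simp add: dist_norm norm_minus_commute)
  ultimately have "norm (m - lbar) \<le> 2 * norm (l - lbar)" by linarith
  with m show ?thesis using that by (simp add: dist_norm)
qed

lemma norm_near: "norm (m - lbar) \<le> 1 \<Longrightarrow> norm m \<le> norm lbar + 1"
  using norm_triangle_ineq2[of m lbar] by simp

text \<open>For \<open>x = xbar\<close> this is calmness; the second-order condition bounds the distance of \<open>x\<close>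
  to \<open>xbar\<close>, because the curvature of \<open>K\<close> enters twice, through the normals at \<open>g x - b\<close> and at \<open>g xbar\<close>.\<close>

lemma error_bound:
  "\<exists>\<kappa>>0. \<exists>\<delta>>0. \<forall>x l b. norm (x - xbar) < \<delta> \<longrightarrow> norm (l - lbar) < \<delta> \<longrightarrow> norm b < \<delta> \<longrightarrow>
     l \<in> normal_cone K (g x - b) \<longrightarrow> norm (x - xbar) + infdist l \<Lambda> \<le> \<kappa> * (norm (grad x l) + norm b)"
proof -
  obtain \<gamma> M where \<gamma>: "\<gamma> > 0" and M: "M > 0" and coer: "\<And>\<theta>. \<theta> > 0 \<Longrightarrow> \<exists>\<delta>>0. \<forall>x. \<forall>p\<in>K. \<forall>m\<in>normal_cone K ybar.
     norm (x - xbar) < \<delta> \<longrightarrow> norm (m - lbar) < \<delta> \<longrightarrow>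
     H (x - xbar) + Q (p - ybar) + \<theta> * (- (m \<bullet> (p - ybar))) \<ge> \<gamma> * (norm (x - xbar))\<^sup>2 - M * (norm (g x - p))\<^sup>2"
    using local_coercivity by blast
  obtain C \<delta>1 where C: "C \<ge> 1" and \<delta>1: "\<delta>1 > 0" and lip: "\<And>x. norm (x - xbar) < \<delta>1 \<Longrightarrow>
    norm (g x - ybar) \<le> C * norm (x - xbar) \<and> norm (f' x - f' xbar) \<le> C * norm (x - xbar) \<and>
    norm (g' x - J) \<le> C * norm (x - xbar) \<and> norm (g' x) \<le> C"
    using local_lipschitz by blast
  define e where "e = \<gamma> / (32 * C\<^sup>2)"
  have C2: "C\<^sup>2 \<ge> 1" using C by simp
  have e: "e > 0" "e \<le> \<gamma> / 32" "e * C\<^sup>2 = \<gamma> / 32" using \<gamma> C2 C by (simp_all add: e_def divide_simps)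
  obtain \<theta> \<delta>2 where \<theta>: "\<theta> > 0" and \<delta>2: "\<delta>2 > 0" and base: "\<And>p m. p \<in> K \<Longrightarrow> m \<in> normal_cone K ybar \<Longrightarrow>
    norm (p - ybar) < \<delta>2 \<Longrightarrow> norm (m - lbar) < \<delta>2 \<Longrightarrow>
    - (m \<bullet> (p - ybar)) \<ge> \<theta> * (- (m \<bullet> (p - ybar))) + Q (p - ybar) / 2 - e * (norm (p - ybar))\<^sup>2"
    using base_curvature[OF e(1)] by blast
  obtain \<delta>3 where \<delta>3: "\<delta>3 > 0" and co: "\<And>x p m. p \<in> K \<Longrightarrow> m \<in> normal_cone K ybar \<Longrightarrow>
     norm (x - xbar) < \<delta>3 \<Longrightarrow> norm (m - lbar) < \<delta>3 \<Longrightarrow>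
     H (x - xbar) + Q (p - ybar) + \<theta> * (- (m \<bullet> (p - ybar))) \<ge> \<gamma> * (norm (x - xbar))\<^sup>2 - M * (norm (g x - p))\<^sup>2"
    using coer[OF \<theta>] by blast
  obtain \<delta>4 where \<delta>4: "\<delta>4 > 0" and tay: "\<And>x m l. norm (x - xbar) < \<delta>4 \<Longrightarrow> m \<in> \<Lambda> \<Longrightarrow> norm (m - lbar) < \<delta>4 \<Longrightarrow>
    norm (l - lbar) < \<delta>4 \<Longrightarrow>
    \<bar>grad x l \<bullet> (x - xbar) - (H (x - xbar) + (l - m) \<bullet> (g x - ybar))\<bar> \<le> \<gamma> / 16 * (norm (x - xbar))\<^sup>2"
    using expansions_at_multipliers[of "\<gamma> / 16"] \<gamma> by (metis divide_pos_pos zero_less_numeral)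
  obtain \<delta>5 where \<delta>5: "\<delta>5 > 0" and nearby: "\<And>p l. p \<in> K \<Longrightarrow> l \<in> normal_cone K p \<Longrightarrow>
    norm (p - ybar) < \<delta>5 \<Longrightarrow> norm (l - lbar) < \<delta>5 \<Longrightarrow>
    l \<bullet> (p - ybar) \<ge> Q (p - ybar) / 2 - e * (norm (p - ybar))\<^sup>2"
    using curvature_nearby[OF e(1), of lbar] unfolding Q_def by blast
  obtain k \<epsilon> \<delta>6 where k: "k > 0" and \<epsilon>: "\<epsilon> > 0" and \<delta>6: "\<delta>6 > 0" and cal: "\<And>a b. norm (a, b) \<le> \<delta>6 \<Longrightarrow>
        multiplier_map f g K xbar a b \<inter> cball lbar \<epsilon>
          \<subseteq> {m + w | m w. m \<in> \<Lambda> \<and> w \<in> cball 0 (k * (norm a + norm b))}"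
    using calm unfolding multiplier_map_calm_def by blast
  define L where "L = norm lbar + 1"
  have L: "L \<ge> 1" by (simp add: L_def)
  define C1 where "C1 = C * (2 + L)"
  have C1: "C1 > 0" using C L by (simp add: C1_def)
  define \<delta>7 where "\<delta>7 = min (min \<delta>2 \<delta>3) (min \<delta>4 \<delta>5)"
  define \<delta> where "\<delta> = min (min (min \<delta>1 1) (min (\<delta>7 / (2 * C)) (\<delta>6 / (3 * C)))) \<epsilon>"
  have \<delta>7: "\<delta>7 > 0" using \<delta>2 \<delta>3 \<delta>4 \<delta>5 by (simp add: \<delta>7_def)
  have \<delta>: "\<delta> > 0" using \<delta>1 \<delta>6 \<delta>7 C \<epsilon> by (simp add: \<delta>_def)
  have C\<delta>: "2 * (C * \<delta>) \<le> \<delta>7" "3 * (C * \<delta>) \<le> \<delta>6" "\<delta> \<le> C * \<delta>"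
  proof -
    have "C * \<delta> \<le> C * (\<delta>7 / (2 * C))" "C * \<delta> \<le> C * (\<delta>6 / (3 * C))"
      using C by (intro mult_left_mono; simp add: \<delta>_def)+
    then show "2 * (C * \<delta>) \<le> \<delta>7" "3 * (C * \<delta>) \<le> \<delta>6" using C by simp_all
    show "\<delta> \<le> C * \<delta>" using C \<delta> by simp
  qed
  \<comment> \<open>\<open>X\<close> collects the coefficients of \<open>t * n\<close> once
    \<open>t \<le> n\<close> is known: 1 from \<open>A * n\<close>, \<open>M + \<gamma>\<close> from
    the squared slack, and \<open>k + k * C1\<close> from \<open>W * B\<close>. Then
    \<open>\<gamma> / 2 * n \<le> X * t\<close> determines \<open>\<kappa>1\<close>, and
    \<open>W \<le> k * (t + C1 * n)\<close> determines \<open>\<kappa>\<close>.\<close>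
  define X where "X = 1 + (M + \<gamma>) + k + k * C1"
  have X: "X > 0" using M \<gamma> k C1 by (simp add: X_def add_pos_pos)
  define \<kappa>1 where "\<kappa>1 = 1 + 2 * X / \<gamma>"
  have \<kappa>1: "\<kappa>1 > 0" "\<kappa>1 \<ge> 1" using X \<gamma> by (simp_all add: \<kappa>1_def add_pos_pos)
  define \<kappa> where "\<kappa> = \<kappa>1 + k * (1 + C1 * \<kappa>1)"
  have \<kappa>: "\<kappa> > 0" using \<kappa>1 k C1 by (simp add: \<kappa>_def add_pos_pos)
  show ?thesis
  proof (rule exI[of _ \<kappa>], rule conjI[OF \<kappa>], rule exI[of _ \<delta>], rule conjI[OF \<delta>], intro allI impI)
    fix x l b assume x: "norm (x - xbar) < \<delta>" and l: "norm (l - lbar) < \<delta>" and b: "norm b < \<delta>"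
      and lN: "l \<in> normal_cone K (g x - b)"
    define d where "d = x - xbar"
    define n where "n = norm d"
    define B where "B = norm b"
    define p where "p = g x - b"
    define h where "h = p - ybar"
    define A where "A = norm (grad x l)"
    define t where "t = A + B"
    have n0: "n \<ge> 0" "B \<ge> 0" "A \<ge> 0" "t \<ge> 0" by (simp_all add: n_def B_def A_def t_def)
    have pK: "p \<in> K" using lN by (simp add: normal_cone_def p_def)
    have lp: "norm (g x - ybar) \<le> C * n" "norm (f' x - f' xbar) \<le> C * n" "norm (g' x - J) \<le> C * n"
      using lip[of x] x by (simp_all add: n_def d_def \<delta>_def)
    have nJ: "norm J \<le> C" using lip[of xbar] \<delta>1 by simp
    have Cn: "C * n \<le> C * \<delta>" using x C by (simp add: n_def d_def)
    obtain m where m: "m \<in> \<Lambda>" "norm (l - m) = infdist l \<Lambda>" "norm (m - lbar) \<le> 2 * norm (l - lbar)"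
      by (rule nearest_multiplier)
    define W where "W = norm (l - m)"
    have mN: "m \<in> normal_cone K ybar" using \<Lambda>D m by blast
    have l1: "norm l \<le> L" using norm_near[of l] l by (simp add: L_def \<delta>_def)
    have W: "W \<le> k * (t + C1 * n)"
    proof -
      \<comment> \<open>Moving \<open>x\<close> back to \<open>xbar\<close> makes \<open>l\<close> a
        value of the multiplier map at \<open>(a', b')\<close>, to which calmness applies; the move
        costs a multiple of \<open>n\<close>.\<close>
      define a' where "a' = grad xbar l"
      define b' where "b' = ybar - p"
      have "norm a' \<le> norm (l - lbar) * norm J"
        using grad_diff[of xbar l xbar lbar] \<Lambda>D(1)[OF lbar_in_\<Lambda>] by (simp add: a'_def)
      also have "\<dots> \<le> \<delta> * C" using l nJ \<delta> by (intro mult_mono) auto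
      finally have a': "norm a' \<le> C * \<delta>" by (simp add: mult.commute)
      have b': "norm b' \<le> C * n + B"
      proof -
        have "b' = b - (g x - ybar)" by (simp add: b'_def p_def)
        then show ?thesis using norm_triangle_ineq4[of b "g x - ybar"] lp(1) by (simp add: B_def)
      qed
      have "norm (a', b') \<le> norm a' + norm b'" by (rule norm_Pair_le)
      also have "\<dots> \<le> \<delta>6" using a' b' Cn b C\<delta> unfolding B_def by linarith
      finally have "multiplier_map f g K xbar a' b' \<inter> cball lbar \<epsilon>
          \<subseteq> {m + w | m w. m \<in> \<Lambda> \<and> w \<in> cball 0 (k * (norm a' + norm b'))}" by (rule cal)
      moreover have "l \<in> multiplier_map f g K xbar a' b' \<inter> cball lbar \<epsilon>"
        using l lN by (simp add: multiplier_map_def a'_def b'_def p_def \<delta>_def dist_norm norm_minus_commute)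
      ultimately obtain m' w where m': "m' \<in> \<Lambda>" "l = m' + w" "norm w \<le> k * (norm a' + norm b')" by auto
      have "infdist l \<Lambda> \<le> norm w" using infdist_le[OF m'(1), of l] m'(2) by (simp add: dist_norm)
      then have W1: "W \<le> k * (norm a' + norm b')" using m'(3) m(2) by (simp add: W_def)
      have "norm a' \<le> A + norm (grad xbar l - grad x l)"
        using norm_triangle_ineq[of "grad x l" "grad xbar l - grad x l"] by (simp add: a'_def A_def)
      also have "norm (grad xbar l - grad x l) \<le> norm (f' x - f' xbar) + norm l * norm (g' x - J)"
        using grad_diff[of xbar l x l] by (simp add: norm_minus_commute)
      also have "\<dots> \<le> C * n + L * (C * n)"
        using lp l1 L by (intro add_mono mult_mono) auto
      finally have "norm a' + norm b' \<le> t + C1 * n"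
        using b' by (simp add: t_def C1_def algebra_simps)
      then have "k * (norm a' + norm b') \<le> k * (t + C1 * n)" using k by simp
      then show ?thesis using W1 by linarith
    qed
    have hp: "norm h \<le> C * n + B"
    proof -
      have "h = (g x - ybar) - b" by (simp add: h_def p_def)
      then show ?thesis using norm_triangle_ineq4[of "g x - ybar" b] lp(1) by (simp add: B_def)
    qed
    then have hs: "norm (p - ybar) < \<delta>7" using Cn b C\<delta> unfolding B_def h_def by linarith
    have ms: "norm (m - lbar) < \<delta>7" "norm (l - lbar) < \<delta>7" "norm d < \<delta>7"
      using m(3) l x C\<delta> \<delta> unfolding d_def by linarith+
    have "(norm h)\<^sup>2 \<le> 2 * (C * n)\<^sup>2 + 2 * B\<^sup>2"
      using hp by (intro power2_le_sum) auto
    then have "e * (norm h)\<^sup>2 \<le> e * (2 * (C * n)\<^sup>2 + 2 * B\<^sup>2)"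
      using e by (intro mult_left_mono) auto
    also have "\<dots> = 2 * ((e * C\<^sup>2) * n\<^sup>2) + 2 * (e * B\<^sup>2)"
      by (simp add: power_mult_distrib algebra_simps)
    also have "\<dots> \<le> \<gamma> / 16 * n\<^sup>2 + \<gamma> / 16 * B\<^sup>2"
      unfolding e(3) using mult_right_mono[OF e(2), of "B\<^sup>2"] by simp
    finally have 1: "e * (norm h)\<^sup>2 \<le> \<gamma> / 16 * n\<^sup>2 + \<gamma> / 16 * B\<^sup>2" .
    define G where "G = - (m \<bullet> h)"
    have 2: "G \<ge> \<theta> * G + Q h / 2 - e * (norm h)\<^sup>2"
      using base[OF pK mN] hs ms by (simp add: G_def h_def \<delta>7_def)
    have 3: "H d + Q h + \<theta> * G \<ge> \<gamma> * n\<^sup>2 - M * B\<^sup>2"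
      using co[OF pK mN, of x] ms by (simp add: G_def h_def d_def p_def n_def B_def \<delta>7_def)
    have 4: "grad x l \<bullet> d \<ge> H d + (l - m) \<bullet> (g x - ybar) - \<gamma> / 16 * n\<^sup>2"
    proof -
      have "norm (x - xbar) < \<delta>4" "norm (m - lbar) < \<delta>4" "norm (l - lbar) < \<delta>4"
        using ms by (simp_all add: d_def \<delta>7_def)
      from tay[OF this(1) m(1) this(2,3)] show ?thesis unfolding d_def n_def by linarith
    qed
    have 5: "l \<bullet> h \<ge> Q h / 2 - e * (norm h)\<^sup>2"
      using nearby[OF pK, of l] lN hs ms by (simp add: h_def p_def[symmetric] \<delta>7_def)
    \<comment> \<open>Here the curvature enters twice: \<open>l \<bullet> h\<close> and
      \<open>G\<close> each contribute \<open>Q h / 2\<close>, which gives the full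
      \<open>Q h\<close> next to the full \<open>H d\<close>.\<close>
    have 6: "(l - m) \<bullet> (g x - ybar) = l \<bullet> h + G + (l - m) \<bullet> b"
      by (simp add: G_def h_def p_def inner_diff_left inner_diff_right)
    have 7: "(l - m) \<bullet> b \<ge> - (W * B)"
      using Cauchy_Schwarz_ineq2[of "l - m" b] by (simp add: W_def B_def abs_le_iff)
    have 8: "grad x l \<bullet> d \<le> A * n"
      using norm_cauchy_schwarz[of "grad x l" d] by (simp add: A_def n_def)
    have 9: "\<gamma> * n\<^sup>2 \<ge> 0" "\<gamma> * B\<^sup>2 \<ge> 0" using \<gamma> by simp_all
    have 10: "(M + \<gamma>) * B\<^sup>2 = M * B\<^sup>2 + \<gamma> * B\<^sup>2" by (rule distrib_right)
    have main: "\<gamma> / 2 * n\<^sup>2 \<le> A * n + (M + \<gamma>) * B\<^sup>2 + W * B"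
      using 1 2 3 4 5 6 7 8 9 10 by linarith
    have n\<kappa>: "n \<le> \<kappa>1 * t"
    \<comment> \<open>If \<open>n\<close> exceeded \<open>\<kappa>1 * t\<close>, then
      \<open>t \<le> n\<close>, so every term on the right of \<open>main\<close> would be at most a
      constant times \<open>t * n\<close>, and one factor \<open>n\<close> cancels.\<close>
    proof (rule ccontr)
      assume "\<not> ?thesis"
      then have nt: "n > \<kappa>1 * t" by simp
      moreover have "t \<le> \<kappa>1 * t" using \<kappa>1 n0 mult_right_mono[of 1 \<kappa>1 t] by simp
      ultimately have tn: "t \<le> n" "n > 0" using n0 by linarith+
      have Bt: "B \<le> t" "A \<le> t" using n0 by (simp_all add: t_def)
      have "A * n \<le> t * n" using Bt n0 by (intro mult_right_mono)
      moreover have "(M + \<gamma>) * B\<^sup>2 \<le> (M + \<gamma>) * (t * n)"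
        unfolding power2_eq_square using Bt tn n0 M \<gamma> by (intro mult_left_mono mult_mono) auto
      moreover have "W * B \<le> (k * (n + C1 * n)) * t"
      proof (intro mult_mono)
        have "k * (t + C1 * n) \<le> k * (n + C1 * n)" using tn k by simp
        then show "W \<le> k * (n + C1 * n)" using W by linarith
        show "0 \<le> k * (n + C1 * n)" using k C1 n0 by simp
      qed (use Bt n0 in auto)
      ultimately have "\<gamma> / 2 * n\<^sup>2 \<le> X * (t * n)"
        using main by (simp add: X_def algebra_simps)
      then have "(\<gamma> / 2 * n) * n \<le> (X * t) * n" by (simp add: power2_eq_square mult.assoc)
      then have "\<gamma> / 2 * n \<le> X * t" using tn by simp
      then have "n \<le> (2 * X / \<gamma>) * t" using \<gamma> by (simp add: field_simps)
      also have "\<dots> \<le> \<kappa>1 * t" using n0 by (intro mult_right_mono) (simp_all add: \<kappa>1_def)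
      finally show False using nt by simp
    qed
    have "k * (t + C1 * n) \<le> k * (t + C1 * (\<kappa>1 * t))"
      using n\<kappa> k C1 by (intro mult_left_mono add_left_mono) auto
    then have "n + W \<le> \<kappa>1 * t + k * (t + C1 * (\<kappa>1 * t))" using W n\<kappa> by linarith
    also have "\<dots> = \<kappa> * t" by (simp add: \<kappa>_def algebra_simps)
    finally show "norm (x - xbar) + infdist l \<Lambda> \<le> \<kappa> * (norm (grad x l) + norm b)"
      by (simp add: n_def d_def W_def m(2) t_def A_def B_def)
  qed
qed

end

section \<open>The augmented Lagrangian and the residual\<close>

lemma infdist_closest_point:
  fixes K :: "'h::euclidean_space set"
  assumes "closed K" "K \<noteq> {}"
  shows "infdist y K = norm (y - closest_point K y)"
  using assms setdist_closest_point[of K y] by (simp add: infdist_eq_setdist dist_norm)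

text \<open>Using the projection of \<open>y\<close> as competitor for \<open>z\<close> bounds the
  increment from above; exchanging the roles bounds it from below with slope
  \<open>b = z - ?P z\<close>. Nonexpansiveness of the projection gives
  \<open>b \<bullet> h \<ge> a \<bullet> h\<close>, so both bounds use the slope \<open>a\<close>
  with error at most half the squared increment.\<close>

lemma half_sq_infdist_has_derivative:
  fixes K :: "'h::euclidean_space set"
  assumes K: "closed K" "convex K" "K \<noteq> {}"
  shows "((\<lambda>y. (infdist y K)\<^sup>2 / 2) has_derivative (\<lambda>h. (y - closest_point K y) \<bullet> h)) (at y)"
proof -
  let ?P = "closest_point K"
  have rem: "\<bar>(infdist z K)\<^sup>2 / 2 - (infdist y K)\<^sup>2 / 2 - (y - ?P y) \<bullet> (z - y)\<bar> \<le> (norm (z - y))\<^sup>2 / 2" for z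
  proof -
    define h where "h = z - y"
    define a where "a = y - ?P y"
    define b where "b = z - ?P z"
    have z: "z = y + h" by (simp add: h_def)
    have "norm b \<le> norm (a + h)"
      using closest_point_le[OF K(1) closest_point_in_set[OF K(1,3)], of z y] by (simp add: a_def b_def h_def dist_norm)
    then have "(norm b)\<^sup>2 \<le> (norm (a + h))\<^sup>2" by (intro power_mono) auto
    then have 1: "(norm b)\<^sup>2 \<le> (norm a)\<^sup>2 + 2 * (a \<bullet> h) + (norm h)\<^sup>2"
      by (simp only: power2_norm_eq_inner) (simp add: inner_add_left inner_add_right inner_commute)
    have "norm a \<le> norm (b - h)"
      using closest_point_le[OF K(1) closest_point_in_set[OF K(1,3)], of y z] by (simp add: a_def b_def h_def dist_norm)
    then have "(norm a)\<^sup>2 \<le> (norm (b - h))\<^sup>2" by (intro power_mono) auto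
    then have 2: "(norm a)\<^sup>2 \<le> (norm b)\<^sup>2 - 2 * (b \<bullet> h) + (norm h)\<^sup>2"
      by (simp only: power2_norm_eq_inner) (simp add: inner_diff_left inner_diff_right inner_commute)
    have "norm (?P z - ?P y) \<le> norm h"
      using closest_point_lipschitz[OF K(2,1,3), of z y] by (simp add: h_def dist_norm)
    then have "norm (?P z - ?P y) * norm h \<le> norm h * norm h" by (intro mult_right_mono) auto
    then have "(?P z - ?P y) \<bullet> h \<le> (norm h)\<^sup>2"
      using norm_cauchy_schwarz[of "?P z - ?P y" h] by (simp add: power2_eq_square)
    moreover have "b \<bullet> h - a \<bullet> h = (norm h)\<^sup>2 - (?P z - ?P y) \<bullet> h"
      by (simp add: power2_norm_eq_inner a_def b_def z inner_diff_left inner_add_left)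
    ultimately have "b \<bullet> h \<ge> a \<bullet> h" by linarith
    with 1 2 have "\<bar>(norm b)\<^sup>2 / 2 - (norm a)\<^sup>2 / 2 - a \<bullet> h\<bar> \<le> (norm h)\<^sup>2 / 2"
      unfolding abs_le_iff by linarith
    then show ?thesis by (simp add: infdist_closest_point[OF K(1,3)] a_def b_def h_def)
  qed
  show ?thesis
    unfolding has_derivative_at_alt
  proof (intro conjI allI impI)
    show "bounded_linear (\<lambda>h. (y - ?P y) \<bullet> h)" by (rule bounded_linear_inner_right)
    fix e :: real assume e: "e > 0"
    show "\<exists>d>0. \<forall>z. norm (z - y) < d \<longrightarrow>
        norm ((infdist z K)\<^sup>2 / 2 - (infdist y K)\<^sup>2 / 2 - (y - ?P y) \<bullet> (z - y)) \<le> e * norm (z - y)"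
    proof (rule exI[of _ e], intro conjI allI impI)
      fix z assume "norm (z - y) < e"
      then have "norm (z - y) * norm (z - y) \<le> e * norm (z - y)" by (intro mult_right_mono) auto
      then show "norm ((infdist z K)\<^sup>2 / 2 - (infdist y K)\<^sup>2 / 2 - (y - ?P y) \<bullet> (z - y)) \<le> e * norm (z - y)"
        using rem[of z] zero_le_power2[of "norm (z - y)"] unfolding power2_eq_square real_norm_def by linarith
    qed (rule e)
  qed
qed

section \<open>Convergence of sequences that contract towards a closed set\<close>

lemma attraction_invariant:
  fixes z z' :: "'a::real_normed_vector"
  assumes "\<beta> > 0" "norm (z - zbar) + 2 * \<beta> * infdist z S < \<delta>"
    and "norm (z' - z) \<le> \<beta> * infdist z S" "infdist z' S \<le> q * infdist z S" "q \<le> 1/2"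
  shows "norm (z' - zbar) + 2 * \<beta> * infdist z' S < \<delta>"
proof -
  \<comment> \<open>Halving the distance lowers \<open>2 * \<beta> * infdist z S\<close> by at least
    the step length \<open>\<beta> * infdist z S\<close>, so the sum acts as a Lyapunov
    function.\<close>
  have "q * infdist z S \<le> 1/2 * infdist z S"
    using assms(5) by (intro mult_right_mono) (auto simp: infdist_nonneg)
  then have "infdist z' S \<le> infdist z S / 2" using assms(4) by linarith
  then have "\<beta> * infdist z' S \<le> \<beta> * (infdist z S / 2)" using assms(1) by simp
  moreover have "norm (z' - zbar) \<le> norm (z' - z) + norm (z - zbar)"
    using norm_triangle_ineq[of "z' - z" "z - zbar"] by simp
  ultimately show ?thesis using assms(2,3) by (simp add: mult.assoc)
qed

text \<open>The invariant keeps all iterates where \<open>step\<close> applies. Distances then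
  halve, so the steps are summable and the tail from \<open>k\<close> has length at most
  \<open>2 * \<beta> * D k\<close>; this comparison of \<open>norm (z k - zhat)\<close> with
  \<open>D k\<close> transfers the contraction of the distance to the iterates.\<close>

lemma attraction:
  fixes z :: "nat \<Rightarrow> 'a::{real_normed_vector, heine_borel}"
  assumes S: "closed S" "zbar \<in> S" and \<beta>: "\<beta> > 0"
    and z0: "norm (z 0 - zbar) + 2 * \<beta> * infdist (z 0) S < \<delta>"
    and step: "\<And>k. norm (z k - zbar) < \<delta> \<Longrightarrow> norm (z (Suc k) - z k) \<le> \<beta> * infdist (z k) S \<and>
        infdist (z (Suc k)) S \<le> q k * infdist (z k) S \<and> 0 \<le> q k \<and> q k \<le> 1/2"
  shows "\<forall>k. norm (z k - zbar) < \<delta>"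
    and "\<exists>zhat\<in>S. z \<longlonglongrightarrow> zhat \<and> (\<lambda>k. infdist (z k) S) \<longlonglongrightarrow> 0 \<and>
           (\<forall>k. norm (z (Suc k) - zhat) \<le> 2 * \<beta> * q k * norm (z k - zhat))"
proof -
  define D where "D k = infdist (z k) S" for k
  have D0: "D k \<ge> 0" for k by (simp add: D_def infdist_nonneg)
  have inv: "norm (z k - zbar) + 2 * \<beta> * D k < \<delta>" for k
  proof (induction k)
    case 0 then show ?case using z0 by (simp add: D_def)
  next
    case (Suc k)
    have "\<beta> * D k \<ge> 0" using \<beta> D0 by simp
    then have "norm (z k - zbar) < \<delta>" using Suc by linarith
    from step[OF this] show ?case
      using attraction_invariant[OF \<beta>, of "z k" zbar S \<delta> "z (Suc k)" "q k"] Suc by (simp add: D_def)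
  qed
  show near: "\<forall>k. norm (z k - zbar) < \<delta>"
  proof
    fix k
    have "\<beta> * D k \<ge> 0" using \<beta> D0 by simp
    then show "norm (z k - zbar) < \<delta>" using inv[of k] by linarith
  qed
  then have s: "norm (z (Suc k) - z k) \<le> \<beta> * D k" "D (Suc k) \<le> q k * D k" "0 \<le> q k" "q k \<le> 1/2" for k
    using step unfolding D_def by blast+
  have half: "D (Suc k) \<le> D k / 2" for k
    using s(2)[of k] mult_right_mono[OF s(4) D0, of k k] by simp
  have geo: "D k \<le> D 0 * (1/2)^k" for k
  proof (induction k)
    case (Suc k)
    have "D (Suc k) \<le> D k / 2" by (rule half)
    also have "\<dots> \<le> (D 0 * (1/2)^k) / 2" using Suc by simp
    finally show ?case by simp
  qed simp
  have "(\<lambda>k. (1/2::real)^k) \<longlonglongrightarrow> 0"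
    by (rule LIMSEQ_realpow_zero) simp_all
  then have "(\<lambda>k. D 0 * (1/2)^k) \<longlonglongrightarrow> 0"
    by (rule tendsto_mult_right_zero)
  then have Dlim: "D \<longlonglongrightarrow> 0"
    by (rule tendsto_sandwich[OF always_eventually[OF allI[OF D0]] always_eventually[OF allI[OF geo]] tendsto_const])
  have tele: "norm (z (k + j) - z k) \<le> 2 * \<beta> * D k - 2 * \<beta> * D (k + j)" for k j
  proof (induction j)
    case (Suc j)
    have "norm (z (k + Suc j) - z k) \<le> norm (z (Suc (k + j)) - z (k + j)) + norm (z (k + j) - z k)"
      using norm_triangle_ineq[of "z (Suc (k + j)) - z (k + j)" "z (k + j) - z k"] by simp
    moreover have "\<beta> * D (Suc (k + j)) \<le> \<beta> * (D (k + j) / 2)"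
      using half[of "k + j"] \<beta> by simp
    ultimately show ?case using Suc s(1)[of "k + j"] by (simp add: mult.assoc)
  qed simp
  have tele': "norm (z (k + j) - z k) \<le> 2 * \<beta> * D k" for k j
  proof -
    have "\<beta> * D (k + j) \<ge> 0" using \<beta> D0 by simp
    then show ?thesis using tele[of k j] by linarith
  qed
  have "Cauchy z"
  proof (rule metric_CauchyI)
    fix e :: real assume e: "e > 0"
    have "(\<lambda>k. 2 * \<beta> * D k) \<longlonglongrightarrow> 2 * \<beta> * 0" by (intro tendsto_mult tendsto_const Dlim)
    then have "\<forall>\<^sub>F k in sequentially. 2 * \<beta> * D k < e / 2"
      using e by (intro order_tendstoD(2)[of _ "2 * \<beta> * 0"]) auto
    then obtain N where N: "2 * \<beta> * D N < e / 2" by (auto simp: eventually_sequentially)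
    show "\<exists>M. \<forall>m\<ge>M. \<forall>n\<ge>M. dist (z m) (z n) < e"
    proof (intro exI[of _ N] allI impI)
      fix m n assume "N \<le> m" "N \<le> n"
      then have "dist (z m) (z N) < e / 2" "dist (z n) (z N) < e / 2"
        using tele'[of N "m - N"] tele'[of N "n - N"] N by (simp_all add: dist_norm)
      then show "dist (z m) (z n) < e" by (rule dist_triangle_half_l)
    qed
  qed
  then obtain zhat where lim: "z \<longlonglongrightarrow> zhat"
    by (meson Cauchy_convergent convergent_def)
  have "D \<longlonglongrightarrow> infdist zhat S" unfolding D_def by (intro tendsto_infdist lim)
  then have "infdist zhat S = 0" using Dlim LIMSEQ_unique by blast
  then have zS: "zhat \<in> S"
    using in_closed_iff_infdist_zero[OF S(1)] S(2) by blast
  have close: "norm (z k - zhat) \<le> 2 * \<beta> * D k" for k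
  proof -
    have "(\<lambda>j. z (k + j) - z k) \<longlonglongrightarrow> zhat - z k"
      using LIMSEQ_ignore_initial_segment[OF lim, of k] by (intro tendsto_diff tendsto_const) (simp add: add.commute)
    then have "norm (zhat - z k) \<le> 2 * \<beta> * D k"
      using tele' by (intro Lim_norm_ubound[OF sequentially_bot]) auto
    then show ?thesis by (simp add: norm_minus_commute)
  qed
  \<comment> \<open>The limit lies in \<open>S\<close>, so \<open>D k\<close> is at most the
    distance from \<open>z k\<close> to \<open>zhat\<close>, which closes the estimate.\<close>
  have rate: "norm (z (Suc k) - zhat) \<le> 2 * \<beta> * q k * norm (z k - zhat)" for k
  proof -
    have "norm (z (Suc k) - zhat) \<le> 2 * \<beta> * D (Suc k)" by (rule close)
    also have "\<dots> \<le> 2 * \<beta> * (q k * D k)" using s(2)[of k] \<beta> by simp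
    also have "\<dots> \<le> 2 * \<beta> * (q k * norm (z k - zhat))"
      using infdist_le[OF zS, of "z k"] s(3)[of k] \<beta>
      by (intro mult_left_mono) (auto simp: D_def dist_norm)
    finally show ?thesis by (simp add: mult.assoc)
  qed
  show "\<exists>zhat\<in>S. z \<longlonglongrightarrow> zhat \<and> (\<lambda>k. infdist (z k) S) \<longlonglongrightarrow> 0 \<and>
           (\<forall>k. norm (z (Suc k) - zhat) \<le> 2 * \<beta> * q k * norm (z k - zhat))"
    using zS lim Dlim rate unfolding D_def by blast
qed

section \<open>Solution set, residual and augmented Lagrangian\<close>

context kkt_setting
begin

abbreviation "Sol \<equiv> {xbar} \<times> \<Lambda>"
abbreviation "res \<equiv> residual f g K"

lemma closed_Sol: "closed Sol"
  by (intro closed_Times closed_\<Lambda>) simp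

lemma infdist_Sol_le: "infdist (x, l) Sol \<le> norm (x - xbar) + infdist l \<Lambda>"
proof -
  obtain m where m: "m \<in> \<Lambda>" "norm (l - m) = infdist l \<Lambda>" by (rule nearest_multiplier)
  have "infdist (x, l) Sol \<le> dist (x, l) (xbar, m)"
    using m(1) by (intro infdist_le) auto
  also have "\<dots> \<le> norm (x - xbar) + norm (l - m)"
    unfolding dist_norm using norm_Pair_le[of "x - xbar" "l - m"] by simp
  finally show ?thesis by (simp add: m(2))
qed

lemma infdist_Sol_ge: "norm (x - xbar) \<le> infdist (x, l) Sol" "infdist l \<Lambda> \<le> infdist (x, l) Sol"
proof -
  have "Sol \<noteq> {}" using lbar_in_\<Lambda> by auto
  then obtain s where s: "s \<in> Sol" "infdist (x, l) Sol = dist (x, l) s"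
    using infdist_attains_inf[OF closed_Sol] by blast
  then obtain m where m: "m \<in> \<Lambda>" "s = (xbar, m)" by auto
  show "norm (x - xbar) \<le> infdist (x, l) Sol"
    using dist_fst_le[of "(x, l)" s] s(2) m(2) by (simp add: dist_norm)
  have "infdist l \<Lambda> \<le> dist l m" using m(1) by (rule infdist_le)
  then show "infdist l \<Lambda> \<le> infdist (x, l) Sol"
    using dist_snd_le[of "(x, l)" s] s(2) m(2) by simp
qed

text \<open>The projection sends \<open>ybar + m\<close> to \<open>ybar\<close> and is
  nonexpansive.\<close>

lemma residual_projection_le:
  assumes m: "m \<in> \<Lambda>"
  shows "norm (g x - closest_point K (g x + l)) \<le> 2 * norm (g x - ybar) + norm (l - m)"
proof -
  let ?p = "closest_point K (g x + l)"
  have "closest_point K (ybar + m) = ybar"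
    using m \<Lambda>D by (intro closest_point_add_normal K) auto
  then have "norm (?p - ybar) \<le> norm (g x + l - (ybar + m))"
    using closest_point_lipschitz[OF K(3,2,1), of "g x + l" "ybar + m"] by (simp add: dist_norm)
  also have "g x + l - (ybar + m) = (g x - ybar) + (l - m)" by simp
  also have "norm \<dots> \<le> norm (g x - ybar) + norm (l - m)" by (rule norm_triangle_ineq)
  finally have "norm (?p - ybar) \<le> norm (g x - ybar) + norm (l - m)" .
  moreover have "norm (g x - ?p) \<le> norm (g x - ybar) + norm (?p - ybar)"
    using norm_triangle_ineq4[of "g x - ybar" "?p - ybar"] by simp
  ultimately show ?thesis by simp
qed

text \<open>For the projection defect \<open>b\<close>, it is \<open>l + b\<close> and not
  \<open>l\<close> that is normal to \<open>K\<close> at \<open>g x - b\<close>. The error bound is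
  applied to \<open>(x, l + b)\<close>, and passing back to \<open>l\<close> changes both sides by
  multiples of \<open>norm b\<close>. The other inequality is Lipschitz continuity, as the residual
  vanishes at \<open>(xbar, m)\<close>.\<close>

lemma residual_bounds:
  "\<exists>\<kappa>>0. \<exists>\<delta>>0. \<forall>x l. norm (x - xbar) < \<delta> \<longrightarrow> norm (l - lbar) < \<delta> \<longrightarrow>
     infdist (x, l) Sol \<le> \<kappa> * res x l \<and> res x l \<le> \<kappa> * infdist (x, l) Sol"
proof -
  obtain k \<delta>0 where k: "k > 0" and \<delta>0: "\<delta>0 > 0" and eb: "\<And>x l b. norm (x - xbar) < \<delta>0 \<Longrightarrow> norm (l - lbar) < \<delta>0 \<Longrightarrow>
     norm b < \<delta>0 \<Longrightarrow> l \<in> normal_cone K (g x - b) \<Longrightarrow> norm (x - xbar) + infdist l \<Lambda> \<le> k * (norm (grad x l) + norm b)"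
    using error_bound by blast
  obtain C \<delta>1 where C: "C \<ge> 1" and \<delta>1: "\<delta>1 > 0" and lip: "\<And>x. norm (x - xbar) < \<delta>1 \<Longrightarrow>
    norm (g x - ybar) \<le> C * norm (x - xbar) \<and> norm (f' x - f' xbar) \<le> C * norm (x - xbar) \<and>
    norm (g' x - J) \<le> C * norm (x - xbar) \<and> norm (g' x) \<le> C"
    using local_lipschitz by blast
  define L where "L = norm lbar + 1"
  have L: "L \<ge> 1" by (simp add: L_def)
  define \<kappa>1 where "\<kappa>1 = k * (1 + C) + 1"
  define \<kappa>2 where "\<kappa>2 = C * (4 + L) + 1"
  define \<kappa> where "\<kappa> = max \<kappa>1 \<kappa>2"
  have "\<kappa>1 > 0" using k C by (simp add: \<kappa>1_def add_pos_pos)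
  then have \<kappa>: "\<kappa> > 0" "\<kappa>1 \<le> \<kappa>" "\<kappa>2 \<le> \<kappa>" by (auto simp: \<kappa>_def)
  define \<delta> where "\<delta> = min (min \<delta>1 (1/2)) (\<delta>0 / (4 * C))"
  have \<delta>: "\<delta> > 0" using \<delta>1 \<delta>0 C by (simp add: \<delta>_def)
  have C\<delta>: "4 * (C * \<delta>) \<le> \<delta>0" "\<delta> \<le> C * \<delta>"
  proof -
    have "C * \<delta> \<le> C * (\<delta>0 / (4 * C))" using C by (intro mult_left_mono) (auto simp: \<delta>_def)
    then show "4 * (C * \<delta>) \<le> \<delta>0" using C by simp
    show "\<delta> \<le> C * \<delta>" using C \<delta> by simp
  qed
  show ?thesis
  proof (rule exI[of _ \<kappa>], rule conjI[OF \<kappa>(1)], rule exI[of _ \<delta>], rule conjI[OF \<delta>], intro allI impI conjI)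
    fix x l assume x: "norm (x - xbar) < \<delta>" and l: "norm (l - lbar) < \<delta>"
    define p where "p = closest_point K (g x + l)"
    define b where "b = g x - p"
    define n where "n = norm (x - xbar)"
    have r: "res x l = norm (grad x l) + norm b" by (simp add: residual_def b_def p_def)
    have r0: "res x l \<ge> 0" unfolding r by simp
    have lp: "norm (g x - ybar) \<le> C * n" "norm (f' x - f' xbar) \<le> C * n" "norm (g' x - J) \<le> C * n" "norm (g' x) \<le> C"
      using lip[of x] x by (simp_all add: n_def \<delta>_def)
    have n: "0 \<le> n" "C * n \<le> C * \<delta>" using x C by (simp_all add: n_def)
    have nb: "norm b \<le> 2 * (C * n) + norm (l - m)" if "m \<in> \<Lambda>" for m
      using residual_projection_le[OF that, of x l] lp(1) by (simp add: b_def p_def)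
    have "l + b \<in> normal_cone K p"
      using closest_point_normal[OF K(2,3,1), of "g x + l"] by (simp add: p_def b_def algebra_simps)
    then have N: "l + b \<in> normal_cone K (g x - b)" by (simp add: b_def)
    have bs: "norm b < \<delta>0 - \<delta>" using nb[OF lbar_in_\<Lambda>] n l C\<delta> \<delta> by linarith
    have "norm (l + b - lbar) \<le> norm (l - lbar) + norm b"
      using norm_triangle_ineq[of "l - lbar" b] by (simp add: algebra_simps)
    then have "norm (l + b - lbar) < \<delta>0" using bs l by linarith
    moreover have "norm (x - xbar) < \<delta>0" "norm b < \<delta>0" using x C\<delta> bs \<delta> by linarith+
    ultimately have e1: "n + infdist (l + b) \<Lambda> \<le> k * (norm (grad x (l + b)) + norm b)"
      using eb[of x "l + b" b] N by (simp add: n_def)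
    have "norm (grad x (l + b)) \<le> norm (grad x l) + norm (grad x (l + b) - grad x l)"
      using norm_triangle_ineq[of "grad x l" "grad x (l + b) - grad x l"] by simp
    also have "norm (grad x (l + b) - grad x l) \<le> norm b * norm (g' x)"
      using grad_diff[of x "l + b" x l] by simp
    also have "\<dots> \<le> norm b * C" using lp(4) by (intro mult_left_mono) auto
    finally have "norm (grad x (l + b)) + norm b \<le> norm (grad x l) + (1 + C) * norm b"
      by (simp add: algebra_simps)
    also have "\<dots> \<le> (1 + C) * res x l"
      unfolding r using mult_right_mono[of 1 "1 + C" "norm (grad x l)"] C by (simp add: distrib_left)
    finally have "k * (norm (grad x (l + b)) + norm b) \<le> k * ((1 + C) * res x l)"
      using k by simp
    moreover have "infdist l \<Lambda> \<le> infdist (l + b) \<Lambda> + norm b"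
      using infdist_triangle[of l \<Lambda> "l + b"] by (simp add: dist_norm)
    moreover have "norm b \<le> res x l" by (simp add: r)
    ultimately have "infdist (x, l) Sol \<le> k * ((1 + C) * res x l) + res x l"
      using e1 infdist_Sol_le[of x l] unfolding n_def by linarith
    also have "\<dots> = \<kappa>1 * res x l" by (simp add: \<kappa>1_def algebra_simps)
    also have "\<dots> \<le> \<kappa> * res x l" using \<kappa> r0 by (intro mult_right_mono)
    finally show "infdist (x, l) Sol \<le> \<kappa> * res x l" .
    obtain m where m: "m \<in> \<Lambda>" "norm (l - m) = infdist l \<Lambda>" "norm (m - lbar) \<le> 2 * norm (l - lbar)"
      by (rule nearest_multiplier)
    define D where "D = infdist (x, l) Sol"
    have D: "n \<le> D" "norm (l - m) \<le> D"
      using infdist_Sol_ge(1)[of x l] infdist_Sol_ge(2)[of l x] m(2) by (simp_all add: n_def D_def)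
    have "norm m \<le> L" using norm_near[of m] m(3) l unfolding L_def \<delta>_def by linarith
    have "norm (grad x l) \<le> norm (f' x - f' xbar) + norm (l - m) * norm (g' x) + norm m * norm (g' x - J)"
      using grad_diff[of x l xbar m] \<Lambda>D(1)[OF m(1)] by simp
    also have "\<dots> \<le> C * D + D * C + L * (C * D)"
    proof (intro add_mono mult_mono)
      show "norm (f' x - f' xbar) \<le> C * D" "norm (g' x - J) \<le> C * D"
        using lp C D mult_left_mono[OF D(1), of C] by linarith+
    qed (use lp D \<open>norm m \<le> L\<close> L n in auto)
    finally have "norm (grad x l) \<le> C * D + D * C + L * (C * D)" .
    moreover have "norm b \<le> 2 * (C * D) + D"
      using nb[OF m(1)] D mult_left_mono[OF D(1), of C] C by linarith
    ultimately have "res x l \<le> \<kappa>2 * D" by (simp add: r \<kappa>2_def algebra_simps)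
    also have "\<dots> \<le> \<kappa> * D" using \<kappa> D n by (intro mult_right_mono) auto
    finally show "res x l \<le> \<kappa> * infdist (x, l) Sol" by (simp add: D_def)
  qed
qed

lemma multiplier_update_eq:
  assumes "c > 0"
  shows "multiplier_update K c y l = l + c *\<^sub>R (y - closest_point K (y + inverse c *\<^sub>R l))"
  using assms unfolding multiplier_update_alt[OF K(2,3,1) assms] by (simp add: algebra_simps)

text \<open>Completing the square exhibits the augmented Lagrangian as the minimum over
  \<open>q\<close> in \<open>K\<close> of the penalised Lagrangian with slack
  \<open>g y - q\<close>, attained at the projection. The attained value is used at the new iterate,
  the inequality at \<open>xbar\<close>.\<close>

lemma aug_lagrangian_eq:
  assumes "c > 0"
  shows "aug_lagrangian f g K y l c = f y + l \<bullet> (g y - closest_point K (g y + inverse c *\<^sub>R l))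
      + c / 2 * (norm (g y - closest_point K (g y + inverse c *\<^sub>R l)))\<^sup>2"
    and "q \<in> K \<Longrightarrow> aug_lagrangian f g K y l c \<le> f y + l \<bullet> (g y - q) + c / 2 * (norm (g y - q))\<^sup>2"
proof -
  have expand: "c / 2 * (norm (s + inverse c *\<^sub>R l))\<^sup>2 - 1 / (2 * c) * (norm l)\<^sup>2 = l \<bullet> s + c / 2 * (norm s)\<^sup>2" for s :: 'h
  proof -
    have "(norm (s + inverse c *\<^sub>R l))\<^sup>2 = (norm s)\<^sup>2 + 2 * inverse c * (l \<bullet> s) + (inverse c)\<^sup>2 * (norm l)\<^sup>2"
      unfolding power2_norm_eq_inner
      by (simp add: inner_add_left inner_add_right inner_commute power2_eq_square)
    then show ?thesis using assms by (simp add: field_simps power2_eq_square)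
  qed
  define z where "z = g y + inverse c *\<^sub>R l"
  have "infdist z K = norm ((g y - closest_point K z) + inverse c *\<^sub>R l)"
    unfolding infdist_closest_point[OF K(2,1)] by (simp add: z_def algebra_simps)
  then show "aug_lagrangian f g K y l c = f y + l \<bullet> (g y - closest_point K (g y + inverse c *\<^sub>R l))
      + c / 2 * (norm (g y - closest_point K (g y + inverse c *\<^sub>R l)))\<^sup>2"
    using expand[of "g y - closest_point K z"] unfolding aug_lagrangian_def z_def[symmetric] by simp
  assume "q \<in> K"
  then have "infdist z K \<le> norm ((g y - q) + inverse c *\<^sub>R l)"
    using infdist_le[of q K z] by (simp add: dist_norm z_def algebra_simps)
  then have "(infdist z K)\<^sup>2 \<le> (norm ((g y - q) + inverse c *\<^sub>R l))\<^sup>2"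
    by (intro power_mono) (auto simp: infdist_nonneg)
  then have "c / 2 * (infdist z K)\<^sup>2 \<le> c / 2 * (norm ((g y - q) + inverse c *\<^sub>R l))\<^sup>2"
    using assms by (intro mult_left_mono) auto
  then show "aug_lagrangian f g K y l c \<le> f y + l \<bullet> (g y - q) + c / 2 * (norm (g y - q))\<^sup>2"
    using expand[of "g y - q"] unfolding aug_lagrangian_def z_def[symmetric] by linarith
qed

lemma aug_lagrangian_has_derivative:
  assumes "c > 0"
  shows "((\<lambda>y. aug_lagrangian f g K y l c) has_derivative (\<lambda>v. grad x (multiplier_update K c (g x) l) \<bullet> v)) (at x)"
proof -
  define z where "z = g x + inverse c *\<^sub>R l"
  have "((\<lambda>y. g y + inverse c *\<^sub>R l) has_derivative (\<lambda>v. g' x v)) (at x)"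
    by (auto intro!: derivative_eq_intros g')
  from has_derivative_compose[OF this half_sq_infdist_has_derivative[OF K(2,3,1)]]
  have 1: "((\<lambda>y. (infdist (g y + inverse c *\<^sub>R l) K)\<^sup>2 / 2) has_derivative
      (\<lambda>v. (z - closest_point K z) \<bullet> g' x v)) (at x)"
    by (simp add: z_def)
  have "((\<lambda>y. f y + c * ((infdist (g y + inverse c *\<^sub>R l) K)\<^sup>2 / 2) - 1 / (2 * c) * (norm l)\<^sup>2) has_derivative
      (\<lambda>v. f' x v + c * ((z - closest_point K z) \<bullet> g' x v) - 0)) (at x)"
    by (intro has_derivative_diff has_derivative_add has_derivative_mult_right has_derivative_const f' 1)
  moreover have "f' x v + c * ((z - closest_point K z) \<bullet> g' x v) - 0 = grad x (multiplier_update K c (g x) l) \<bullet> v" for v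
    by (simp add: grad_inner multiplier_update_alt[OF K(2,3,1) assms] z_def)
  ultimately show ?thesis
    by (simp add: aug_lagrangian_def)
qed

lemma grad_aug_lagrangian_eq:
  assumes "c > 0"
  shows "grad_aug_lagrangian f g K x l c = grad x (multiplier_update K c (g x) l)"
proof -
  have "gradient (\<lambda>y. aug_lagrangian f g K y l c) x \<bullet> v = grad x (multiplier_update K c (g x) l) \<bullet> v" for v
    by (rule gradient_inner[OF aug_lagrangian_has_derivative[OF assms]])
  then show ?thesis
    using vector_eq_rdot unfolding grad_aug_lagrangian_def by blast
qed

text \<open>The projected point is \<open>y - (l' - l) / c\<close> for the updated multiplier
  \<open>l'\<close>, so the slack to be inserted in the error bound is the multiplier step divided
  by \<open>c\<close>.\<close>

lemma multiplier_update_normal: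
  assumes "c > 0"
  shows "multiplier_update K c y l \<in> normal_cone K (y - inverse c *\<^sub>R (multiplier_update K c y l - l))"
proof -
  define z where "z = y + inverse c *\<^sub>R l"
  have "c *\<^sub>R (z - closest_point K z) \<in> normal_cone K (closest_point K z)"
    using closest_point_normal[OF K(2,3,1)] assms by (intro normal_cone_scaleR) auto
  moreover have "multiplier_update K c y l = c *\<^sub>R (z - closest_point K z)"
    using multiplier_update_alt[OF K(2,3,1) assms] by (simp add: z_def)
  moreover have "y - inverse c *\<^sub>R (multiplier_update K c y l - l) = closest_point K z"
    using assms by (simp add: multiplier_update_eq z_def)
  ultimately show ?thesis by simp
qed

section \<open>Local convergence\<close>

text \<open>An exact stationary point meets any nonnegative tolerance. It is a minimiser of the
  proximal augmented Lagrangian over a closed ball; compactness gives existence, and growth at the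
  multiplier nearest to \<open>l\<close> gives interiority.\<close>

lemma step_exists:
  "\<exists>c1>0. \<exists>\<delta>>0. \<forall>x l c. norm (x - xbar) < \<delta> \<longrightarrow> norm (l - lbar) < \<delta> \<longrightarrow> c1 \<le> c \<longrightarrow>
    (\<exists>x'. grad_aug_lagrangian f g K x' l c + inverse c *\<^sub>R (x' - x) = 0 \<and>
       norm (x' - x) + norm (multiplier_update K c (g x') l - l) \<le> 7 * infdist (x, l) Sol)"
proof -
  obtain \<gamma> c0 \<delta>0 where \<gamma>: "\<gamma> > 0" and c0: "c0 > 0" and \<delta>0: "\<delta>0 > 0" and growth: "\<And>x m p. m \<in> \<Lambda> \<Longrightarrow> p \<in> K \<Longrightarrow>
     norm (x - xbar) < \<delta>0 \<Longrightarrow> norm (m - lbar) < \<delta>0 \<Longrightarrow>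
     f x + m \<bullet> (g x - p) + c0 / 2 * (norm (g x - p))\<^sup>2 \<ge> f xbar + \<gamma> * (norm (x - xbar))\<^sup>2"
    using quadratic_growth by blast
  define \<rho> where "\<rho> = \<delta>0 / 2"
  have \<rho>: "\<rho> > 0" "\<rho> < \<delta>0" using \<delta>0 by (simp_all add: \<rho>_def)
  \<comment> \<open>This gives \<open>D < \<rho> / 4\<close>, while the minimiser will be within
    \<open>3 * D\<close> of \<open>xbar\<close>, hence interior.\<close>
  define \<delta> where "\<delta> = \<rho> / 8"
  have \<delta>: "\<delta> > 0" using \<rho> by (simp add: \<delta>_def)
  show ?thesis
  proof (rule exI[of _ "2 * c0"], rule conjI, use c0 in simp, rule exI[of _ \<delta>], rule conjI[OF \<delta>], intro allI impI)
    fix x l c assume x: "norm (x - xbar) < \<delta>" and l: "norm (l - lbar) < \<delta>" and c: "2 * c0 \<le> c"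
    have cpos: "c > 0" using c c0 by linarith
    define D where "D = infdist (x, l) Sol"
    have xD: "norm (x - xbar) \<le> D" unfolding D_def by (rule infdist_Sol_ge)
    obtain m where m: "m \<in> \<Lambda>" "norm (l - m) = infdist l \<Lambda>" "norm (m - lbar) \<le> 2 * norm (l - lbar)"
      by (rule nearest_multiplier)
    have lD: "norm (l - m) \<le> D" unfolding m(2) D_def by (rule infdist_Sol_ge)
    have D0: "D \<ge> 0" by (simp add: D_def infdist_nonneg)
    have "infdist l \<Lambda> \<le> norm (l - lbar)"
      using infdist_le[OF lbar_in_\<Lambda>, of l] by (simp add: dist_norm)
    then have D\<rho>: "D < \<rho> / 4" using infdist_Sol_le[of x l] x l unfolding D_def \<delta>_def by linarith
    define \<phi> where "\<phi> = (\<lambda>y. aug_lagrangian f g K y l c + inverse c * ((norm (y - x))\<^sup>2 / 2))"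
    have der: "(\<phi> has_derivative (\<lambda>v. (grad y (multiplier_update K c (g y) l) + inverse c *\<^sub>R (y - x)) \<bullet> v)) (at y)" for y
    proof -
      have "((\<lambda>y. ((y - x) \<bullet> (y - x)) / 2) has_derivative (\<lambda>v. (y - x) \<bullet> v)) (at y)"
        by (auto intro!: derivative_eq_intros simp: inner_commute)
      then have "((\<lambda>y. aug_lagrangian f g K y l c + inverse c * (((y - x) \<bullet> (y - x)) / 2)) has_derivative
          (\<lambda>v. grad y (multiplier_update K c (g y) l) \<bullet> v + inverse c * ((y - x) \<bullet> v))) (at y)"
        by (intro has_derivative_add has_derivative_mult_right aug_lagrangian_has_derivative[OF cpos])
      then show ?thesis by (simp add: \<phi>_def power2_norm_eq_inner inner_add_left)
    qed
    have "continuous_on (cball xbar \<rho>) \<phi>"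
      using der by (meson continuous_at_imp_continuous_on has_derivative_continuous)
    then obtain x' where x': "x' \<in> cball xbar \<rho>" and min: "\<And>y. y \<in> cball xbar \<rho> \<Longrightarrow> \<phi> x' \<le> \<phi> y"
      using continuous_attains_inf[OF compact_cball, of xbar \<rho> \<phi>] \<rho> by auto
    define p where "p = closest_point K (g x' + inverse c *\<^sub>R l)"
    define s where "s = g x' - p"
    define a where "a = norm (x' - x)"
    define T where "T = c * norm s"
    have pK: "p \<in> K" unfolding p_def by (rule closest_point_in_set[OF K(2,1)])
    have upd: "multiplier_update K c (g x') l - l = c *\<^sub>R s"
      by (simp add: multiplier_update_eq[OF cpos] s_def p_def)
    have "\<phi> xbar \<le> f xbar + inverse c * (D\<^sup>2 / 2)"
    proof -
      have "aug_lagrangian f g K xbar l c \<le> f xbar"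
        using aug_lagrangian_eq(2)[OF cpos ybar_in_K, of xbar l] by simp
      moreover have "(norm (xbar - x))\<^sup>2 \<le> D\<^sup>2"
        using xD by (intro power_mono) (simp_all add: norm_minus_commute)
      then have "inverse c * ((norm (xbar - x))\<^sup>2 / 2) \<le> inverse c * (D\<^sup>2 / 2)"
        using cpos by (intro mult_left_mono) auto
      ultimately show ?thesis unfolding \<phi>_def by linarith
    qed
    moreover have "\<phi> x' \<le> \<phi> xbar" using \<rho> by (intro min) simp
    moreover have "\<phi> x' = f x' + l \<bullet> s + c / 2 * (norm s)\<^sup>2 + inverse c * (a\<^sup>2 / 2)"
      unfolding \<phi>_def aug_lagrangian_eq(1)[OF cpos] s_def p_def a_def ..
    moreover have "f x' + m \<bullet> s + c0 / 2 * (norm s)\<^sup>2 \<ge> f xbar + \<gamma> * (norm (x' - xbar))\<^sup>2"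
      unfolding s_def
    proof (rule growth[OF m(1) pK])
      show "norm (x' - xbar) < \<delta>0" using x' \<rho> by (simp add: dist_norm norm_minus_commute)
      show "norm (m - lbar) < \<delta>0" using m(3) l \<rho> unfolding \<delta>_def by linarith
    qed
    moreover have "\<gamma> * (norm (x' - xbar))\<^sup>2 \<ge> 0" using \<gamma> by simp
    \<comment> \<open>With \<open>c \<ge> 2 * c0\<close> the growth estimate consumes at most half
      of the penalty \<open>c / 2\<close>, and \<open>c / 4\<close> remains.\<close>
    moreover have "c0 / 2 * (norm s)\<^sup>2 \<le> c / 4 * (norm s)\<^sup>2"
      using c by (intro mult_right_mono) auto
    moreover have "m \<bullet> s - l \<bullet> s \<le> D * norm s"
      using norm_cauchy_schwarz[of "m - l" s] mult_right_mono[OF lD, of "norm s"]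
      by (simp add: inner_diff_left norm_minus_commute)
    ultimately have "c / 4 * (norm s)\<^sup>2 + inverse c * (a\<^sup>2 / 2) \<le> D * norm s + inverse c * (D\<^sup>2 / 2)"
      by linarith
    \<comment> \<open>After multiplication by \<open>4 * c\<close>, and with
      \<open>T = c * norm s\<close> the multiplier step, the inequality no longer contains
      \<open>c\<close>.\<close>
    then have "(4 * c) * (c / 4 * (norm s)\<^sup>2 + inverse c * (a\<^sup>2 / 2)) \<le> (4 * c) * (D * norm s + inverse c * (D\<^sup>2 / 2))"
      using cpos by (intro mult_left_mono) auto
    then have key: "T\<^sup>2 + 2 * a\<^sup>2 \<le> 4 * D * T + 2 * D\<^sup>2"
      using cpos by (simp add: T_def algebra_simps power2_eq_square)
    have sq: "(T - 2 * D)\<^sup>2 = T\<^sup>2 - 4 * D * T + 4 * D\<^sup>2"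
      by (simp add: power2_eq_square algebra_simps)
    have scaled: "(3 * D)\<^sup>2 = 9 * D\<^sup>2" "(2 * D)\<^sup>2 = 4 * D\<^sup>2" by (simp_all add: power_mult_distrib)
    \<comment> \<open>Completing the square leaves \<open>6 * D\<^sup>2\<close> for the multiplier
      part and \<open>3 * D\<^sup>2\<close> for the primal part. Rounded up to 9 and 4 these give
      \<open>T \<le> 5 * D\<close> and \<open>a \<le> 2 * D\<close>, in sum the factor 7.\<close>
    have "(T - 2 * D)\<^sup>2 \<le> (3 * D)\<^sup>2"
      using key zero_le_power2[of a] zero_le_power2[of D] unfolding sq scaled by linarith
    then have "\<bar>T - 2 * D\<bar> \<le> 3 * D" using abs_le_square_iff[of "T - 2 * D" "3 * D"] D0 by simp
    then have T: "T \<le> 5 * D" by simp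
    have a2: "a\<^sup>2 \<le> (2 * D)\<^sup>2"
      using key zero_le_power2[of "T - 2 * D"] zero_le_power2[of D] unfolding sq scaled by linarith
    have a: "a \<le> 2 * D" by (rule power2_le_imp_le[OF a2]) (use D0 in simp)
    have "norm (x' - xbar) \<le> a + norm (x - xbar)"
      using norm_triangle_ineq[of "x' - x" "x - xbar"] by (simp add: a_def)
    then have x'b: "x' \<in> ball xbar \<rho>"
      using a xD D\<rho> \<rho> D0 by (simp add: dist_norm norm_minus_commute)
    have "(\<lambda>v. (grad x' (multiplier_update K c (g x') l) + inverse c *\<^sub>R (x' - x)) \<bullet> v) = (\<lambda>v. 0)"
      by (rule differential_zero_maxmin[OF x'b open_ball der]) (use min in auto)
    then have "grad x' (multiplier_update K c (g x') l) + inverse c *\<^sub>R (x' - x) = 0"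
      by (metis inner_eq_zero_iff)
    moreover have "norm (x' - x) + norm (multiplier_update K c (g x') l - l) \<le> 7 * D"
      using a T cpos by (simp add: upd a_def T_def)
    ultimately show "\<exists>x'. grad_aug_lagrangian f g K x' l c + inverse c *\<^sub>R (x' - x) = 0 \<and>
       norm (x' - x) + norm (multiplier_update K c (g x') l - l) \<le> 7 * infdist (x, l) Sol"
      unfolding grad_aug_lagrangian_eq[OF cpos] D_def by blast
  qed
qed

text \<open>The proximal term and the slack of the new multiplier are the primal and dual steps
  divided by \<open>c\<close>, which is how \<open>1 / c\<close> enters. \<open>\<kappa>\<close> is
  the error-bound constant and does not depend on \<open>\<alpha>\<close>; only the neighbourhood
  does.\<close>

lemma step_contraction:
  "\<exists>\<kappa>>0. \<forall>\<alpha>>0. \<exists>\<delta>>0. \<forall>x l x' l' c e. norm (x - xbar) < \<delta> \<longrightarrow> norm (l - lbar) < \<delta> \<longrightarrow> c \<ge> 1 \<longrightarrow>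
    norm (grad_aug_lagrangian f g K x' l c + inverse c *\<^sub>R (x' - x)) \<le> e \<longrightarrow>
    l' = multiplier_update K c (g x') l \<longrightarrow> norm (x' - x) + norm (l' - l) \<le> \<alpha> * res x l \<longrightarrow>
    infdist (x', l') Sol \<le> \<kappa> * (e + \<alpha> * res x l / c)"
proof -
  obtain \<kappa> \<delta>0 where \<kappa>: "\<kappa> > 0" and \<delta>0: "\<delta>0 > 0" and eb: "\<And>x l b. norm (x - xbar) < \<delta>0 \<Longrightarrow> norm (l - lbar) < \<delta>0 \<Longrightarrow>
     norm b < \<delta>0 \<Longrightarrow> l \<in> normal_cone K (g x - b) \<Longrightarrow> norm (x - xbar) + infdist l \<Lambda> \<le> \<kappa> * (norm (grad x l) + norm b)"
    using error_bound by blast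
  obtain k \<delta>1 where k: "k > 0" and \<delta>1: "\<delta>1 > 0" and rb: "\<And>x l. norm (x - xbar) < \<delta>1 \<Longrightarrow> norm (l - lbar) < \<delta>1 \<Longrightarrow>
     res x l \<le> k * infdist (x, l) Sol"
    using residual_bounds by blast
  have "\<exists>\<delta>>0. \<forall>x l x' l' c e. norm (x - xbar) < \<delta> \<longrightarrow> norm (l - lbar) < \<delta> \<longrightarrow> c \<ge> 1 \<longrightarrow>
    norm (grad_aug_lagrangian f g K x' l c + inverse c *\<^sub>R (x' - x)) \<le> e \<longrightarrow>
    l' = multiplier_update K c (g x') l \<longrightarrow> norm (x' - x) + norm (l' - l) \<le> \<alpha> * res x l \<longrightarrow>
    infdist (x', l') Sol \<le> \<kappa> * (e + \<alpha> * res x l / c)" if \<alpha>: "\<alpha> > 0" for \<alpha>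
  proof -
    \<comment> \<open>The distance is below \<open>2 * \<delta>\<close> and the residual below
      \<open>2 * k * \<delta>\<close>, so the last entry makes the step shorter than
      \<open>\<delta>0 / 2\<close> and keeps the new point where the error bound holds.\<close>
    define \<delta> where "\<delta> = min (min \<delta>1 (\<delta>0 / 2)) (\<delta>0 / (4 * \<alpha> * k))"
    have \<delta>: "\<delta> > 0" using \<delta>0 \<delta>1 \<alpha> k by (simp add: \<delta>_def)
    have "2 * (\<alpha> * (k * \<delta>)) \<le> 2 * (\<alpha> * (k * (\<delta>0 / (4 * \<alpha> * k))))"
      using \<alpha> k by (intro mult_left_mono) (auto simp: \<delta>_def)
    then have \<alpha>k: "2 * (\<alpha> * (k * \<delta>)) \<le> \<delta>0 / 2" using \<alpha> k by simp
    show ?thesis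
    proof (rule exI[of _ \<delta>], rule conjI[OF \<delta>], intro allI impI)
      fix x l x' l' c e
      assume x: "norm (x - xbar) < \<delta>" and l: "norm (l - lbar) < \<delta>" and c: "c \<ge> 1"
        and e: "norm (grad_aug_lagrangian f g K x' l c + inverse c *\<^sub>R (x' - x)) \<le> e"
        and l': "l' = multiplier_update K c (g x') l" and st: "norm (x' - x) + norm (l' - l) \<le> \<alpha> * res x l"
      have cpos: "c > 0" using c by simp
      have "infdist l \<Lambda> \<le> norm (l - lbar)"
        using infdist_le[OF lbar_in_\<Lambda>, of l] by (simp add: dist_norm)
      then have "infdist (x, l) Sol < 2 * \<delta>" using infdist_Sol_le[of x l] x l by linarith
      then have "k * infdist (x, l) Sol < k * (2 * \<delta>)" using k by simp
      moreover have "res x l \<le> k * infdist (x, l) Sol"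
        using x l by (intro rb) (auto simp: \<delta>_def)
      ultimately have "\<alpha> * res x l < \<alpha> * (k * (2 * \<delta>))" using \<alpha> by simp
      then have "\<alpha> * res x l < \<delta>0 / 2" using \<alpha>k by (simp add: algebra_simps)
      then have small: "norm (x' - x) + norm (l' - l) < \<delta>0 / 2" using st by linarith
      define b where "b = inverse c *\<^sub>R (l' - l)"
      have ic: "inverse c \<le> 1" "inverse c > 0" using c by (simp_all add: inverse_le_1_iff)
      have nb: "norm b = norm (l' - l) / c" using cpos by (simp add: b_def divide_inverse mult.commute)
      have "norm b \<le> norm (l' - l)" using ic by (simp add: b_def mult_left_le_one_le)
      then have "norm b < \<delta>0" using small \<delta>0 norm_ge_zero[of "x' - x"] by linarith
      moreover have "norm (x' - xbar) < \<delta>0" "norm (l' - lbar) < \<delta>0"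
      proof -
        have "norm (x' - xbar) \<le> norm (x' - x) + norm (x - xbar)" "norm (l' - lbar) \<le> norm (l' - l) + norm (l - lbar)"
          using norm_triangle_ineq[of "x' - x" "x - xbar"] norm_triangle_ineq[of "l' - l" "l - lbar"] by simp_all
        moreover have "norm (x - xbar) < \<delta>0 / 2" "norm (l - lbar) < \<delta>0 / 2"
          using x l by (simp_all add: \<delta>_def)
        ultimately show "norm (x' - xbar) < \<delta>0" "norm (l' - lbar) < \<delta>0"
          using small norm_ge_zero[of "l' - l"] norm_ge_zero[of "x' - x"] by linarith+
      qed
      moreover have "l' \<in> normal_cone K (g x' - b)"
        unfolding b_def l' by (rule multiplier_update_normal[OF cpos])
      ultimately have "norm (x' - xbar) + infdist l' \<Lambda> \<le> \<kappa> * (norm (grad x' l') + norm b)"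
        by (intro eb)
      then have "infdist (x', l') Sol \<le> \<kappa> * (norm (grad x' l') + norm b)"
        using infdist_Sol_le[of x' l'] by linarith
      also have "\<dots> \<le> \<kappa> * (e + \<alpha> * res x l / c)"
      proof (rule mult_left_mono)
        have "norm (grad x' l') \<le> norm (grad x' l' + inverse c *\<^sub>R (x' - x)) + norm (inverse c *\<^sub>R (x' - x))"
          using norm_triangle_ineq4[of "grad x' l' + inverse c *\<^sub>R (x' - x)" "inverse c *\<^sub>R (x' - x)"] by simp
        also have "norm (grad x' l' + inverse c *\<^sub>R (x' - x)) \<le> e"
          using e unfolding grad_aug_lagrangian_eq[OF cpos] l' .
        also have "norm (inverse c *\<^sub>R (x' - x)) = norm (x' - x) / c"
          using cpos by (simp add: divide_inverse mult.commute)
        finally have "norm (grad x' l') + norm b \<le> e + (norm (x' - x) + norm (l' - l)) / c"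
          by (simp add: nb add_divide_distrib)
        also have "\<dots> \<le> e + \<alpha> * res x l / c" using st cpos by (simp add: divide_right_mono)
        finally show "norm (grad x' l') + norm b \<le> e + \<alpha> * res x l / c" .
      qed (use \<kappa> in simp)
      finally show "infdist (x', l') Sol \<le> \<kappa> * (e + \<alpha> * res x l / c)" .
    qed
  qed
  then show ?thesis using \<kappa> by blast
qed

text \<open>The distance to \<open>Sol\<close> contracts by
  \<open>A * (\<omega> (res x l) + \<alpha> / c)\<close>. Each summand takes half of the admissible
  factor \<open>qb\<close>, by nearness and by a large penalty; the first tends to 0 along the
  sequence, the second when \<open>c\<close> tends to infinity.\<close>

lemma local_convergence:
  assumes eps_nonneg: "\<And>t. t \<ge> 0 \<Longrightarrow> eps t \<ge> 0" and eps_o: "eps \<in> o[at_right 0](\<lambda>t. t)"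
  shows "\<exists>\<alpha>>0. \<exists>cbar>0. \<exists>\<epsilon>\<^sub>0>0.
    \<forall>x0 l0 (c :: nat \<Rightarrow> real).
      (x0, l0) \<in> cball (xbar, lbar) \<epsilon>\<^sub>0 \<longrightarrow> (\<forall>k. c k \<ge> cbar) \<longrightarrow>
        (\<exists>x l. x 0 = x0 \<and> l 0 = l0 \<and> pmm_sequence f g K eps \<alpha> c x l) \<and>
        (\<forall>x l. x 0 = x0 \<longrightarrow> l 0 = l0 \<longrightarrow> pmm_sequence f g K eps \<alpha> c x l \<longrightarrow>
          (\<exists>lhat \<in> multiplier_set f g K xbar.
             (\<lambda>k. (x k, l k)) \<longlonglongrightarrow> (xbar, lhat) \<and>
             converges_Q_linearly (\<lambda>k. (x k, l k)) (xbar, lhat) \<and>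
             converges_Q_linearly
               (\<lambda>k. infdist (x k, l k) ({xbar} \<times> multiplier_set f g K xbar)) 0 \<and>
             (filterlim c at_top sequentially \<longrightarrow>
                converges_Q_superlinearly (\<lambda>k. (x k, l k)) (xbar, lhat) \<and>
                converges_Q_superlinearly
                  (\<lambda>k. infdist (x k, l k) ({xbar} \<times> multiplier_set f g K xbar)) 0)))"
proof -
  obtain \<kappa>r \<delta>1 where \<kappa>r: "\<kappa>r > 0" and \<delta>1: "\<delta>1 > 0" and rb: "\<And>x l. norm (x - xbar) < \<delta>1 \<Longrightarrow> norm (l - lbar) < \<delta>1 \<Longrightarrow>
     infdist (x, l) Sol \<le> \<kappa>r * res x l \<and> res x l \<le> \<kappa>r * infdist (x, l) Sol"
    using residual_bounds by blast
  obtain c1 \<delta>2 where c1: "c1 > 0" and \<delta>2: "\<delta>2 > 0" and ex: "\<And>x l c. norm (x - xbar) < \<delta>2 \<Longrightarrow> norm (l - lbar) < \<delta>2 \<Longrightarrow> c1 \<le> c \<Longrightarrow>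
    \<exists>x'. grad_aug_lagrangian f g K x' l c + inverse c *\<^sub>R (x' - x) = 0 \<and>
       norm (x' - x) + norm (multiplier_update K c (g x') l - l) \<le> 7 * infdist (x, l) Sol"
    using step_exists by blast
  \<comment> \<open>The factor 7 bounds the exact step by the distance, and \<open>\<kappa>r\<close>
    converts the distance to the residual; \<open>\<beta>\<close> below converts back.\<close>
  define \<alpha> where "\<alpha> = 7 * \<kappa>r"
  have \<alpha>: "\<alpha> > 0" using \<kappa>r by (simp add: \<alpha>_def)
  obtain \<kappa> where \<kappa>: "\<kappa> > 0" and contr: "\<And>\<alpha>. \<alpha> > 0 \<Longrightarrow> \<exists>\<delta>>0. \<forall>x l x' l' c e. norm (x - xbar) < \<delta> \<longrightarrow> norm (l - lbar) < \<delta> \<longrightarrow> c \<ge> 1 \<longrightarrow>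
    norm (grad_aug_lagrangian f g K x' l c + inverse c *\<^sub>R (x' - x)) \<le> e \<longrightarrow>
    l' = multiplier_update K c (g x') l \<longrightarrow> norm (x' - x) + norm (l' - l) \<le> \<alpha> * res x l \<longrightarrow>
    infdist (x', l') Sol \<le> \<kappa> * (e + \<alpha> * res x l / c)"
    using step_contraction by blast
  obtain \<delta>3 where \<delta>3: "\<delta>3 > 0" and con: "\<And>x l x' l' c e. norm (x - xbar) < \<delta>3 \<Longrightarrow> norm (l - lbar) < \<delta>3 \<Longrightarrow> c \<ge> 1 \<Longrightarrow>
    norm (grad_aug_lagrangian f g K x' l c + inverse c *\<^sub>R (x' - x)) \<le> e \<Longrightarrow>
    l' = multiplier_update K c (g x') l \<Longrightarrow> norm (x' - x) + norm (l' - l) \<le> \<alpha> * res x l \<Longrightarrow>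
    infdist (x', l') Sol \<le> \<kappa> * (e + \<alpha> * res x l / c)"
    using contr[OF \<alpha>] by blast
  define \<beta> where "\<beta> = \<alpha> * \<kappa>r"
  have \<beta>: "\<beta> > 0" using \<alpha> \<kappa>r by (simp add: \<beta>_def)
  define A where "A = \<kappa> * \<kappa>r"
  have A: "A > 0" using \<kappa> \<kappa>r by (simp add: A_def)
  \<comment> \<open>\<open>attraction\<close> needs a factor at most 1/2, and the rate of the
    iterates is \<open>2 * \<beta> * qb\<close>, which must be below 1.\<close>
  define qb where "qb = 1 / (2 + 4 * \<beta>)"
  have qb: "qb > 0" "qb \<le> 1/2" "2 * \<beta> * qb < 1" using \<beta> by (simp_all add: qb_def divide_simps)
  \<comment> \<open>Division by zero makes \<open>\<omega> 0 = 0\<close> whatever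
    \<open>eps 0\<close> is, so the smallness of \<open>\<omega>\<close> extends to
    \<open>t = 0\<close>.\<close>
  define \<omega> where "\<omega> = (\<lambda>t. eps t / t)"
  have \<omega>_nonneg: "0 \<le> \<omega> t" if "t \<ge> 0" for t
    using eps_nonneg[OF that] that by (simp add: \<omega>_def)
  have \<omega>_small: "\<exists>t0>0. \<forall>t. 0 \<le> t \<longrightarrow> t < t0 \<longrightarrow> \<omega> t \<le> e" if e: "e > 0" for e
  proof -
    have "\<forall>\<^sub>F t in at_right 0. norm (eps t) \<le> e * norm t"
      by (rule landau_o.smallD[OF eps_o e])
    then obtain t0 where t0: "t0 > 0" "\<And>t. 0 < t \<Longrightarrow> t < t0 \<Longrightarrow> norm (eps t) \<le> e * norm t"
      unfolding eventually_at_right_field by blast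
    have "\<omega> t \<le> e" if t: "0 \<le> t" "t < t0" for t
    proof (cases "t = 0")
      case True
      then show ?thesis using e by (simp add: \<omega>_def)
    next
      case False
      then have "eps t \<le> e * t" using t0(2)[of t] t by simp
      then show ?thesis using False t by (simp add: \<omega>_def divide_le_eq)
    qed
    then show ?thesis using t0(1) by blast
  qed
  obtain t0 where t0: "t0 > 0" and \<omega>_le: "\<And>t. 0 \<le> t \<Longrightarrow> t < t0 \<Longrightarrow> \<omega> t \<le> qb / (2 * A)"
    using \<omega>_small[of "qb / (2 * A)"] qb A by auto
  \<comment> \<open>The last entry makes \<open>A * \<alpha> / c\<close> at most
    \<open>qb / 2\<close>; the others are required by \<open>step_contraction\<close> and
    \<open>step_exists\<close>.\<close>
  define cbar where "cbar = max (max 1 c1) (2 * A * \<alpha> / qb)"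
  have cbar: "cbar \<ge> 1" "cbar \<ge> c1" "cbar \<ge> 2 * A * \<alpha> / qb" by (auto simp: cbar_def)
  define \<delta> where "\<delta> = min (min \<delta>1 \<delta>2) (min \<delta>3 (t0 / \<kappa>r))"
  have \<delta>: "\<delta> > 0" using \<delta>1 \<delta>2 \<delta>3 t0 \<kappa>r by (simp add: \<delta>_def)
  define zbar where "zbar = (xbar, lbar)"
  have zS: "zbar \<in> Sol" using lbar_in_\<Lambda> by (simp add: zbar_def)
  define Dst where "Dst x l = infdist (x, l) Sol" for x l
  have D0: "Dst x l \<ge> 0" for x l by (simp add: Dst_def infdist_nonneg)
  have res0: "res x l \<ge> 0" for x l by (simp add: residual_def)
  have near: "norm (x - xbar) < \<delta>" "norm (l - lbar) < \<delta>" "res x l < t0"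
      "Dst x l \<le> \<kappa>r * res x l" "res x l \<le> \<kappa>r * Dst x l" if "norm ((x, l) - zbar) < \<delta>" for x l
  proof -
    show xl: "norm (x - xbar) < \<delta>" "norm (l - lbar) < \<delta>"
      using that norm_fst_le[of "x - xbar" "l - lbar"] norm_snd_le[of "l - lbar" "x - xbar"]
      by (simp_all add: zbar_def)
    then show "Dst x l \<le> \<kappa>r * res x l" and r: "res x l \<le> \<kappa>r * Dst x l"
      using rb[of x l] by (simp_all add: \<delta>_def Dst_def)
    have "Dst x l < t0 / \<kappa>r"
      using infdist_le[OF zS, of "(x, l)"] that by (simp add: Dst_def dist_norm \<delta>_def)
    then have "\<kappa>r * Dst x l < t0" using \<kappa>r by (simp add: field_simps)
    then show "res x l < t0" using r by linarith
  qed
  define q where "q x l c = A * (\<omega> (res x l) + \<alpha> / c)" for x l c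
  have q: "0 \<le> q x l c" "q x l c \<le> qb" if z: "norm ((x, l) - zbar) < \<delta>" and c: "cbar \<le> c" for x l c
  proof -
    have cpos: "c > 0" using c cbar by linarith
    have "0 \<le> \<alpha> / c" using \<alpha> cpos by simp
    then show "0 \<le> q x l c" using A \<omega>_nonneg[OF res0] by (simp add: q_def)
    have "2 * A * \<alpha> / qb \<le> c" using c cbar by linarith
    then have "\<alpha> / c \<le> qb / (2 * A)" using qb A cpos by (simp add: field_simps)
    moreover have "\<omega> (res x l) \<le> qb / (2 * A)" using near(3)[OF z] res0 by (intro \<omega>_le)
    ultimately have "q x l c \<le> A * (qb / (2 * A) + qb / (2 * A))"
      unfolding q_def using A by (intro mult_left_mono add_mono) auto
    also have "\<dots> = qb" using A by simp
    finally show "q x l c \<le> qb" .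
  qed
  have step: "norm ((x', l') - (x, l)) \<le> \<beta> * Dst x l" "Dst x' l' \<le> q x l c * Dst x l"
    if z: "norm ((x, l) - zbar) < \<delta>" and c: "cbar \<le> c"
      and st: "norm (grad_aug_lagrangian f g K x' l c + inverse c *\<^sub>R (x' - x)) \<le> eps (res x l)"
        "l' = multiplier_update K c (g x') l" "norm (x' - x) + norm (l' - l) \<le> \<alpha> * res x l" for x l x' l' c
  proof -
    have "norm ((x', l') - (x, l)) \<le> norm (x' - x) + norm (l' - l)"
      using norm_Pair_le[of "x' - x" "l' - l"] by simp
    also have "\<dots> \<le> \<alpha> * res x l" by (rule st(3))
    also have "\<dots> \<le> \<alpha> * (\<kappa>r * Dst x l)" using near(5)[OF z] \<alpha> by simp
    finally show "norm ((x', l') - (x, l)) \<le> \<beta> * Dst x l" by (simp add: \<beta>_def mult.assoc)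
    show "Dst x' l' \<le> q x l c * Dst x l"
    proof (cases "res x l = 0")
      case True
      then have "norm (x' - x) + norm (l' - l) \<le> 0" using st(3) by simp
      then have "norm (x' - x) = 0" "norm (l' - l) = 0"
        using norm_ge_zero[of "x' - x"] norm_ge_zero[of "l' - l"] by linarith+
      then have "x' = x" "l' = l" by simp_all
      moreover have "Dst x l = 0" using near(4)[OF z] True D0[of x l] by simp
      ultimately show ?thesis by simp
    next
      case False
      have sm: "norm (x - xbar) < \<delta>3" "norm (l - lbar) < \<delta>3" using near(1,2)[OF z] by (simp_all add: \<delta>_def)
      have c1': "c \<ge> 1" using c cbar by linarith
      have "Dst x' l' \<le> \<kappa> * (eps (res x l) + \<alpha> * res x l / c)"
        unfolding Dst_def by (rule con[OF sm c1' st])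
      also have "\<dots> = \<kappa> * (\<omega> (res x l) + \<alpha> / c) * res x l"
        using False by (simp add: \<omega>_def algebra_simps)
      also have "\<dots> \<le> \<kappa> * (\<omega> (res x l) + \<alpha> / c) * (\<kappa>r * Dst x l)"
        using near(5)[OF z] \<kappa> \<omega>_nonneg[OF res0, of x l] \<alpha> c1' by (intro mult_left_mono mult_nonneg_nonneg add_nonneg_nonneg) auto
      also have "\<dots> = q x l c * Dst x l" by (simp add: q_def A_def)
      finally show ?thesis .
    qed
  qed
  \<comment> \<open>The initial value of the Lyapunov function is at most
    \<open>(1 + 2 * \<beta>) * \<epsilon>\<^sub>0 = \<delta> / 2\<close>.\<close>
  define \<epsilon>\<^sub>0 where "\<epsilon>\<^sub>0 = \<delta> / (2 * (1 + 2 * \<beta>))"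
  have \<epsilon>\<^sub>0: "\<epsilon>\<^sub>0 > 0" "(1 + 2 * \<beta>) * \<epsilon>\<^sub>0 < \<delta>" using \<delta> \<beta> by (simp_all add: \<epsilon>\<^sub>0_def divide_simps)
  have start: "norm ((x0, l0) - zbar) + 2 * \<beta> * infdist (x0, l0) Sol < \<delta>" if "(x0, l0) \<in> cball (xbar, lbar) \<epsilon>\<^sub>0" for x0 l0
  proof -
    have "norm ((x0, l0) - zbar) \<le> \<epsilon>\<^sub>0"
      using that by (simp only: zbar_def mem_cball dist_norm norm_minus_commute)
    moreover have "infdist (x0, l0) Sol \<le> norm ((x0, l0) - zbar)"
      using infdist_le[OF zS] by (simp only: dist_norm)
    ultimately have "infdist (x0, l0) Sol \<le> \<epsilon>\<^sub>0" "norm ((x0, l0) - zbar) \<le> \<epsilon>\<^sub>0" by linarith+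
    then have "2 * \<beta> * infdist (x0, l0) Sol \<le> 2 * \<beta> * \<epsilon>\<^sub>0" using \<beta> by simp
    then show ?thesis using \<epsilon>\<^sub>0(2) \<open>norm ((x0, l0) - zbar) \<le> \<epsilon>\<^sub>0\<close> by (simp only: distrib_right)
  qed
  have existence: "\<exists>x l. x 0 = x0 \<and> l 0 = l0 \<and> pmm_sequence f g K eps \<alpha> c x l"
    if z0: "(x0, l0) \<in> cball (xbar, lbar) \<epsilon>\<^sub>0" and c: "\<forall>k. c k \<ge> cbar" for x0 l0 and c :: "nat \<Rightarrow> real"
  proof -
    \<comment> \<open>Steps exist only near \<open>zbar\<close>, so the dependent choice carries the
      Lyapunov bound along with the iterate; the clause for index 0 pins the starting point.\<close>
    define P where "P n z \<longleftrightarrow> (n = (0::nat) \<longrightarrow> z = (x0, l0)) \<and> norm (z - zbar) + 2 * \<beta> * infdist z Sol < \<delta>" for n z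
    define R where "R n z z' \<longleftrightarrow>
      norm (grad_aug_lagrangian f g K (fst z') (snd z) (c n) + inverse (c n) *\<^sub>R (fst z' - fst z)) \<le> eps (res (fst z) (snd z)) \<and>
      snd z' = multiplier_update K (c n) (g (fst z')) (snd z) \<and>
      norm (fst z' - fst z) + norm (snd z' - snd z) \<le> \<alpha> * res (fst z) (snd z)" for n z z'
    have "\<exists>F. \<forall>n. P n (F n) \<and> R n (F n) (F (Suc n))"
    proof (rule dependent_nat_choice)
      show "\<exists>z. P 0 z" using start[OF z0] by (auto simp: P_def)
      fix z n assume Pz: "P n z"
      obtain x l where z: "z = (x, l)" by (cases z)
      have inv: "norm ((x, l) - zbar) + 2 * \<beta> * infdist (x, l) Sol < \<delta>"
        using Pz unfolding P_def z by blast
      have "2 * \<beta> * infdist (x, l) Sol \<ge> 0" using \<beta> by (simp add: infdist_nonneg)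
      then have zn: "norm ((x, l) - zbar) < \<delta>" using inv by linarith
      have sm: "norm (x - xbar) < \<delta>2" "norm (l - lbar) < \<delta>2" using near(1,2)[OF zn] by (simp_all add: \<delta>_def)
      have "c1 \<le> c n" using c cbar order_trans by blast
      from ex[OF sm this] obtain x' where x': "grad_aug_lagrangian f g K x' l (c n) + inverse (c n) *\<^sub>R (x' - x) = 0"
        "norm (x' - x) + norm (multiplier_update K (c n) (g x') l - l) \<le> 7 * infdist (x, l) Sol" by blast
      define l' where "l' = multiplier_update K (c n) (g x') l"
      have "7 * infdist (x, l) Sol \<le> \<alpha> * res x l"
        using near(4)[OF zn] by (simp add: \<alpha>_def Dst_def)
      then have s3: "norm (x' - x) + norm (l' - l) \<le> \<alpha> * res x l" using x'(2) unfolding l'_def by linarith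
      have s1: "norm (grad_aug_lagrangian f g K x' l (c n) + inverse (c n) *\<^sub>R (x' - x)) \<le> eps (res x l)"
        unfolding x'(1) using eps_nonneg[OF res0] by simp
      have cn: "cbar \<le> c n" using c by blast
      have "q x l (c n) \<le> 1/2" using q(2)[OF zn cn] qb by linarith
      then have "norm ((x', l') - zbar) + 2 * \<beta> * infdist (x', l') Sol < \<delta>"
        using attraction_invariant[OF \<beta> inv, of "(x', l')" "q x l (c n)"]
          step[OF zn cn s1 l'_def s3] unfolding Dst_def by blast
      then have "P (Suc n) (x', l')" by (simp only: P_def) simp
      moreover have "R n z (x', l')" using s1 s3 by (simp add: R_def z l'_def)
      ultimately show "\<exists>z'. P (Suc n) z' \<and> R n z z'" by blast
    qed
    then obtain F where F: "\<And>n. P n (F n)" "\<And>n. R n (F n) (F (Suc n))" by blast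
    have "F 0 = (x0, l0)" using F(1)[of 0] by (simp add: P_def)
    moreover have "pmm_sequence f g K eps \<alpha> c (\<lambda>n. fst (F n)) (\<lambda>n. snd (F n))"
      using F(2) unfolding pmm_sequence_def R_def by blast
    ultimately show ?thesis
      by (intro exI[of _ "\<lambda>n. fst (F n)"] exI[of _ "\<lambda>n. snd (F n)"]) simp
  qed
  have convergence: "\<exists>lhat \<in> \<Lambda>.
             (\<lambda>k. (x k, l k)) \<longlonglongrightarrow> (xbar, lhat) \<and>
             converges_Q_linearly (\<lambda>k. (x k, l k)) (xbar, lhat) \<and>
             converges_Q_linearly (\<lambda>k. infdist (x k, l k) Sol) 0 \<and>
             (filterlim c at_top sequentially \<longrightarrow>
                converges_Q_superlinearly (\<lambda>k. (x k, l k)) (xbar, lhat) \<and>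
                converges_Q_superlinearly (\<lambda>k. infdist (x k, l k) Sol) 0)"
    if z0: "(x 0, l 0) \<in> cball (xbar, lbar) \<epsilon>\<^sub>0" and c: "\<forall>k. c k \<ge> cbar"
      and seq: "pmm_sequence f g K eps \<alpha> c x l" for x l and c :: "nat \<Rightarrow> real"
  proof -
    define z where "z k = (x k, l k)" for k
    define qk where "qk k = q (x k) (l k) (c k)" for k
    have st: "norm (z (Suc k) - z k) \<le> \<beta> * infdist (z k) Sol \<and>
        infdist (z (Suc k)) Sol \<le> qk k * infdist (z k) Sol \<and> 0 \<le> qk k \<and> qk k \<le> qb"
      if zn: "norm (z k - zbar) < \<delta>" for k
    proof -
      have ck: "cbar \<le> c k" using c by blast
      have s: "norm (grad_aug_lagrangian f g K (x (Suc k)) (l k) (c k) + inverse (c k) *\<^sub>R (x (Suc k) - x k)) \<le> eps (res (x k) (l k))"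
        "l (Suc k) = multiplier_update K (c k) (g (x (Suc k))) (l k)"
        "norm (x (Suc k) - x k) + norm (l (Suc k) - l k) \<le> \<alpha> * res (x k) (l k)"
        using seq unfolding pmm_sequence_def by blast+
      show ?thesis
        using step[OF zn[unfolded z_def] ck s] q[OF zn[unfolded z_def] ck] unfolding z_def qk_def Dst_def by blast
    qed
    have st': "norm (z (Suc k) - z k) \<le> \<beta> * infdist (z k) Sol \<and>
        infdist (z (Suc k)) Sol \<le> qk k * infdist (z k) Sol \<and> 0 \<le> qk k \<and> qk k \<le> 1/2"
      if "norm (z k - zbar) < \<delta>" for k
      using st[OF that] qb(2) order_trans by blast
    have i0: "norm (z 0 - zbar) + 2 * \<beta> * infdist (z 0) Sol < \<delta>"
      unfolding z_def by (rule start[OF z0])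
    note at = attraction[of Sol zbar \<beta> z \<delta> qk, OF closed_Sol zS \<beta> i0 st']
    have zn: "norm (z k - zbar) < \<delta>" for k using at(1) by blast
    obtain zhat where zhat: "zhat \<in> Sol" "z \<longlonglongrightarrow> zhat" and Dlim: "(\<lambda>k. infdist (z k) Sol) \<longlonglongrightarrow> 0"
      and rate: "\<And>k. norm (z (Suc k) - zhat) \<le> 2 * \<beta> * qk k * norm (z k - zhat)"
      using at(2) by blast
    then obtain lhat where lhat: "lhat \<in> \<Lambda>" "zhat = (xbar, lhat)" by auto
    have qk: "0 \<le> qk k" "qk k \<le> qb" for k using st[OF zn] by blast+
    have Drate: "infdist (z (Suc k)) Sol \<le> qk k * infdist (z k) Sol" for k using st[OF zn] by blast
    have "norm (z (Suc k) - zhat) \<le> (2 * \<beta> * qb) * norm (z k - zhat)" for k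
    proof -
      have "2 * \<beta> * qk k * norm (z k - zhat) \<le> 2 * \<beta> * qb * norm (z k - zhat)"
        using qk(2)[of k] \<beta> by (intro mult_right_mono mult_left_mono) auto
      then show ?thesis using rate[of k] by linarith
    qed
    then have lin1: "converges_Q_linearly z zhat"
      unfolding converges_Q_linearly_def using zhat qb \<beta>
      by (intro conjI exI[of _ "2 * \<beta> * qb"] always_eventually allI) auto
    have "infdist (z (Suc k)) Sol \<le> qb * infdist (z k) Sol" for k
      using Drate[of k] mult_right_mono[OF qk(2) infdist_nonneg, of k "z k" Sol] by linarith
    then have lin2: "converges_Q_linearly (\<lambda>k. infdist (z k) Sol) 0"
      unfolding converges_Q_linearly_def using Dlim qb
      by (intro conjI exI[of _ qb] always_eventually allI) (auto simp: infdist_nonneg)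
    have sup: "converges_Q_superlinearly z zhat \<and> converges_Q_superlinearly (\<lambda>k. infdist (z k) Sol) 0"
      if ctop: "filterlim c at_top sequentially"
    proof -
      define r where "r k = res (x k) (l k)" for k
      have "(\<lambda>k. \<kappa>r * infdist (z k) Sol) \<longlonglongrightarrow> 0" by (rule tendsto_mult_right_zero[OF Dlim])
      moreover have "r k \<le> \<kappa>r * infdist (z k) Sol" for k
        using near(5)[OF zn[of k, unfolded z_def]] by (simp add: r_def z_def Dst_def)
      ultimately have rlim: "r \<longlonglongrightarrow> 0"
        by (intro tendsto_sandwich[of "\<lambda>_. 0" r sequentially "\<lambda>k. \<kappa>r * infdist (z k) Sol" 0] tendsto_const
            always_eventually allI) (auto simp: r_def res0)
      have "(\<lambda>k. \<omega> (r k)) \<longlonglongrightarrow> 0"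
      proof (rule LIMSEQ_I)
        fix e :: real assume e: "e > 0"
        then obtain t1 where t1: "t1 > 0" "\<And>t. 0 \<le> t \<Longrightarrow> t < t1 \<Longrightarrow> \<omega> t \<le> e / 2"
          using \<omega>_small[of "e / 2"] by auto
        obtain N where N: "\<And>k. k \<ge> N \<Longrightarrow> r k < t1"
          using order_tendstoD(2)[OF rlim t1(1)] unfolding eventually_sequentially by blast
        have "norm (\<omega> (r k) - 0) < e" if "k \<ge> N" for k
          using t1(2)[of "r k"] N[OF that] \<omega>_nonneg[of "r k"] res0 e by (simp add: r_def)
        then show "\<exists>N. \<forall>k\<ge>N. norm (\<omega> (r k) - 0) < e" by blast
      qed
      moreover have "(\<lambda>k. \<alpha> / c k) \<longlonglongrightarrow> 0"
        by (rule tendsto_divide_0[OF tendsto_const filterlim_at_top_imp_at_infinity[OF ctop]])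
      ultimately have "(\<lambda>k. A * (\<omega> (r k) + \<alpha> / c k)) \<longlonglongrightarrow> A * (0 + 0)"
        by (intro tendsto_mult tendsto_add tendsto_const)
      then have qlim: "qk \<longlonglongrightarrow> 0" by (simp add: qk_def[abs_def] q_def r_def)
      have "(\<lambda>k. 2 * \<beta> * qk k) \<longlonglongrightarrow> 0" by (rule tendsto_mult_right_zero[OF qlim])
      then have "converges_Q_superlinearly z zhat"
        unfolding converges_Q_superlinearly_def using zhat rate by blast
      moreover have "converges_Q_superlinearly (\<lambda>k. infdist (z k) Sol) 0"
        unfolding converges_Q_superlinearly_def using Dlim Drate qlim
        by (intro conjI exI[of _ qk]) (auto simp: infdist_nonneg)
      ultimately show ?thesis by blast
    qed
    show ?thesis
      using lhat(1) zhat(2) lin1 lin2 sup unfolding lhat(2) z_def[abs_def] by blast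
  qed
  have "cbar > 0" using cbar by linarith
  show ?thesis
  proof (rule exI[of _ \<alpha>], rule conjI[OF \<alpha>], rule exI[of _ cbar], rule conjI[OF \<open>cbar > 0\<close>],
      rule exI[of _ \<epsilon>\<^sub>0], rule conjI[OF \<epsilon>\<^sub>0(1)], intro allI impI, rule conjI, goal_cases)
    case (1 x0 l0 c)
    then show ?case by (rule existence)
  next
    case (2 x0 l0 c)
    show ?case
    proof (intro allI impI)
      fix x l assume "x 0 = x0" "l 0 = l0" "pmm_sequence f g K eps \<alpha> c x l"
      then show "\<exists>lhat \<in> \<Lambda>.
             (\<lambda>k. (x k, l k)) \<longlonglongrightarrow> (xbar, lhat) \<and>
             converges_Q_linearly (\<lambda>k. (x k, l k)) (xbar, lhat) \<and>
             converges_Q_linearly (\<lambda>k. infdist (x k, l k) Sol) 0 \<and>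
             (filterlim c at_top sequentially \<longrightarrow>
                converges_Q_superlinearly (\<lambda>k. (x k, l k)) (xbar, lhat) \<and>
                converges_Q_superlinearly (\<lambda>k. infdist (x k, l k) Sol) 0)"
        using 2 by (intro convergence) simp_all
    qed
  qed
qed

end

theorem theorem3p1:
  fixes f :: "'x::euclidean_space \<Rightarrow> real"
    and g :: "'x \<Rightarrow> 'h::euclidean_space"
    and K :: "'h set"
    and xbar :: 'x and lbar :: 'h
    and eps :: "real \<Rightarrow> real"
  assumes "twice_differentiable f" and "twice_differentiable g"
    and "K \<noteq> {}" and "closed K" and "convex K" and "C2_cone_reducible K"
    and "KKT_point f g K xbar lbar"
    and "SOSC f g K xbar lbar"
    and "multiplier_map_calm f g K xbar lbar"
    and "\<And>t. t \<ge> 0 \<Longrightarrow> eps t \<ge> 0" and "eps \<in> o[at_right 0](\<lambda>t. t)"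
  shows "\<exists>\<alpha>>0. \<exists>cbar>0. \<exists>\<epsilon>\<^sub>0>0.
    \<forall>x0 l0 (c :: nat \<Rightarrow> real).
      (x0, l0) \<in> cball (xbar, lbar) \<epsilon>\<^sub>0 \<longrightarrow> (\<forall>k. c k \<ge> cbar) \<longrightarrow>
        (\<exists>x l. x 0 = x0 \<and> l 0 = l0 \<and> pmm_sequence f g K eps \<alpha> c x l) \<and>
        (\<forall>x l. x 0 = x0 \<longrightarrow> l 0 = l0 \<longrightarrow> pmm_sequence f g K eps \<alpha> c x l \<longrightarrow>
          (\<exists>lhat \<in> multiplier_set f g K xbar.
             (\<lambda>k. (x k, l k)) \<longlonglongrightarrow> (xbar, lhat) \<and>
             converges_Q_linearly (\<lambda>k. (x k, l k)) (xbar, lhat) \<and>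
             converges_Q_linearly
               (\<lambda>k. infdist (x k, l k) ({xbar} \<times> multiplier_set f g K xbar)) 0 \<and>
             (filterlim c at_top sequentially \<longrightarrow>
                converges_Q_superlinearly (\<lambda>k. (x k, l k)) (xbar, lhat) \<and>
                converges_Q_superlinearly
                  (\<lambda>k. infdist (x k, l k) ({xbar} \<times> multiplier_set f g K xbar)) 0)))"
proof -
  obtain f' :: "'x \<Rightarrow> 'x \<Rightarrow>\<^sub>L real" where f': "\<And>x. (f has_derivative f' x) (at x)" "f' differentiable (at xbar)"
    using assms(1) unfolding twice_differentiable_def by blast
  obtain g' :: "'x \<Rightarrow> 'x \<Rightarrow>\<^sub>L 'h" where g': "\<And>x. (g has_derivative g' x) (at x)" "g' differentiable (at xbar)"
    using assms(2) unfolding twice_differentiable_def by blast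
  obtain f'' where f'': "(f' has_derivative blinfun_apply f'') (at xbar)"
    using f'(2) unfolding differentiable_def by (metis bounded_linear_Blinfun_apply has_derivative_bounded_linear)
  obtain g'' where g'': "(g' has_derivative blinfun_apply g'') (at xbar)"
    using g'(2) unfolding differentiable_def by (metis bounded_linear_Blinfun_apply has_derivative_bounded_linear)
  have "g xbar \<in> K" using assms(7) by (simp add: KKT_point_def normal_cone_def)
  then obtain \<Phi> \<Phi>' \<Phi>'' D r where "straightening K (g xbar) \<Phi> \<Phi>' \<Phi>'' D r"
    using C2_cone_reducible_straightening[OF assms(6)] by blast
  then interpret kkt_setting K g xbar \<Phi> \<Phi>' \<Phi>'' D r f lbar f' g' f'' g''
    using f' g' f'' g'' assms(3-9) by (intro kkt_setting.intro kkt_setting_axioms.intro) auto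
  show ?thesis using assms(10,11) by (rule local_convergence)
qed

end
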